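(* Let $\mathcal H=\mathbb R^d$ with $d<\infty$. Assume unbiased quantization, the fourth-moment assumption (constant $\alpha_B$), the noise assumption (constant $\sigma^2$), zero initialization $\mathbf w_0=\mathbf 0$, and that for each $i\in\{d,l,p,a,o\}$ the quantization $\mathcal Q_i$ is $\epsilon_i$-additive. Suppose $\gamma<\frac{1}{\alpha_B\mathrm{tr}(\mathbf H+\epsilon_d\mathbf I)}$. Then $$\mathbb E[\mathcal E(\overline{\mathbf w}_N)]\le\mathrm{ApproxErr}+2\,\mathrm{VarErr}+2\,\mathrm{BiasErr},$$ where $\mathrm{ApproxErr}=\epsilon_l+\frac{3\epsilon_d}{2}\|\mathbf w^*\|^2_{\mathbf H(\mathbf H+\epsilon_d\mathbf I)^{-2}\mathbf H}+\frac{\epsilon_d^2}{2}\|\mathbf w^*\|^2_{(\mathbf H+\epsilon_d\mathbf I)^{-1}\mathbf H(\mathbf H+\epsilon_d\mathbf I)^{-1}}$, $\mathrm{BiasErr}=\frac{1}{\gamma^2N^2}\|\mathbf w^{(q)*}\|^2_{(\mathbf H^{(q)}_{0:k^*})^{-1}}+\|\mathbf w^{(q)*}\|^2_{\mathbf H^{(q)}_{k^*:\infty}}$, $$\mathrm{VarErr}=\frac{{\sigma_A^{(q)}}^2+\frac{2\alpha_B}{N\gamma}\big(\|\mathbf w^{(q)*}\|^2_{\mathbf I^{(q)}_{0:k^*}}+N\gamma\|\mathbf w^{(q)*}\|^2_{\mathbf H^{(q)}_{k^*:\infty}}\big)}{1-\gamma\alpha_B\mathrm{tr}(\mathbf H+\epsilon_d\mathbf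 I)}\Big(\frac{k^*}{N}+N\gamma^2\sum_{i>k^*}(\lambda_i+\epsilon_d)^2\Big),$$ with ${\sigma_A^{(q)}}^2=\frac{\epsilon_o+\epsilon_a}{B}+\alpha_B\epsilon_p\mathrm{tr}(\mathbf H+\epsilon_d\mathbf I)+\frac{\sigma^2}{B}$.
   Context: Setting: $(\mathbf x,y)\in\mathbb R^d\times\mathbb R$ with distribution $\mathcal D$; $L(\mathbf w)=\frac12\mathbb E[(y-\langle\mathbf w,\mathbf x\rangle)^2]$; $\mathbf H=\mathbb E[\mathbf x\mathbf x^\top]=\sum_i\lambda_i\mathbf v_i\mathbf v_i^\top$ strictly positive definite ($\lambda_i$ nonincreasing), $\mathbf w^*=\arg\min L$, $\mathcal E(\mathbf w)=L(\mathbf w)-L(\mathbf w^* )$. Quantization operators $\mathcal Q_d,\mathcal Q_l,\mathcal Q_p,\mathcal Q_a,\mathcal Q_o$ are random coordinatewise maps, mutually independent, fresh randomness at each application (data quantization per sample), unbiased: $\mathbb E[\mathcal Q_i(\mathbf u)\mid\mathbf u]=\mathbf u$. A quantization $\mathcal Q$ is $\epsilon$-additive if $\mathbb E[(\mathcal Q(\mathbf u)-\mathbf u)(\mathcal Q(\mathbf u)-\mathbf u)^\top\mid\mathbf u]=\epsilon\mathbf I$ for every input $\mathbf u$ (scalar case: $=\epsilon$). Quantized SGD: batches $(\mathbf X_t,\mathbf y_t)$ of $B$ i.i.d. samples, fresh each step; $\mathbf w_t=\mathbf w_{t-1}+\frac{\gamma}{B}\mathcal Q_d(\mathbf X_t)^\top\mathcal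 Q_o\big(\mathcal Q_l(\mathbf y_t)-\mathcal Q_a(\mathcal Q_d(\mathbf X_t)\mathcal Q_p(\mathbf w_{t-1}))\big)$, $t=1,\dots,N$; $\overline{\mathbf w}_N=\frac1N\sum_{t=0}^{N-1}\mathbf w_t$. $\mathbf H^{(q)}=\mathbb E[\mathcal Q_d(\mathbf x)\mathcal Q_d(\mathbf x)^\top]$ (here $=\mathbf H+\epsilon_d\mathbf I$) with eigenvalues $\lambda^{(q)}_i$ and eigenvectors $\mathbf v^{(q)}_i$; $\mathbf w^{(q)*}=\arg\min_{\mathbf w}\mathbb E[(\mathcal Q_l(y)-\langle\mathbf w,\mathcal Q_d(\mathbf x)\rangle)^2]$; $\xi=\mathcal Q_l(y)-\langle\mathbf w^{(q)*},\mathcal Q_d(\mathbf x)\rangle$. Fourth-moment assumption: for every PSD $\mathbf A$, $\mathbb E[\mathbf x^{(q)}\mathbf x^{(q)\top}\mathbf A\mathbf x^{(q)}\mathbf x^{(q)\top}]\preceq\alpha_B\mathrm{tr}(\mathbf H^{(q)}\mathbf A)\mathbf H^{(q)}$ ($\mathbf x^{(q)}=\mathcal Q_d(\mathbf x)$) and $\mathbb E[\frac{1}{B^2}\mathcal Q_d(\mathbf X)^\top\mathcal Q_d(\mathbf X)\mathbf A\mathcal Q_d(\mathbf X)^\top\mathcal Q_d(\mathbf X)]\preceq\alpha_B\mathrm{tr}(\mathbf H^{(q)}\mathbf A)\mathbf H^{(q)}$ for a batch. Noise assumption: $\mathbb E[\xi^2\mathcal Q_d(\mathbf x)\mathcal Q_d(\mathbf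 x)^\top]\preceq\sigma^2\mathbf H^{(q)}$. Notation: $\mathbf H^{(q)}_{0:k}=\sum_{i\le k}\lambda^{(q)}_i\mathbf v^{(q)}_i\mathbf v^{(q)\top}_i$, $\mathbf H^{(q)}_{k:\infty}=\sum_{i>k}\lambda^{(q)}_i\mathbf v^{(q)}_i\mathbf v^{(q)\top}_i$, $\mathbf I^{(q)}_{0:k}=\sum_{i\le k}\mathbf v^{(q)}_i\mathbf v^{(q)\top}_i$, $(\mathbf H^{(q)}_{0:k})^{-1}=\sum_{i\le k}(\lambda^{(q)}_i)^{-1}\mathbf v^{(q)}_i\mathbf v^{(q)\top}_i$; $\|\mathbf w\|^2_{\mathbf M}=\mathbf w^\top\mathbf M\mathbf w$; $k^*=\max\{k:\lambda^{(q)}_k\ge\frac1{N\gamma}\}$. *)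

theory Defs
  imports "HOL-Probability.Probability"
begin

definition outer :: "real^'n \<Rightarrow> real^'n \<Rightarrow> real^'n^'n" where
  "outer u v = (\<chi> i j. u$i * v$j)"

definition loewner_le :: "real^'n^'n \<Rightarrow> real^'n^'n \<Rightarrow> bool" where
  "loewner_le A B \<longleftrightarrow> (\<forall>v. v \<bullet> (A *v v) \<le> v \<bullet> (B *v v))"

definition psd :: "real^'n^'n \<Rightarrow> bool" where
  "psd A \<longleftrightarrow> transpose A = A \<and> (\<forall>v. 0 \<le> v \<bullet> (A *v v))"

definition mnorm2 :: "real^'n \<Rightarrow> real^'n^'n \<Rightarrow> real" where
  "mnorm2 w M = w \<bullet> (M *v w)"

definition sorted_eigendecomp :: "real^'n^'n \<Rightarrow> (nat \<Rightarrow> real) \<Rightarrow> (nat \<Rightarrow> real^'n) \<Rightarrow> bool" where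
  "sorted_eigendecomp M lam v \<longleftrightarrow>
     (\<forall>i\<in>{1..CARD('n)}. \<forall>j\<in>{1..CARD('n)}. v i \<bullet> v j = (if i = j then 1 else 0)) \<and>
     M = (\<Sum>i=1..CARD('n). lam i *\<^sub>R outer (v i) (v i)) \<and>
     (\<forall>i j. 1 \<le> i \<longrightarrow> i \<le> j \<longrightarrow> j \<le> CARD('n) \<longrightarrow> lam j \<le> lam i)"

definition head_mat :: "(nat \<Rightarrow> real) \<Rightarrow> (nat \<Rightarrow> real^'n) \<Rightarrow> nat \<Rightarrow> real^'n^'n" where
  "head_mat lam v k = (\<Sum>i=1..k. lam i *\<^sub>R outer (v i) (v i))"
definition head_inv :: "(nat \<Rightarrow> real) \<Rightarrow> (nat \<Rightarrow> real^'n) \<Rightarrow> nat \<Rightarrow> real^'n^'n" where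
  "head_inv lam v k = (\<Sum>i=1..k. inverse (lam i) *\<^sub>R outer (v i) (v i))"
definition head_id :: "(nat \<Rightarrow> real^'n) \<Rightarrow> nat \<Rightarrow> real^'n^'n" where
  "head_id v k = (\<Sum>i=1..k. outer (v i) (v i))"
definition tail_mat :: "(nat \<Rightarrow> real) \<Rightarrow> (nat \<Rightarrow> real^'n) \<Rightarrow> nat \<Rightarrow> real^'n^'n" where
  "tail_mat lam v k = (\<Sum>i\<in>{k<..CARD('n)}. lam i *\<^sub>R outer (v i) (v i))"

definition kstar :: "nat \<Rightarrow> (nat \<Rightarrow> real) \<Rightarrow> nat \<Rightarrow> real \<Rightarrow> nat" where
  "kstar d lamq N \<gamma> = Max ({0} \<union> {k\<in>{1..d}. lamq k \<ge> 1 / (real N * \<gamma>)})"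

definition vec_quantizer :: "(real^'n \<Rightarrow> (real^'n) measure) \<Rightarrow> bool" where
  "vec_quantizer Q \<longleftrightarrow> Q \<in> borel \<rightarrow>\<^sub>M prob_algebra borel"

definition unbiased_vq :: "(real^'n \<Rightarrow> (real^'n) measure) \<Rightarrow> bool" where
  "unbiased_vq Q \<longleftrightarrow> (\<forall>u. integrable (Q u) (\<lambda>v. v) \<and> (LINT v|Q u. v) = u)"

definition additive_vq :: "real \<Rightarrow> (real^'n \<Rightarrow> (real^'n) measure) \<Rightarrow> bool" where
  "additive_vq eps Q \<longleftrightarrow> (\<forall>u. integrable (Q u) (\<lambda>v. outer (v - u) (v - u)) \<and>
       (LINT v|Q u. outer (v - u) (v - u)) = eps *\<^sub>R mat 1)"

definition coordinatewise_vq :: "(real^'n \<Rightarrow> (real^'n) measure) \<Rightarrow> bool" where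
  "coordinatewise_vq Q \<longleftrightarrow> (\<forall>u u' j. u$j = u'$j \<longrightarrow>
       distr (Q u) borel (\<lambda>v. v$j) = distr (Q u') borel (\<lambda>v. v$j))"

definition scal_quantizer :: "(real \<Rightarrow> real measure) \<Rightarrow> bool" where
  "scal_quantizer Q \<longleftrightarrow> Q \<in> borel \<rightarrow>\<^sub>M prob_algebra borel"

definition unbiased_sq :: "(real \<Rightarrow> real measure) \<Rightarrow> bool" where
  "unbiased_sq Q \<longleftrightarrow> (\<forall>u. integrable (Q u) (\<lambda>v. v) \<and> (LINT v|Q u. v) = u)"

definition additive_sq :: "real \<Rightarrow> (real \<Rightarrow> real measure) \<Rightarrow> bool" where
  "additive_sq eps Q \<longleftrightarrow> (\<forall>u. integrable (Q u) (\<lambda>v. (v - u)^2) \<and> (LINT v|Q u. (v - u)^2) = eps)"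

definition risk :: "((real^'n) \<times> real) measure \<Rightarrow> real^'n \<Rightarrow> real" where
  "risk D w = (1/2) * (LINT z|D. (snd z - w \<bullet> fst z)^2)"

definition qdata :: "((real^'n) \<times> real) measure \<Rightarrow> (real^'n \<Rightarrow> (real^'n) measure)
     \<Rightarrow> (real \<Rightarrow> real measure) \<Rightarrow> ((real^'n) \<times> real) measure" where
  "qdata D Qd Ql = D \<bind> (\<lambda>z. Qd (fst z) \<bind> (\<lambda>xq. Ql (snd z) \<bind> (\<lambda>yq. return borel (xq, yq))))"

definition qrisk :: "((real^'n) \<times> real) measure \<Rightarrow> real^'n \<Rightarrow> real" where
  "qrisk Dq w = (LINT z|Dq. (snd z - w \<bullet> fst z)^2)"

definition second_moment :: "((real^'n) \<times> real) measure \<Rightarrow> real^'n^'n" where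
  "second_moment M = (LINT z|M. outer (fst z) (fst z))"

text \<open>law of Q_d(X)^T Q_d(X) for a fresh batch of b quantized samples\<close>
primrec gram_batch :: "((real^'n) \<times> real) measure \<Rightarrow> nat \<Rightarrow> (real^'n^'n) measure" where
  "gram_batch Dq 0 = return borel 0"
| "gram_batch Dq (Suc b) = gram_batch Dq b \<bind> (\<lambda>G. Dq \<bind> (\<lambda>z. return borel (G + outer (fst z) (fst z))))"

definition fourth_moment_assm :: "real \<Rightarrow> nat \<Rightarrow> ((real^'n) \<times> real) measure \<Rightarrow> bool" where
  "fourth_moment_assm \<alpha> B Dq \<longleftrightarrow> (\<forall>A. psd A \<longrightarrow>
     (integrable Dq (\<lambda>z. outer (fst z) (fst z) ** A ** outer (fst z) (fst z)) \<and>
      loewner_le (LINT z|Dq. outer (fst z) (fst z) ** A ** outer (fst z) (fst z))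
                 ((\<alpha> * trace (second_moment Dq ** A)) *\<^sub>R second_moment Dq)) \<and>
     (integrable (gram_batch Dq B) (\<lambda>G. (1 / (real B)^2) *\<^sub>R (G ** A ** G)) \<and>
      loewner_le (LINT G|gram_batch Dq B. (1 / (real B)^2) *\<^sub>R (G ** A ** G))
                 ((\<alpha> * trace (second_moment Dq ** A)) *\<^sub>R second_moment Dq)))"

definition noise_assm :: "real \<Rightarrow> real^'n \<Rightarrow> ((real^'n) \<times> real) measure \<Rightarrow> bool" where
  "noise_assm \<sigma>2 wq Dq \<longleftrightarrow>
     integrable Dq (\<lambda>z. (snd z - wq \<bullet> fst z)^2 *\<^sub>R outer (fst z) (fst z)) \<and>
     loewner_le (LINT z|Dq. (snd z - wq \<bullet> fst z)^2 *\<^sub>R outer (fst z) (fst z)) (\<sigma>2 *\<^sub>R second_moment Dq)"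

text \<open>one sample's contribution Q_d(x) * Q_o(Q_l(y) - Q_a(<Q_d(x), wq>)), wq = Q_p(w) fixed for the batch\<close>
definition sample_grad :: "((real^'n) \<times> real) measure \<Rightarrow> (real^'n \<Rightarrow> (real^'n) measure)
   \<Rightarrow> (real \<Rightarrow> real measure) \<Rightarrow> (real \<Rightarrow> real measure) \<Rightarrow> (real \<Rightarrow> real measure)
   \<Rightarrow> real^'n \<Rightarrow> (real^'n) measure" where
  "sample_grad D Qd Ql Qa Qo wq =
     D \<bind> (\<lambda>z. Qd (fst z) \<bind> (\<lambda>xq. Ql (snd z) \<bind> (\<lambda>yq. Qa (xq \<bullet> wq) \<bind>
       (\<lambda>aq. Qo (yq - aq) \<bind> (\<lambda>oq. return borel (oq *\<^sub>R xq))))))"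

primrec batch_grad :: "((real^'n) \<times> real) measure \<Rightarrow> (real^'n \<Rightarrow> (real^'n) measure)
   \<Rightarrow> (real \<Rightarrow> real measure) \<Rightarrow> (real \<Rightarrow> real measure) \<Rightarrow> (real \<Rightarrow> real measure)
   \<Rightarrow> real^'n \<Rightarrow> nat \<Rightarrow> (real^'n) measure" where
  "batch_grad D Qd Ql Qa Qo wq 0 = return borel 0"
| "batch_grad D Qd Ql Qa Qo wq (Suc b) =
     batch_grad D Qd Ql Qa Qo wq b \<bind> (\<lambda>g. sample_grad D Qd Ql Qa Qo wq \<bind> (\<lambda>c. return borel (g + c)))"

text \<open>w_t = w_{t-1} + gamma/B * Q_d(X_t)^T Q_o(Q_l(y_t) - Q_a(Q_d(X_t) Q_p(w_{t-1})))\<close>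
definition sgd_step :: "((real^'n) \<times> real) measure \<Rightarrow> (real^'n \<Rightarrow> (real^'n) measure)
   \<Rightarrow> (real \<Rightarrow> real measure) \<Rightarrow> (real^'n \<Rightarrow> (real^'n) measure) \<Rightarrow> (real \<Rightarrow> real measure)
   \<Rightarrow> (real \<Rightarrow> real measure) \<Rightarrow> real \<Rightarrow> nat \<Rightarrow> real^'n \<Rightarrow> (real^'n) measure" where
  "sgd_step D Qd Ql Qp Qa Qo \<gamma> B w =
     Qp w \<bind> (\<lambda>wq. batch_grad D Qd Ql Qa Qo wq B \<bind> (\<lambda>g. return borel (w + (\<gamma> / real B) *\<^sub>R g)))"

text \<open>law of (w_t, sum_{s<t} w_s), started at w_0 = 0\<close>
primrec sgd_traj :: "((real^'n) \<times> real) measure \<Rightarrow> (real^'n \<Rightarrow> (real^'n) measure)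
   \<Rightarrow> (real \<Rightarrow> real measure) \<Rightarrow> (real^'n \<Rightarrow> (real^'n) measure) \<Rightarrow> (real \<Rightarrow> real measure)
   \<Rightarrow> (real \<Rightarrow> real measure) \<Rightarrow> real \<Rightarrow> nat \<Rightarrow> nat \<Rightarrow> ((real^'n) \<times> (real^'n)) measure" where
  "sgd_traj D Qd Ql Qp Qa Qo \<gamma> B 0 = return borel (0, 0)"
| "sgd_traj D Qd Ql Qp Qa Qo \<gamma> B (Suc t) =
     sgd_traj D Qd Ql Qp Qa Qo \<gamma> B t \<bind>
       (\<lambda>s. sgd_step D Qd Ql Qp Qa Qo \<gamma> B (fst s) \<bind> (\<lambda>w'. return borel (w', snd s + fst s)))"

end

(*
  Up to the approximation error, the excess risk of w is at most half the squared distance from w to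
  the quantized minimizer w^(q)* in the norm of H^(q). In the eigenbasis of H^(q) the mean error of
  SGD contracts exactly, coordinate i by 1 - gamma lambda_i in each step, and its second moment obeys
  a scalar recursion coupled to the other coordinates only through the total energy
  sum_j lambda_j U_j. The one awkward term, the correlation between residual noise and signal, is
  linear in the current error, so only the mean error enters it; nonnegativity of the gradient second
  moment at the reflected mean bounds it. Summing the recursion over t, solving for the total energy
  by gamma alpha tr H^(q) < 1, and using that the mean error contracts to bound the correlations
  inside the averaged iterate, every coordinate contributes through
  p_i = 1 - (1 - gamma lambda_i)^N <= min(1, N gamma lambda_i); splitting at k* gives the bound.
*)
theory Submission
  imports Defs
begin

section \<open>Expectations along kernels\<close>

text \<open>The obstacle is the residual \<open>\<xi>\<close>: it is uncorrelated with the quantized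
  input but need not be independent of it, so the second moment of the gradient keeps a third-order
  term. The two factors 2 of the conclusion have one origin: the bound at the reflected mean costs a
  second copy of the noise, and adding the squared mean to the error moments, which absorbs the rest
  of that bound, doubles the initial error. The matrix assumptions enter only at rank-one matrices d
  d^T tested on vectors u; this turns them into scalar inequalities in the energy d \<bullet> K d.
  The conclusion is a bound on a nonnegative integral, so it also asserts finiteness. Signed
  expectations pass through a kernel only when integrability is known; therefore second moments are
  shown finite before means and correlations are computed. The approximation error arises because
  quantizing the data adds a ridge penalty \<epsilon>d |w|^2 to the least-squares objective.\<close>

abbreviation prob_measures :: "'a::topological_space measure set" where
  "prob_measures \<equiv> space (prob_algebra borel)"

abbreviation kernel :: "('a::topological_space \<Rightarrow> 'b::topological_space measure) \<Rightarrow> bool" where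
  "kernel K \<equiv> K \<in> borel \<rightarrow>\<^sub>M prob_algebra borel"

lemma prob_measuresD:
  assumes "M \<in> prob_measures"
  shows "prob_space M" "sets M = sets borel" "space M = UNIV"
    "borel_measurable M = borel_measurable borel"
  using assms by (auto simp: space_prob_algebra dest: sets_eq_imp_space_eq intro: measurable_cong_sets)

lemma kernel_prob_measures: "kernel K \<Longrightarrow> K x \<in> prob_measures"
  using measurable_space[of K borel "prob_algebra borel" x] by simp

lemma bind_prob_measures: "M \<in> prob_measures \<Longrightarrow> kernel K \<Longrightarrow> M \<bind> K \<in> prob_measures"
  by (simp add: space_prob_algebra sets_bind' prob_space_bind')

lemma kernel_in_subprob:
  assumes "M \<in> prob_measures" "kernel K"
  shows "K \<in> M \<rightarrow>\<^sub>M subprob_algebra borel"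
  using measurable_prob_algebraD[OF assms(2)] assms(1)
  by (simp add: space_prob_algebra cong: measurable_cong_sets)

lemma nn_integral_bind_kernel:
  assumes "M \<in> prob_measures" "kernel K" "f \<in> borel_measurable borel"
  shows "(\<integral>\<^sup>+x. f x \<partial>(M \<bind> K)) = (\<integral>\<^sup>+x. \<integral>\<^sup>+y. f y \<partial>K x \<partial>M)"
  by (rule nn_integral_bind[OF assms(3) kernel_in_subprob[OF assms(1,2)]])

lemma borel_measurable_prob_measures:
  "M \<in> prob_measures \<Longrightarrow> f \<in> borel_measurable borel \<Longrightarrow> f \<in> borel_measurable M"
  by (simp add: prob_measuresD(4))

lemma kernel_integral_measurable:
  fixes f :: "'b::topological_space \<Rightarrow> real"
  assumes "kernel K" "f \<in> borel_measurable borel"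
  shows "(\<lambda>x. \<integral>y. f y \<partial>K x) \<in> borel_measurable borel"
  using measurable_compose[OF measurable_prob_algebraD[OF assms(1)]
      integral_measurable_subprob_algebra[OF assms(2)]] by simp

text \<open>\<open>f\<close> may change sign and is integrable only over the composite, so on a null
  set of x it can fail to be integrable over \<open>K x\<close>, where its Bochner integral is 0 by
  default. The formula for nonnegative integrals has no such exception, hence the detour over
  positive and negative parts.\<close>

lemma integral_bind_kernel:
  fixes f :: "'b::topological_space \<Rightarrow> real"
  assumes M: "M \<in> prob_measures" and K: "kernel K" and f: "f \<in> borel_measurable borel"
    and int: "integrable (M \<bind> K) f"
  shows "integrable M (\<lambda>x. \<integral>y. f y \<partial>K x)"
    and "(\<integral>y. f y \<partial>(M \<bind> K)) = (\<integral>x. (\<integral>y. f y \<partial>K x) \<partial>M)"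
proof -
  have mK: "f \<in> borel_measurable (K x)" for x
    using borel_measurable_prob_measures[OF kernel_prob_measures[OF K] f] .
  have fin: "(\<integral>\<^sup>+x. \<integral>\<^sup>+y. ennreal \<bar>f y\<bar> \<partial>K x \<partial>M) < \<infinity>"
    using int f unfolding integrable_iff_bounded
    by (subst nn_integral_bind_kernel[OF M K, symmetric]) auto
  have nnm: "(\<lambda>x. \<integral>\<^sup>+y. g y \<partial>K x) \<in> borel_measurable M" if "g \<in> borel_measurable borel" for g
    using measurable_compose[OF kernel_in_subprob[OF M K] nn_integral_measurable_subprob_algebra[OF that]] .
  have ae: "AE x in M. (\<integral>\<^sup>+y. ennreal \<bar>f y\<bar> \<partial>K x) \<noteq> \<infinity>"
    by (rule nn_integral_PInf_AE[OF nnm]) (use f fin in auto)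
  have aei: "AE x in M. integrable (K x) f"
    using ae by eventually_elim (auto simp: integrable_iff_bounded mK top.not_eq_extremum)
  have meas: "(\<lambda>x. \<integral>y. f y \<partial>K x) \<in> borel_measurable M"
    by (rule borel_measurable_prob_measures[OF M kernel_integral_measurable[OF K f]])
  show "integrable M (\<lambda>x. \<integral>y. f y \<partial>K x)"
  proof (rule integrableI_bounded[OF meas])
    have "(\<integral>\<^sup>+x. ennreal (norm (\<integral>y. f y \<partial>K x)) \<partial>M) \<le> (\<integral>\<^sup>+x. \<integral>\<^sup>+y. ennreal \<bar>f y\<bar> \<partial>K x \<partial>M)"
      by (rule nn_integral_mono_AE) (use aei in \<open>eventually_elim, use integral_norm_bound_ennreal in force\<close>)
    then show "(\<integral>\<^sup>+x. ennreal (norm (\<integral>y. f y \<partial>K x)) \<partial>M) < \<infinity>" using fin by (rule le_less_trans)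
  qed
  \<comment> \<open>\<open>ennreal\<close> sends negative reals to 0, so \<open>P\<close> and
    \<open>Q\<close> integrate the positive and the negative part of \<open>f\<close>.\<close>
  define P where "P x = (\<integral>\<^sup>+y. ennreal (f y) \<partial>K x)" for x
  define Q where "Q x = (\<integral>\<^sup>+y. ennreal (- f y) \<partial>K x)" for x
  have PQm: "P \<in> borel_measurable M" "Q \<in> borel_measurable M"
    unfolding P_def Q_def using f by (auto intro!: nnm)
  have PQle: "P x \<le> (\<integral>\<^sup>+y. ennreal \<bar>f y\<bar> \<partial>K x)" "Q x \<le> (\<integral>\<^sup>+y. ennreal \<bar>f y\<bar> \<partial>K x)" for x
    unfolding P_def Q_def by (auto intro!: nn_integral_mono ennreal_leI)
  have PQfin: "(\<integral>\<^sup>+x. P x \<partial>M) < \<infinity>" "(\<integral>\<^sup>+x. Q x \<partial>M) < \<infinity>"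
    using nn_integral_mono[of M P, OF PQle(1)] nn_integral_mono[of M Q, OF PQle(2)] fin
    by (auto intro: le_less_trans)
  have aeP: "AE x in M. P x \<noteq> \<infinity>" "AE x in M. Q x \<noteq> \<infinity>"
    using nn_integral_PInf_AE[OF PQm(1)] nn_integral_PInf_AE[OF PQm(2)] PQfin by auto
  have iP: "has_bochner_integral M (\<lambda>x. enn2real (P x)) (enn2real (\<integral>\<^sup>+x. P x \<partial>M))"
  proof (rule has_bochner_integral_nn_integral)
    have "(\<integral>\<^sup>+x. ennreal (enn2real (P x)) \<partial>M) = (\<integral>\<^sup>+x. P x \<partial>M)"
      by (rule nn_integral_cong_AE) (use aeP(1) in \<open>eventually_elim, simp add: top.not_eq_extremum\<close>)
    then show "(\<integral>\<^sup>+x. ennreal (enn2real (P x)) \<partial>M) = ennreal (enn2real (\<integral>\<^sup>+x. P x \<partial>M))"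
      using PQfin by simp
  qed (use PQm in auto)
  have iQ: "has_bochner_integral M (\<lambda>x. enn2real (Q x)) (enn2real (\<integral>\<^sup>+x. Q x \<partial>M))"
  proof (rule has_bochner_integral_nn_integral)
    have "(\<integral>\<^sup>+x. ennreal (enn2real (Q x)) \<partial>M) = (\<integral>\<^sup>+x. Q x \<partial>M)"
      by (rule nn_integral_cong_AE) (use aeP(2) in \<open>eventually_elim, simp add: top.not_eq_extremum\<close>)
    then show "(\<integral>\<^sup>+x. ennreal (enn2real (Q x)) \<partial>M) = ennreal (enn2real (\<integral>\<^sup>+x. Q x \<partial>M))"
      using PQfin by simp
  qed (use PQm in auto)
  have "(\<integral>x. (\<integral>y. f y \<partial>K x) \<partial>M) = (\<integral>x. enn2real (P x) - enn2real (Q x) \<partial>M)"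
  proof (rule integral_cong_AE[OF meas])
    show "AE x in M. (\<integral>y. f y \<partial>K x) = enn2real (P x) - enn2real (Q x)"
      using aei by eventually_elim (simp add: P_def Q_def real_lebesgue_integral_def)
  qed (use PQm in measurable)
  also have "\<dots> = enn2real (\<integral>\<^sup>+x. P x \<partial>M) - enn2real (\<integral>\<^sup>+x. Q x \<partial>M)"
    using iP iQ by (auto dest: has_bochner_integral_diff simp: has_bochner_integral_iff)
  also have "\<dots> = (\<integral>y. f y \<partial>(M \<bind> K))"
    unfolding P_def Q_def real_lebesgue_integral_def[OF int] using f
    by (simp add: nn_integral_bind_kernel[OF M K])
  finally show "(\<integral>y. f y \<partial>(M \<bind> K)) = (\<integral>x. (\<integral>y. f y \<partial>K x) \<partial>M)" ..
qed

text \<open>The Tonelli direction: for nonnegative \<open>f\<close> an integrable bound on the fibre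
  integrals suffices. Finiteness of second moments is carried along the algorithm in this
  way.\<close>

lemma integrable_bind_kernel:
  fixes f :: "'b::topological_space \<Rightarrow> real"
  assumes M: "M \<in> prob_measures" and K: "kernel K" and f: "f \<in> borel_measurable borel"
    and f0: "\<And>y. 0 \<le> f y" and g: "\<And>x. integrable (K x) f" "\<And>x. (\<integral>y. f y \<partial>K x) \<le> g x"
    and ig: "integrable M g"
  shows "integrable (M \<bind> K) f" and "(\<integral>y. f y \<partial>(M \<bind> K)) \<le> (\<integral>x. g x \<partial>M)"
proof -
  have "(\<integral>\<^sup>+y. ennreal (norm (f y)) \<partial>(M \<bind> K)) = (\<integral>\<^sup>+x. \<integral>\<^sup>+y. ennreal (f y) \<partial>K x \<partial>M)"
    using f f0 by (simp add: nn_integral_bind_kernel[OF M K])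
  also have "\<dots> = (\<integral>\<^sup>+x. ennreal (\<integral>y. f y \<partial>K x) \<partial>M)"
    by (simp add: nn_integral_eq_integral[OF g(1)] f0)
  also have "\<dots> \<le> (\<integral>\<^sup>+x. ennreal (norm (g x)) \<partial>M)"
    using g(2) by (intro nn_integral_mono ennreal_leI) (auto intro: order_trans[OF g(2)])
  also have "\<dots> < \<infinity>" using ig by (simp add: integrable_iff_bounded)
  finally show int: "integrable (M \<bind> K) f"
    using f bind_prob_measures[OF M K] by (auto simp: integrable_iff_bounded prob_measuresD(4))
  show "(\<integral>y. f y \<partial>(M \<bind> K)) \<le> (\<integral>x. g x \<partial>M)"
    unfolding integral_bind_kernel(2)[OF M K f int]
    by (intro integral_mono integral_bind_kernel(1)[OF M K f int] ig g(2))
qed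

lemma has_bochner_integral_bind_kernel_nonneg:
  fixes f :: "'b::topological_space \<Rightarrow> real"
  assumes M: "M \<in> prob_measures" and K: "kernel K" and f: "f \<in> borel_measurable borel"
    and f0: "\<And>y. 0 \<le> f y" and g: "\<And>x. has_bochner_integral (K x) f (g x)"
    and ig: "has_bochner_integral M g c"
  shows "has_bochner_integral (M \<bind> K) f c"
proof -
  have int: "integrable (M \<bind> K) f"
    by (rule integrable_bind_kernel[OF M K f f0, of g])
       (use g ig in \<open>auto simp: has_bochner_integral_iff\<close>)
  show ?thesis
    using integral_bind_kernel(2)[OF M K f int] int g ig by (simp add: has_bochner_integral_iff)
qed

text \<open>For signed \<open>f\<close> integrability is a premise. Below it comes from
  \<open>integrable_of_square\<close> or \<open>integrable_mult_of_squares\<close> once second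
  moments are finite.\<close>

lemma has_bochner_integral_bind_kernel:
  fixes f :: "'b::topological_space \<Rightarrow> real"
  assumes M: "M \<in> prob_measures" and K: "kernel K" and f: "f \<in> borel_measurable borel"
    and int: "integrable (M \<bind> K) f" and g: "\<And>x. has_bochner_integral (K x) f (g x)"
  shows "has_bochner_integral (M \<bind> K) f (\<integral>x. g x \<partial>M)" "integrable M g"
  using integral_bind_kernel[OF M K f int] int g by (simp_all add: has_bochner_integral_iff)

lemma has_bochner_integral_return:
  fixes f :: "'b::topological_space \<Rightarrow> real"
  assumes "f \<in> borel_measurable borel"
  shows "has_bochner_integral (return borel x) f (f x)"
  using assms
  by (auto simp: has_bochner_integral_iff integral_return integrable_iff_bounded nn_integral_return)

lemma has_bochner_integral_const_prob:
  "M \<in> prob_measures \<Longrightarrow> has_bochner_integral M (\<lambda>_. c::real) c"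
  using prob_measuresD(1)[of M]
  by (auto simp: has_bochner_integral_iff prob_space.prob_space
      intro: finite_measure.integrable_const prob_space.finite_measure)

section \<open>Square integrability and moments of independent sums\<close>

lemma integrable_mult_of_squares:
  fixes f g :: "'a \<Rightarrow> real"
  assumes "f \<in> borel_measurable M" "g \<in> borel_measurable M"
    and "integrable M (\<lambda>x. (f x)\<^sup>2)" "integrable M (\<lambda>x. (g x)\<^sup>2)"
  shows "integrable M (\<lambda>x. f x * g x)"
proof (rule Bochner_Integration.integrable_bound)
  show "integrable M (\<lambda>x. (f x)\<^sup>2 + (g x)\<^sup>2)" using assms by simp
  have "\<bar>a * b\<bar> \<le> a\<^sup>2 + b\<^sup>2" for a b :: real
    using sum_squares_bound[of "\<bar>a\<bar>" "\<bar>b\<bar>"] abs_ge_zero[of "a*b"]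
    unfolding abs_mult power2_abs by linarith
  then show "AE x in M. norm (f x * g x) \<le> norm ((f x)\<^sup>2 + (g x)\<^sup>2)" by simp
qed (use assms in simp)

lemma integrable_of_square:
  fixes f :: "'a::topological_space \<Rightarrow> real"
  assumes "M \<in> prob_measures" "f \<in> borel_measurable M" "integrable M (\<lambda>x. (f x)\<^sup>2)"
  shows "integrable M f"
  using integrable_mult_of_squares[OF assms(2) borel_measurable_const[of 1] assms(3)]
    has_bochner_integral_const_prob[OF assms(1), of 1] by (simp add: has_bochner_integral_iff)

text \<open>Variance plus squared bias: the term linear in f - m integrates to 0. For an unbiased
  quantizer m is determined by the input and s is the error variance.\<close>

lemma has_bochner_integral_shifted_square:
  fixes f :: "'a::topological_space \<Rightarrow> real"
  assumes M: "M \<in> prob_measures" and f: "has_bochner_integral M f m"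
    and s: "has_bochner_integral M (\<lambda>x. (f x - m)\<^sup>2) s"
  shows "has_bochner_integral M (\<lambda>x. (f x - c)\<^sup>2) ((m - c)\<^sup>2 + s)"
proof -
  have "has_bochner_integral M (\<lambda>x. (f x - m)\<^sup>2 + (2 * (m - c) * f x + (c\<^sup>2 - m\<^sup>2)))
          (s + (2 * (m - c) * m + (c\<^sup>2 - m\<^sup>2)))"
    by (intro has_bochner_integral_add s has_bochner_integral_mult_right f has_bochner_integral_const_prob M)
  moreover have "(\<lambda>x. (f x - m)\<^sup>2 + (2 * (m - c) * f x + (c\<^sup>2 - m\<^sup>2))) = (\<lambda>x. (f x - c)\<^sup>2)"
    by (auto simp: power2_eq_square algebra_simps)
  moreover have "s + (2 * (m - c) * m + (c\<^sup>2 - m\<^sup>2)) = (m - c)\<^sup>2 + s"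
    by (auto simp: power2_eq_square algebra_simps)
  ultimately show ?thesis by metis
qed

text \<open>Polarized, since the law of the Gram matrix is not known to sit on symmetric matrices.\<close>
lemma iid_sum_moments:
  fixes P :: "nat \<Rightarrow> 'e::euclidean_space measure" and \<mu> :: "'a::topological_space measure"
    and h :: "'a \<Rightarrow> 'e"
  assumes mu: "\<mu> \<in> prob_measures" and h[measurable]: "h \<in> borel_measurable borel"
    and P0: "P 0 = return borel 0"
    and PS: "\<And>b. P (Suc b) = P b \<bind> (\<lambda>g. \<mu> \<bind> (\<lambda>z. return borel (g + h z)))"
    and L2: "\<And>p. p \<in> {p1, p2} \<Longrightarrow> integrable \<mu> (\<lambda>z. (p \<bullet> h z)\<^sup>2)"
  shows "P b \<in> prob_measures"
    and "p \<in> {p1, p2} \<Longrightarrow> integrable (P b) (\<lambda>g. (p \<bullet> g)\<^sup>2)"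
    and "p \<in> {p1, p2} \<Longrightarrow> has_bochner_integral (P b) (\<lambda>g. p \<bullet> g) (real b * (\<integral>z. p \<bullet> h z \<partial>\<mu>))"
    and "has_bochner_integral (P b) (\<lambda>g. (p1 \<bullet> g) * (p2 \<bullet> g))
      (real b * (\<integral>z. (p1 \<bullet> h z) * (p2 \<bullet> h z) \<partial>\<mu>)
        + real b * (real b - 1) * (\<integral>z. p1 \<bullet> h z \<partial>\<mu>) * (\<integral>z. p2 \<bullet> h z \<partial>\<mu>))"
proof -
  let ?m = "\<lambda>p. \<integral>z. p \<bullet> h z \<partial>\<mu>"
  let ?s = "\<lambda>p q. \<integral>z. (p \<bullet> h z) * (q \<bullet> h z) \<partial>\<mu>"
  define K where "K = (\<lambda>g. \<mu> \<bind> (\<lambda>z. return borel (g + h z)))"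
  have R: "kernel (\<lambda>z. return borel (g + h z))" for g
    by measurable
  have K: "kernel K"
    unfolding K_def
  proof (rule measurable_bind_prob_space2[where N=borel])
    show "(\<lambda>g. \<mu>) \<in> borel \<rightarrow>\<^sub>M prob_algebra borel" using mu by simp
  qed measurable
  have mh: "(\<lambda>z. p \<bullet> h z) \<in> borel_measurable \<mu>" for p
    by (rule borel_measurable_prob_measures[OF mu]) measurable
  have I1: "has_bochner_integral \<mu> (\<lambda>z. p \<bullet> h z) (?m p)" if "p \<in> {p1,p2}" for p
    using integrable_of_square[OF mu mh L2[OF that]] by (simp add: has_bochner_integral_iff)
  have I2: "has_bochner_integral \<mu> (\<lambda>z. (p \<bullet> h z) * (q \<bullet> h z)) (?s p q)" if "p \<in> {p1,p2}" "q \<in> {p1,p2}" for p q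
    using integrable_mult_of_squares[OF mh mh L2[OF that(1)] L2[OF that(2)]] by (simp add: has_bochner_integral_iff)
  \<comment> \<open>Squares come first: being nonnegative they are integrable along the kernel, and
    the signed \<open>Klin\<close> and \<open>Kprod\<close> inherit integrability from them.\<close>
  have Kprod_sq: "has_bochner_integral (K g) (\<lambda>y. (p \<bullet> y)\<^sup>2)
     ((p \<bullet> g)\<^sup>2 + (2 * (p \<bullet> g) * ?m p + ?s p p))" if "p \<in> {p1,p2}" for p g
    unfolding K_def
  proof (rule has_bochner_integral_bind_kernel_nonneg[OF mu R])
    have "has_bochner_integral \<mu> (\<lambda>z. (p \<bullet> g)\<^sup>2 + (2 * (p \<bullet> g) * (p \<bullet> h z) + (p \<bullet> h z) * (p \<bullet> h z)))
       ((p \<bullet> g)\<^sup>2 + (2 * (p \<bullet> g) * ?m p + ?s p p))"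
      by (intro has_bochner_integral_add has_bochner_integral_mult_right I1 I2 that has_bochner_integral_const_prob mu)
    then show "has_bochner_integral \<mu> (\<lambda>z. (p \<bullet> (g + h z))\<^sup>2)
       ((p \<bullet> g)\<^sup>2 + (2 * (p \<bullet> g) * ?m p + ?s p p))"
      by (simp add: inner_add_right power2_eq_square algebra_simps)
  qed (auto intro!: has_bochner_integral_return)
  have Klin: "has_bochner_integral (K g) (\<lambda>y. p \<bullet> y) (p \<bullet> g + ?m p)" if "p \<in> {p1,p2}" for p g
  proof -
    have Kg: "K g \<in> prob_measures" by (rule kernel_prob_measures[OF K])
    have i: "integrable (K g) (\<lambda>y. p \<bullet> y)"
      by (rule integrable_of_square[OF Kg borel_measurable_prob_measures[OF Kg] integrable.intros[OF Kprod_sq[OF that]]]) simp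
    have "has_bochner_integral (K g) (\<lambda>y. p \<bullet> y) (\<integral>z. p \<bullet> (g + h z) \<partial>\<mu>)"
      unfolding K_def
      by (rule has_bochner_integral_bind_kernel(1)[OF mu R])
         (use i in \<open>auto simp: K_def intro!: has_bochner_integral_return\<close>)
    moreover have "has_bochner_integral \<mu> (\<lambda>z. p \<bullet> g + p \<bullet> h z) (p \<bullet> g + ?m p)"
      by (intro has_bochner_integral_add I1 that has_bochner_integral_const_prob mu)
    ultimately show ?thesis by (simp add: inner_add_right has_bochner_integral_iff)
  qed
  have Kprod: "has_bochner_integral (K g) (\<lambda>y. (p1 \<bullet> y) * (p2 \<bullet> y))
      ((p1 \<bullet> g) * (p2 \<bullet> g) + ((p1 \<bullet> g) * ?m p2 + ((p2 \<bullet> g) * ?m p1 + ?s p1 p2)))" for g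
  proof -
    have Kg: "K g \<in> prob_measures" by (rule kernel_prob_measures[OF K])
    have i: "integrable (K g) (\<lambda>y. (p1 \<bullet> y) * (p2 \<bullet> y))"
      by (intro integrable_mult_of_squares borel_measurable_prob_measures[OF Kg] integrable.intros[OF Kprod_sq]) auto
    have "has_bochner_integral (K g) (\<lambda>y. (p1 \<bullet> y) * (p2 \<bullet> y)) (\<integral>z. (p1 \<bullet> (g + h z)) * (p2 \<bullet> (g + h z)) \<partial>\<mu>)"
      unfolding K_def
      by (rule has_bochner_integral_bind_kernel(1)[OF mu R])
         (use i in \<open>auto simp: K_def intro!: has_bochner_integral_return\<close>)
    moreover have "has_bochner_integral \<mu> (\<lambda>z. (p1 \<bullet> g) * (p2 \<bullet> g) + ((p1 \<bullet> g) * (p2 \<bullet> h z) + ((p2 \<bullet> g) * (p1 \<bullet> h z) + (p1 \<bullet> h z) * (p2 \<bullet> h z))))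
       ((p1 \<bullet> g) * (p2 \<bullet> g) + ((p1 \<bullet> g) * ?m p2 + ((p2 \<bullet> g) * ?m p1 + ?s p1 p2)))"
      by (intro has_bochner_integral_add has_bochner_integral_mult_right I1 I2 has_bochner_integral_const_prob mu) auto
    ultimately show ?thesis by (simp add: inner_add_right has_bochner_integral_iff algebra_simps)
  qed
  \<comment> \<open>Of the b^2 ordered pairs of summands, b are diagonal and give a joint moment;
    the other b (b - 1) are independent and give a product of means.\<close>
  have main: "P b \<in> prob_measures \<and>
    (\<forall>p\<in>{p1,p2}. integrable (P b) (\<lambda>g. (p \<bullet> g)\<^sup>2)) \<and>
    (\<forall>p\<in>{p1,p2}. has_bochner_integral (P b) (\<lambda>g. p \<bullet> g) (real b * ?m p)) \<and>
    has_bochner_integral (P b) (\<lambda>g. (p1 \<bullet> g) * (p2 \<bullet> g)) (real b * ?s p1 p2 + real b * (real b - 1) * ?m p1 * ?m p2)"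
  proof (induction b)
    case 0
    have "has_bochner_integral (return borel 0) (\<lambda>g::'e. (p \<bullet> g)) 0"
      "has_bochner_integral (return borel 0) (\<lambda>g::'e. (p \<bullet> g)\<^sup>2) 0"
      "has_bochner_integral (return borel 0) (\<lambda>g::'e. (p \<bullet> g) * (q \<bullet> g)) 0" for p q :: 'e
      using has_bochner_integral_return[of "\<lambda>g::'e. (p \<bullet> g)" 0]
       has_bochner_integral_return[of "\<lambda>g::'e. (p \<bullet> g)\<^sup>2" 0]
       has_bochner_integral_return[of "\<lambda>g::'e. (p \<bullet> g) * (q \<bullet> g)" 0] by auto
    then show ?case by (auto simp: P0 space_prob_algebra prob_space_return has_bochner_integral_iff)
  next
    case (Suc b)
    then have Pb: "P b \<in> prob_measures" by blast
    have lin: "has_bochner_integral (P b) (\<lambda>g. p \<bullet> g) (real b * ?m p)" if "p \<in> {p1,p2}" for p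
      using Suc that by blast
    have PSK: "P (Suc b) = P b \<bind> K" unfolding PS K_def ..
    have PSp: "P (Suc b) \<in> prob_measures" unfolding PSK by (rule bind_prob_measures[OF Pb K])
    have sq: "integrable (P (Suc b)) (\<lambda>g. (p \<bullet> g)\<^sup>2)" if "p \<in> {p1,p2}" for p
      unfolding PSK
    proof (rule integrable_bind_kernel(1)[OF Pb K _ _ integrable.intros[OF Kprod_sq[OF that]]])
      show "integrable (P b) (\<lambda>g. (p \<bullet> g)\<^sup>2 + (2 * (p \<bullet> g) * ?m p + ?s p p))"
        using Suc that lin[OF that] has_bochner_integral_const_prob[OF Pb, of "?s p p"]
        by (auto simp: has_bochner_integral_iff)
    qed (use Kprod_sq[OF that] in \<open>auto simp: has_bochner_integral_iff\<close>)
    have meas: "(\<lambda>g. p \<bullet> g) \<in> borel_measurable (P (Suc b))" for p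
      by (rule borel_measurable_prob_measures[OF PSp]) measurable
    have lin': "has_bochner_integral (P (Suc b)) (\<lambda>g. p \<bullet> g) (real (Suc b) * ?m p)" if "p \<in> {p1,p2}" for p
    proof -
      have i: "integrable (P (Suc b)) (\<lambda>g. p \<bullet> g)"
        by (rule integrable_of_square[OF PSp meas sq[OF that]])
      have "has_bochner_integral (P (Suc b)) (\<lambda>g. p \<bullet> g) (\<integral>g. p \<bullet> g + ?m p \<partial>P b)"
        unfolding PSK by (rule has_bochner_integral_bind_kernel(1)[OF Pb K])
          (use i Klin[OF that] in \<open>auto simp: PSK\<close>)
      moreover have "has_bochner_integral (P b) (\<lambda>g. p \<bullet> g + ?m p) (real b * ?m p + ?m p)"
        by (intro has_bochner_integral_add lin that has_bochner_integral_const_prob Pb)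
      ultimately show ?thesis by (simp add: has_bochner_integral_iff algebra_simps)
    qed
    have "has_bochner_integral (P (Suc b)) (\<lambda>g. (p1 \<bullet> g) * (p2 \<bullet> g))
      (\<integral>g. (p1 \<bullet> g) * (p2 \<bullet> g) + ((p1 \<bullet> g) * ?m p2 + ((p2 \<bullet> g) * ?m p1 + ?s p1 p2)) \<partial>P b)"
    proof -
      have i: "integrable (P (Suc b)) (\<lambda>g. (p1 \<bullet> g) * (p2 \<bullet> g))"
        by (rule integrable_mult_of_squares[OF meas meas sq sq]) auto
      show ?thesis unfolding PSK by (rule has_bochner_integral_bind_kernel(1)[OF Pb K])
          (use i Kprod in \<open>auto simp: PSK\<close>)
    qed
    moreover have "has_bochner_integral (P b) (\<lambda>g. (p1 \<bullet> g) * (p2 \<bullet> g) + ((p1 \<bullet> g) * ?m p2 + ((p2 \<bullet> g) * ?m p1 + ?s p1 p2)))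
      ((real b * ?s p1 p2 + real b * (real b - 1) * ?m p1 * ?m p2) + ((real b * ?m p1) * ?m p2 + ((real b * ?m p2) * ?m p1 + ?s p1 p2)))"
      by (intro has_bochner_integral_add has_bochner_integral_mult_left lin has_bochner_integral_const_prob Pb) (use Suc in auto)
    ultimately have "has_bochner_integral (P (Suc b)) (\<lambda>g. (p1 \<bullet> g) * (p2 \<bullet> g))
        (real (Suc b) * ?s p1 p2 + real (Suc b) * (real (Suc b) - 1) * ?m p1 * ?m p2)"
      by (simp add: has_bochner_integral_iff algebra_simps)
    then show ?case using PSp sq lin' by blast
  qed
  from main show "P b \<in> prob_measures" by blast
  from main show "p \<in> {p1, p2} \<Longrightarrow> integrable (P b) (\<lambda>g. (p \<bullet> g)\<^sup>2)" by blast
  from main show "p \<in> {p1, p2} \<Longrightarrow> has_bochner_integral (P b) (\<lambda>g. p \<bullet> g) (real b * ?m p)" by blast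
  from main show "has_bochner_integral (P b) (\<lambda>g. (p1 \<bullet> g) * (p2 \<bullet> g))
      (real b * ?s p1 p2 + real b * (real b - 1) * ?m p1 * ?m p2)" by blast
qed

section \<open>Quantizers\<close>

text \<open>The Frobenius inner product with u w^T. As a linear functional of the matrix it commutes
  with matrix-valued integrals, and it makes \<open>iid_sum_moments\<close>, stated for Euclidean
  spaces, applicable to Gram matrices.\<close>

lemma inner_matrix_mult: "u \<bullet> (M *v w) = outer u w \<bullet> (M::real^'n^'n)"
  by (simp add: inner_vec_def matrix_vector_mult_def outer_def sum_distrib_left mult_ac)

lemma inner_outer_mult: "u \<bullet> (outer a b *v w) = (u \<bullet> a) * (b \<bullet> (w::real^'n))"
  unfolding inner_vec_def matrix_vector_mult_def outer_def
  by (subst sum_product) (simp add: sum_distrib_left mult_ac)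

lemma inner_outer_outer: "outer u w \<bullet> outer a b = (u \<bullet> a) * (w \<bullet> (b::real^'n))"
  using inner_outer_mult[of u a b w] by (simp add: inner_matrix_mult inner_commute)

lemma outer_measurable [measurable]:
  fixes f g :: "'a \<Rightarrow> real^'n"
  assumes "f \<in> borel_measurable M" "g \<in> borel_measurable M"
  shows "(\<lambda>x. outer (f x) (g x)) \<in> borel_measurable M"
  by (rule borel_measurable_continuous_Pair[OF assms])
     (auto simp: outer_def intro!: continuous_on_vec_lambda continuous_intros)

lemma fst_borel_measurable [measurable]:
  "fst \<in> (borel :: ('a::second_countable_topology \<times> 'b::second_countable_topology) measure) \<rightarrow>\<^sub>M borel"
  by (intro borel_measurable_continuous_onI continuous_intros)

lemma snd_borel_measurable [measurable]:
  "snd \<in> (borel :: ('a::second_countable_topology \<times> 'b::second_countable_topology) measure) \<rightarrow>\<^sub>M borel"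
  by (intro borel_measurable_continuous_onI continuous_intros)

lemma has_bochner_integral_nonneg:
  fixes f :: "'a \<Rightarrow> real"
  assumes "has_bochner_integral M f c" "\<And>x. 0 \<le> f x"
  shows "0 \<le> c"
  using assms by (auto simp: has_bochner_integral_iff intro: integral_nonneg)

lemma has_bochner_integral_inner_matrix:
  fixes f :: "'a \<Rightarrow> real^'n^'n"
  assumes "integrable M f"
  shows "has_bochner_integral M (\<lambda>x. u \<bullet> (f x *v w)) (u \<bullet> (integral\<^sup>L M f *v w))"
  unfolding inner_matrix_mult using assms
  by (intro has_bochner_integral_inner_right) (simp add: has_bochner_integral_iff)

lemma kernel_vq: "vec_quantizer Q \<Longrightarrow> kernel Q"
  by (simp add: vec_quantizer_def)

lemma kernel_sq: "scal_quantizer Q \<Longrightarrow> kernel Q"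
  by (simp add: scal_quantizer_def)

lemma kernel_bind_const:
  fixes g :: "'a::second_countable_topology \<Rightarrow> 'b::second_countable_topology \<Rightarrow> 'c::topological_space measure"
  assumes "M \<in> prob_measures" "kernel (\<lambda>p. g (fst p) (snd p))"
  shows "kernel (\<lambda>x. M \<bind> g x)"
  by (rule measurable_bind_prob_space2[where N=borel])
     (use assms in \<open>simp_all add: borel_prod case_prod_beta\<close>)

lemma vq_mean:
  assumes "unbiased_vq Q"
  shows "has_bochner_integral (Q w) (\<lambda>x. u \<bullet> x) (u \<bullet> w)"
  using assms by (intro has_bochner_integral_inner_right) (simp add: has_bochner_integral_iff unbiased_vq_def)

text \<open>Testing the error covariance \<epsilon> I on u gives the variance \<epsilon> |u|^2 along
  u, whatever the input.\<close>

lemma vq_square: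
  assumes "vec_quantizer Q" "unbiased_vq Q" "additive_vq \<epsilon> Q"
  shows "has_bochner_integral (Q w) (\<lambda>x. (u \<bullet> x - c)\<^sup>2) ((u \<bullet> w - c)\<^sup>2 + \<epsilon> * (u \<bullet> u))"
proof (rule has_bochner_integral_shifted_square[OF kernel_prob_measures[OF kernel_vq[OF assms(1)]] vq_mean[OF assms(2)]])
  have "has_bochner_integral (Q w) (\<lambda>x. u \<bullet> (outer (x - w) (x - w) *v u)) (u \<bullet> ((\<epsilon> *\<^sub>R mat 1) *v u))"
    using has_bochner_integral_inner_matrix[of "Q w" "\<lambda>x. outer (x - w) (x - w)" u u] assms(3)
    by (simp add: additive_vq_def)
  then show "has_bochner_integral (Q w) (\<lambda>x. (u \<bullet> x - u \<bullet> w)\<^sup>2) (\<epsilon> * (u \<bullet> u))"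
    by (simp add: inner_outer_mult inner_commute inner_diff_right power2_eq_square scaleR_matrix_vector_assoc[symmetric])
qed

lemma vq_eps_nonneg:
  assumes "vec_quantizer (Q :: real^'n \<Rightarrow> (real^'n) measure)" "unbiased_vq Q" "additive_vq \<epsilon> Q"
  shows "0 \<le> \<epsilon>"
proof -
  obtain b :: "real^'n" where "b \<in> Basis" using nonempty_Basis by blast
  then have "has_bochner_integral (Q 0) (\<lambda>x. (b \<bullet> x - 0)\<^sup>2) \<epsilon>"
    using vq_square[OF assms, of 0 b 0] by (simp add: inner_same_Basis)
  then show ?thesis by (rule has_bochner_integral_nonneg) auto
qed

lemma sq_mean: "unbiased_sq Q \<Longrightarrow> has_bochner_integral (Q w) (\<lambda>x. x) w"
  by (simp add: has_bochner_integral_iff unbiased_sq_def)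

lemma sq_square:
  assumes "scal_quantizer Q" "unbiased_sq Q" "additive_sq \<epsilon> Q"
  shows "has_bochner_integral (Q w) (\<lambda>x. (x - c)\<^sup>2) ((w - c)\<^sup>2 + \<epsilon>)"
  by (rule has_bochner_integral_shifted_square[OF kernel_prob_measures[OF kernel_sq[OF assms(1)]] sq_mean[OF assms(2)]])
     (use assms(3) in \<open>simp add: additive_sq_def has_bochner_integral_iff\<close>)

lemma sq_eps_nonneg:
  assumes "additive_sq \<epsilon> Q"
  shows "0 \<le> \<epsilon>"
  by (rule has_bochner_integral_nonneg[of "Q 0" "\<lambda>x. (x - 0)\<^sup>2"])
     (use assms in \<open>auto simp only: additive_sq_def has_bochner_integral_iff zero_le_power2\<close>)

section \<open>Quantized data\<close>

locale quantized_data =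
  fixes D :: "((real^'n) \<times> real) measure"
    and Qd :: "real^'n \<Rightarrow> (real^'n) measure" and Ql :: "real \<Rightarrow> real measure"
    and \<epsilon>d \<epsilon>l :: real
  assumes D_prob: "prob_space D" and D_sets: "sets D = sets borel"
    and D_x2: "integrable D (\<lambda>z. (norm (fst z))\<^sup>2)"
    and D_y2: "integrable D (\<lambda>z. (snd z)\<^sup>2)"
    and Qd: "vec_quantizer Qd" "unbiased_vq Qd" "additive_vq \<epsilon>d Qd"
    and Ql: "scal_quantizer Ql" "unbiased_sq Ql" "additive_sq \<epsilon>l Ql"
begin

abbreviation Dq where "Dq \<equiv> qdata D Qd Ql"
abbreviation K where "K \<equiv> second_moment Dq"

lemma D_pm: "D \<in> prob_measures"
  using D_prob D_sets by (simp add: space_prob_algebra)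

lemmas ker [measurable] = kernel_vq[OF Qd(1)] kernel_sq[OF Ql(1)]

lemma kernel_qdata:
  "kernel (\<lambda>z. Qd (fst z) \<bind> (\<lambda>xq. Ql (snd z) \<bind> (\<lambda>yq. return borel (xq, yq))))"
  by measurable

lemma Dq_pm: "Dq \<in> prob_measures"
  unfolding qdata_def by (rule bind_prob_measures[OF D_pm kernel_qdata])

text \<open>The weight \<open>a\<close> serves two purposes: a = 1 is the regression residual, a = 0
  leaves the square of w \<bullet> x and thus the second moments of the input.\<close>

lemma D_residual_integrable: "integrable D (\<lambda>z. (a * snd z - w \<bullet> fst z)\<^sup>2)"
proof (rule Bochner_Integration.integrable_bound)
  show "integrable D (\<lambda>z. 2 * a\<^sup>2 * (snd z)\<^sup>2 + 2 * (norm w)\<^sup>2 * (norm (fst z))\<^sup>2)"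
    using D_x2 D_y2 by simp
  show "(\<lambda>z. (a * snd z - w \<bullet> fst z)\<^sup>2) \<in> borel_measurable D"
    by (rule borel_measurable_prob_measures[OF D_pm]) measurable
  have "(a * y - w \<bullet> x)\<^sup>2 \<le> 2 * a\<^sup>2 * y\<^sup>2 + 2 * (norm w)\<^sup>2 * (norm x)\<^sup>2" for y and x :: "real^'n"
  proof -
    have "(w \<bullet> x)\<^sup>2 \<le> (norm w)\<^sup>2 * (norm x)\<^sup>2"
      using Cauchy_Schwarz_ineq[of w x] by (simp add: power2_norm_eq_inner)
    moreover have "(a * y - w \<bullet> x)\<^sup>2 + (a * y + w \<bullet> x)\<^sup>2 = 2 * a\<^sup>2 * y\<^sup>2 + 2 * (w \<bullet> x)\<^sup>2"
      by (simp add: power2_eq_square algebra_simps)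
    ultimately show ?thesis using zero_le_power2[of "a * y + w \<bullet> x"] by linarith
  qed
  then show "AE z in D. norm ((a * snd z - w \<bullet> fst z)\<^sup>2) \<le> norm (2 * a\<^sup>2 * (snd z)\<^sup>2 + 2 * (norm w)\<^sup>2 * (norm (fst z))\<^sup>2)"
    by (intro AE_I2) (force intro: order_trans)
qed

text \<open>The errors of \<open>Qd\<close> and \<open>Ql\<close> are centred and independent given
  the sample, so no mixed terms appear and their variances add to the unquantized second
  moment.\<close>

lemma Dq_residual:
  "has_bochner_integral Dq (\<lambda>z. (a * snd z - w \<bullet> fst z)\<^sup>2)
    ((\<integral>z. (a * snd z - w \<bullet> fst z)\<^sup>2 \<partial>D) + (a\<^sup>2 * \<epsilon>l + \<epsilon>d * (w \<bullet> w)))"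
proof -
  have meas: "(\<lambda>z. (a * snd z - w \<bullet> fst z)\<^sup>2) \<in> borel_measurable borel" by measurable
  show ?thesis
    unfolding qdata_def
  proof (rule has_bochner_integral_bind_kernel_nonneg[OF D_pm kernel_qdata])
    show "has_bochner_integral D (\<lambda>z. (a * snd z - w \<bullet> fst z)\<^sup>2 + (a\<^sup>2 * \<epsilon>l + \<epsilon>d * (w \<bullet> w)))
        ((\<integral>z. (a * snd z - w \<bullet> fst z)\<^sup>2 \<partial>D) + (a\<^sup>2 * \<epsilon>l + \<epsilon>d * (w \<bullet> w)))"
      using D_residual_integrable has_bochner_integral_const_prob[OF D_pm]
      by (intro has_bochner_integral_add) (auto simp: has_bochner_integral_iff)
    fix z :: "(real^'n) \<times> real"
    show "has_bochner_integral (Qd (fst z) \<bind> (\<lambda>xq. Ql (snd z) \<bind> (\<lambda>yq. return borel (xq, yq))))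
        (\<lambda>z. (a * snd z - w \<bullet> fst z)\<^sup>2) ((a * snd z - w \<bullet> fst z)\<^sup>2 + (a\<^sup>2 * \<epsilon>l + \<epsilon>d * (w \<bullet> w)))"
    proof (rule has_bochner_integral_bind_kernel_nonneg[OF kernel_prob_measures[OF kernel_vq[OF Qd(1)]]])
      have "has_bochner_integral (Qd (fst z)) (\<lambda>x. (w \<bullet> x - a * snd z)\<^sup>2 + a\<^sup>2 * \<epsilon>l)
         ((w \<bullet> fst z - a * snd z)\<^sup>2 + \<epsilon>d * (w \<bullet> w) + a\<^sup>2 * \<epsilon>l)"
        by (intro has_bochner_integral_add vq_square[OF Qd] has_bochner_integral_const_prob
            kernel_prob_measures[OF kernel_vq[OF Qd(1)]])
      then show "has_bochner_integral (Qd (fst z)) (\<lambda>x. (a * snd z - w \<bullet> x)\<^sup>2 + a\<^sup>2 * \<epsilon>l)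
         ((a * snd z - w \<bullet> fst z)\<^sup>2 + (a\<^sup>2 * \<epsilon>l + \<epsilon>d * (w \<bullet> w)))"
        by (simp add: power2_commute algebra_simps)
      fix xq :: "real^'n"
      show "has_bochner_integral (Ql (snd z) \<bind> (\<lambda>yq. return borel (xq, yq)))
        (\<lambda>z. (a * snd z - w \<bullet> fst z)\<^sup>2) ((a * snd z - w \<bullet> xq)\<^sup>2 + a\<^sup>2 * \<epsilon>l)"
      proof (rule has_bochner_integral_bind_kernel_nonneg[OF kernel_prob_measures[OF kernel_sq[OF Ql(1)]]])
        fix yq :: real
        show "has_bochner_integral (return borel (xq, yq)) (\<lambda>z. (a * snd z - w \<bullet> fst z)\<^sup>2) ((a * yq - w \<bullet> xq)\<^sup>2)"
          using has_bochner_integral_return[of "\<lambda>z. (a * snd z - w \<bullet> fst z)\<^sup>2" "(xq, yq)"] by simp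
      next
        show "has_bochner_integral (Ql (snd z)) (\<lambda>y. (a * y - w \<bullet> xq)\<^sup>2) ((a * snd z - w \<bullet> xq)\<^sup>2 + a\<^sup>2 * \<epsilon>l)"
        \<comment> \<open>\<open>sq_square\<close> has coefficient 1 at the label, so
          \<open>a\<close> is factored out; for a = 0 the integrand is constant.\<close>
        proof (cases "a = 0")
          case True
          then show ?thesis
            using has_bochner_integral_const_prob[OF kernel_prob_measures[OF kernel_sq[OF Ql(1)]]] by simp
        next
          case False
          have "has_bochner_integral (Ql (snd z)) (\<lambda>y. a\<^sup>2 * (y - w \<bullet> xq / a)\<^sup>2) (a\<^sup>2 * ((snd z - w \<bullet> xq / a)\<^sup>2 + \<epsilon>l))"
            by (intro has_bochner_integral_mult_right sq_square[OF Ql])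
          moreover have "a\<^sup>2 * (y - w \<bullet> xq / a)\<^sup>2 = (a * y - w \<bullet> xq)\<^sup>2" for y
            using False unfolding power_mult_distrib[symmetric] by (simp add: right_diff_distrib)
          ultimately show ?thesis by (simp add: distrib_left)
        qed
        show "kernel (\<lambda>yq. return borel (xq, yq))"
          by (intro measurable_compose[OF _ measurable_return_prob_space]
              borel_measurable_continuous_onI continuous_intros)
      qed (rule meas, simp)
      show "kernel (\<lambda>xq::real^'n. Ql (snd z) \<bind> (\<lambda>yq. return borel (xq, yq)))"
      proof (rule kernel_bind_const)
        show "Ql (snd z) \<in> prob_measures" by (rule kernel_prob_measures[OF kernel_sq[OF Ql(1)]])
      qed measurable
    qed (rule meas, simp)
  qed (rule meas, simp)
qed

lemma fst_square_integrable: "integrable Dq (\<lambda>z. (u \<bullet> fst z)\<^sup>2)"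
  using Dq_residual[of 0 u] by (simp add: has_bochner_integral_iff)

end

lemma has_bochner_integral_second_moment:
  fixes M :: "((real^'n) \<times> real) measure"
  assumes M: "M \<in> prob_measures" and sq: "\<And>u. integrable M (\<lambda>z. (u \<bullet> fst z)\<^sup>2)"
  shows "has_bochner_integral M (\<lambda>z. (u \<bullet> fst z) * (w \<bullet> fst z)) (u \<bullet> (second_moment M *v w))"
proof -
  have meas: "(\<lambda>z. u \<bullet> fst z) \<in> borel_measurable M" for u
    by (rule borel_measurable_prob_measures[OF M]) measurable
  have "integrable M (\<lambda>z. outer (fst z) (fst z))"
  proof (rule Bochner_Integration.integrable_bound)
    show "integrable M (\<lambda>z. \<Sum>b\<in>Basis. (b \<bullet> fst z)\<^sup>2)" using sq by simp
    show "(\<lambda>z. outer (fst z) (fst z)) \<in> borel_measurable M"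
      by (rule borel_measurable_prob_measures[OF M]) measurable
    \<comment> \<open>The Frobenius norm of x x^T is |x|^2, so square-integrable coordinates
      dominate it.\<close>
    have "norm (outer x x) = (\<Sum>b\<in>Basis. (b \<bullet> x)\<^sup>2)" for x :: "real^'n"
      by (simp add: norm_eq_sqrt_inner inner_outer_outer euclidean_inner[of x x] inner_commute power2_eq_square sum_nonneg)
    then show "AE z in M. norm (outer (fst z) (fst z)) \<le> norm (\<Sum>b\<in>Basis. (b \<bullet> fst z)\<^sup>2)" by simp
  qed
  from has_bochner_integral_inner_matrix[OF this, of u w]
  show ?thesis by (simp add: inner_outer_mult inner_commute second_moment_def)
qed

context quantized_data begin

lemma second_moment_Dq:
  "has_bochner_integral Dq (\<lambda>z. (u \<bullet> fst z) * (w \<bullet> fst z)) (u \<bullet> (K *v w))"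
  by (rule has_bochner_integral_second_moment[OF Dq_pm fst_square_integrable])

lemma K_sym: "u \<bullet> (K *v w) = w \<bullet> (K *v u)"
  using second_moment_Dq[of u w] second_moment_Dq[of w u]
  by (simp add: mult.commute has_bochner_integral_iff)

text \<open>\<open>Dq_residual\<close> at a = 0 compares the two quadratic forms; both matrices are
  symmetric, and polarization upgrades this to equality.\<close>

lemma K_eq: "K = second_moment D + \<epsilon>d *\<^sub>R mat 1"
proof -
  have D2: "has_bochner_integral D (\<lambda>z. (u \<bullet> fst z) * (w \<bullet> fst z)) (u \<bullet> (second_moment D *v w))" for u w
    by (rule has_bochner_integral_second_moment[OF D_pm]) (use D_residual_integrable[of 0] in simp)
  have sym: "u \<bullet> (second_moment D *v w) = w \<bullet> (second_moment D *v u)" for u w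
    using D2[of u w] D2[of w u] by (simp add: mult.commute has_bochner_integral_iff)
  have diag: "u \<bullet> (K *v u) = u \<bullet> ((second_moment D + \<epsilon>d *\<^sub>R mat 1) *v u)" for u
    using second_moment_Dq[of u u] D2[of u u] Dq_residual[of 0 u]
    by (simp add: has_bochner_integral_iff power2_eq_square matrix_vector_mult_add_rdistrib
        inner_add_right scaleR_matrix_vector_assoc[symmetric])
  have sym': "u \<bullet> ((second_moment D + \<epsilon>d *\<^sub>R mat 1) *v w) = w \<bullet> ((second_moment D + \<epsilon>d *\<^sub>R mat 1) *v u)" for u w
    using sym[of u w] by (simp add: matrix_vector_mult_add_rdistrib inner_add_right
        scaleR_matrix_vector_assoc[symmetric] inner_commute)
  have polar: "u \<bullet> (A *v w) = ((u + w) \<bullet> (A *v (u + w)) - u \<bullet> (A *v u) - w \<bullet> (A *v w)) / 2"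
    if "\<And>u w. u \<bullet> (A *v w) = w \<bullet> (A *v u)" for A :: "real^'n^'n" and u w
    using that[of w u] by (simp add: matrix_vector_right_distrib inner_add_left inner_add_right)
  have "u \<bullet> (K *v w) = u \<bullet> ((second_moment D + \<epsilon>d *\<^sub>R mat 1) *v w)" for u w
    using polar[OF K_sym, of u w] polar[OF sym', of u w] by (simp only: diag)
  then have "K *v w = (second_moment D + \<epsilon>d *\<^sub>R mat 1) *v w" for w
    using vector_eq_ldot[of "K *v w" "(second_moment D + \<epsilon>d *\<^sub>R mat 1) *v w"] by blast
  then show ?thesis by (simp add: matrix_eq)
qed

lemma K_nonneg: "0 \<le> u \<bullet> (K *v u)"
  by (rule has_bochner_integral_nonneg[OF second_moment_Dq]) simp

text \<open>Ridge regression: the variance of the data error along w acts as a penalty on w, that of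
  the label error as a constant.\<close>

lemma qrisk_eq: "qrisk Dq w = 2 * risk D w + \<epsilon>l + \<epsilon>d * (w \<bullet> w)"
  using Dq_residual[of 1 w] by (simp add: qrisk_def risk_def has_bochner_integral_iff)

end

section \<open>Quantized stochastic gradient descent\<close>

lemma outer_mult_vec: "outer a b *v w = (b \<bullet> w) *\<^sub>R (a::real^'n)"
  by (simp add: vec_eq_iff outer_def matrix_vector_mult_def inner_vec_def sum_distrib_left mult_ac)

lemma trace_mult_outer: "trace ((A::real^'n^'n) ** outer d e) = e \<bullet> (A *v d)"
  by (simp add: trace_def matrix_matrix_mult_def outer_def inner_vec_def matrix_vector_mult_def
      sum_distrib_left mult_ac)

lemma trace_outer: "trace (outer a (b::real^'n)) = a \<bullet> b"
  by (simp add: trace_def outer_def inner_vec_def)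

lemma trace_scaleR: "trace (c *\<^sub>R (A::real^'n^'n)) = c * trace A"
  by (simp add: trace_def sum_distrib_left)

lemma trace_sum: "trace (\<Sum>i\<in>I. f i :: real^'n^'n) = (\<Sum>i\<in>I. trace (f i))"
  unfolding trace_def by (subst sum.swap) simp

lemma psd_outer: "psd (outer d (d::real^'n))"
  unfolding psd_def
proof (intro conjI allI)
  show "transpose (outer d d) = outer d d"
    by (simp add: vec_eq_iff transpose_def outer_def mult.commute)
  show "0 \<le> v \<bullet> (outer d d *v v)" for v
    by (simp add: inner_outer_mult inner_commute[of d])
qed

lemma loewner_leD: "loewner_le A B \<Longrightarrow> u \<bullet> (A *v u) \<le> u \<bullet> (B *v u)"
  by (simp add: loewner_le_def)

lemma matrix_vector_sum_left: "(\<Sum>i\<in>I. f i :: real^'n^'n) *v w = (\<Sum>i\<in>I. f i *v w)"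
  by (induction I rule: infinite_finite_induct) (auto simp: matrix_vector_mult_add_rdistrib)

lemma inner_eigensum:
  "u \<bullet> ((\<Sum>i\<in>I. c i *\<^sub>R outer (v i) (v i)) *v (w::real^'n)) = (\<Sum>i\<in>I. c i * ((v i \<bullet> u) * (v i \<bullet> w)))"
  by (simp add: matrix_vector_sum_left inner_sum_right scaleR_matrix_vector_assoc[symmetric]
      inner_outer_mult inner_commute[of u])

lemma sorted_eigendecompD:
  fixes M :: "real^'n^'n"
  assumes "sorted_eigendecomp M lam v"
  shows "i \<in> {1..CARD('n)} \<Longrightarrow> j \<in> {1..CARD('n)} \<Longrightarrow> v i \<bullet> v j = (if i = j then 1 else 0)"
    and "u \<bullet> (M *v w) = (\<Sum>i=1..CARD('n). lam i * ((v i \<bullet> u) * (v i \<bullet> w)))"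
    and "i \<in> {1..CARD('n)} \<Longrightarrow> M *v v i = lam i *\<^sub>R v i"
    and "trace M = (\<Sum>i=1..CARD('n). lam i)"
proof -
  have o: "v i \<bullet> v j = (if i = j then 1 else 0)" if "i \<in> {1..CARD('n)}" "j \<in> {1..CARD('n)}" for i j
    using assms that unfolding sorted_eigendecomp_def by blast
  have M: "M = (\<Sum>i=1..CARD('n). lam i *\<^sub>R outer (v i) (v i))"
    using assms unfolding sorted_eigendecomp_def by blast
  show "i \<in> {1..CARD('n)} \<Longrightarrow> j \<in> {1..CARD('n)} \<Longrightarrow> v i \<bullet> v j = (if i = j then 1 else 0)" by (rule o)
  show "u \<bullet> (M *v w) = (\<Sum>i=1..CARD('n). lam i * ((v i \<bullet> u) * (v i \<bullet> w)))"
    unfolding M by (rule inner_eigensum)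
  show "trace M = (\<Sum>i=1..CARD('n). lam i)"
    unfolding M trace_sum by (intro sum.cong refl) (simp add: trace_scaleR trace_outer o)
  assume i: "i \<in> {1..CARD('n)}"
  have "M *v v i = (\<Sum>j=1..CARD('n). (lam j * (v j \<bullet> v i)) *\<^sub>R v j)"
    unfolding M matrix_vector_sum_left by (simp add: scaleR_matrix_vector_assoc[symmetric] outer_mult_vec)
  also have "\<dots> = (\<Sum>j=1..CARD('n). if j = i then lam i *\<^sub>R v i else 0)"
    by (intro sum.cong refl) (use i o in auto)
  also have "\<dots> = lam i *\<^sub>R v i" using i by simp
  finally show "M *v v i = lam i *\<^sub>R v i" .
qed

text \<open>First-order optimality without derivatives: a quadratic in t that vanishes at 0 and is
  nowhere negative has slope 0 there. It yields the normal equations of both minimizers.\<close>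

lemma linear_coefficient_zero:
  fixes c k :: real
  assumes "\<And>t. 0 \<le> t * c + t * t * k"
  shows "c = 0"
proof -
  \<comment> \<open>A step against the sign of \<open>c\<close>, so short that the quadratic term
    consumes at most half of the linear gain.\<close>
  define t where "t = - c / (2 * (\<bar>k\<bar> + 1))"
  have c: "c = - 2 * (\<bar>k\<bar> + 1) * t" proof -
    have "\<bar>k\<bar> + 1 \<noteq> 0" by linarith
    then show ?thesis unfolding t_def by (simp add: field_simps)
  qed
  have "0 \<le> t * c + t * t * \<bar>k\<bar>"
    using assms[of t] mult_left_mono[OF abs_ge_self[of k] zero_le_square[of t]] by linarith
  then have "(t * t) * (\<bar>k\<bar> + 2) \<le> 0" unfolding c by (simp add: algebra_simps)
  then have "t = 0" by (auto simp: mult_le_0_iff)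
  then show ?thesis using c by simp
qed

text \<open>Spectrum, positivity and step size refer to the quantized second moment, which governs
  the iteration; the unquantized one returns only when errors are translated into excess
  risk.\<close>

locale quantized_sgd = quantized_data D Qd Ql \<epsilon>d \<epsilon>l
  for D :: "((real^'n) \<times> real) measure" and Qd Ql \<epsilon>d \<epsilon>l +
  fixes Qp :: "real^'n \<Rightarrow> (real^'n) measure" and Qa Qo :: "real \<Rightarrow> real measure"
    and \<epsilon>p \<epsilon>a \<epsilon>o \<alpha> \<sigma>2 \<gamma> :: real and B :: nat and wq :: "real^'n"
    and l :: "nat \<Rightarrow> real" and v :: "nat \<Rightarrow> real^'n"
  assumes Qp: "vec_quantizer Qp" "unbiased_vq Qp" "additive_vq \<epsilon>p Qp"
    and Qa: "scal_quantizer Qa" "unbiased_sq Qa" "additive_sq \<epsilon>a Qa"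
    and Qo: "scal_quantizer Qo" "unbiased_sq Qo" "additive_sq \<epsilon>o Qo"
    and eig: "sorted_eigendecomp (second_moment (qdata D Qd Ql)) l v"
    and wq_min: "\<And>w. qrisk (qdata D Qd Ql) wq \<le> qrisk (qdata D Qd Ql) w"
    and fourth: "fourth_moment_assm \<alpha> B (qdata D Qd Ql)"
    and noise: "noise_assm \<sigma>2 wq (qdata D Qd Ql)"
    and B_pos: "1 \<le> B" and K_pos: "\<And>u. u \<noteq> 0 \<Longrightarrow> 0 < u \<bullet> (second_moment (qdata D Qd Ql) *v u)"
    and \<gamma>_pos: "0 < \<gamma>" and \<gamma>_small: "\<gamma> < 1 / (\<alpha> * trace (second_moment (qdata D Qd Ql)))"
begin

abbreviation \<xi> where "\<xi> z \<equiv> snd z - wq \<bullet> fst z"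

lemmas ker2 [measurable] = kernel_vq[OF Qp(1)] kernel_sq[OF Qa(1)] kernel_sq[OF Qo(1)]

lemma Dq_meas: "f \<in> borel_measurable borel \<Longrightarrow> f \<in> borel_measurable Dq"
  by (rule borel_measurable_prob_measures[OF Dq_pm])

lemma xi_sq: "integrable Dq (\<lambda>z. (\<xi> z)\<^sup>2)"
  using Dq_residual[of 1 wq] by (simp add: has_bochner_integral_iff)

lemma xi_x: "integrable Dq (\<lambda>z. \<xi> z * (u \<bullet> fst z))"
  by (rule integrable_mult_of_squares[OF _ _ xi_sq fst_square_integrable]; rule Dq_meas; measurable)

section \<open>Optimality conditions of the quantized minimizer\<close>

lemma qrisk_expand:
  "qrisk Dq (wq + d) = qrisk Dq wq - 2 * (\<integral>z. \<xi> z * (d \<bullet> fst z) \<partial>Dq) + d \<bullet> (K *v d)"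
proof -
  have "has_bochner_integral Dq (\<lambda>z. (\<xi> z)\<^sup>2 - 2 * (\<xi> z * (d \<bullet> fst z)) + (d \<bullet> fst z) * (d \<bullet> fst z))
     (qrisk Dq wq - 2 * (\<integral>z. \<xi> z * (d \<bullet> fst z) \<partial>Dq) + d \<bullet> (K *v d))"
    using xi_sq xi_x[of d]
    by (intro has_bochner_integral_add has_bochner_integral_diff second_moment_Dq has_bochner_integral_mult_right)
       (simp_all add: has_bochner_integral_iff qrisk_def)
  moreover have "(\<xi> z)\<^sup>2 - 2 * (\<xi> z * (d \<bullet> fst z)) + (d \<bullet> fst z) * (d \<bullet> fst z) = (snd z - (wq + d) \<bullet> fst z)\<^sup>2" for z
    by (simp add: power2_eq_square inner_add_left algebra_simps)
  ultimately show ?thesis by (simp add: has_bochner_integral_iff qrisk_def)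
qed

text \<open>These are the normal equations. They make the residual uncorrelated with the input and
  nothing more, so the third-order moment \<open>cross\<close> survives.\<close>

lemma xi_orth: "has_bochner_integral Dq (\<lambda>z. \<xi> z * (u \<bullet> fst z)) 0"
proof -
  have "- 2 * (\<integral>z. \<xi> z * (u \<bullet> fst z) \<partial>Dq) = 0"
  proof (rule linear_coefficient_zero)
    show "0 \<le> t * (- 2 * (\<integral>z. \<xi> z * (u \<bullet> fst z) \<partial>Dq)) + t * t * (u \<bullet> (K *v u))" for t
      using wq_min[of "wq + t *\<^sub>R u"] unfolding qrisk_expand
      by (simp add: matrix_vector_mult_scaleR mult_ac)
  qed
  then show ?thesis using xi_x[of u] by (simp add: has_bochner_integral_iff)
qed

lemma qrisk_shift: "qrisk Dq (wq + d) = qrisk Dq wq + d \<bullet> (K *v d)"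
  unfolding qrisk_expand using xi_orth[of d] by (simp add: has_bochner_integral_iff)

subsection \<open>Moment assumptions tested on vectors\<close>

abbreviation quartic where "quartic u d \<equiv> \<integral>z. ((u \<bullet> fst z) * (d \<bullet> fst z))\<^sup>2 \<partial>Dq"

text \<open>At A = d d^T, tested on u, the matrix x x^T A x x^T becomes a squared product and the
  trace becomes the energy d \<bullet> K d.\<close>

lemma fourth_rank1:
  shows "integrable Dq (\<lambda>z. ((u \<bullet> fst z) * (d \<bullet> fst z))\<^sup>2)"
    and "quartic u d \<le> \<alpha> * (d \<bullet> (K *v d)) * (u \<bullet> (K *v u))"
proof -
  have f: "integrable Dq (\<lambda>z. outer (fst z) (fst z) ** outer d d ** outer (fst z) (fst z))"
    "loewner_le (LINT z|Dq. outer (fst z) (fst z) ** outer d d ** outer (fst z) (fst z))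
                 ((\<alpha> * trace (K ** outer d d)) *\<^sub>R K)"
    using fourth psd_outer[of d] unfolding fourth_moment_assm_def by blast+
  have eq: "u \<bullet> ((outer x x ** outer d d ** outer x x) *v u) = ((u \<bullet> x) * (d \<bullet> x))\<^sup>2" for x
    by (simp add: matrix_vector_mul_assoc[symmetric] outer_mult_vec power2_eq_square inner_commute)
  from has_bochner_integral_inner_matrix[OF f(1), of u u]
  show "integrable Dq (\<lambda>z. ((u \<bullet> fst z) * (d \<bullet> fst z))\<^sup>2)"
    and "quartic u d \<le> \<alpha> * (d \<bullet> (K *v d)) * (u \<bullet> (K *v u))"
    using loewner_leD[OF f(2), of u] unfolding eq
    by (simp_all add: has_bochner_integral_iff trace_mult_outer scaleR_matrix_vector_assoc[symmetric])
qed

text \<open>The batch half of the fourth-moment assumption at A = d d^T. Its left side is exactly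
  the part of the batch gradient's second moment that is quadratic in d, so minibatching needs no
  separate estimate.\<close>

lemma gram_bound:
  "quartic u d / real B + (real B - 1) / real B * (u \<bullet> (K *v d))\<^sup>2 \<le> \<alpha> * (d \<bullet> (K *v d)) * (u \<bullet> (K *v u))"
proof -
  have f: "integrable (gram_batch Dq B) (\<lambda>G. (1 / (real B)\<^sup>2) *\<^sub>R (G ** outer d d ** G))"
    "loewner_le (LINT G|gram_batch Dq B. (1 / (real B)\<^sup>2) *\<^sub>R (G ** outer d d ** G))
                 ((\<alpha> * trace (K ** outer d d)) *\<^sub>R K)"
    using fourth psd_outer[of d] unfolding fourth_moment_assm_def by blast+
  have eq: "u \<bullet> (((1 / (real B)\<^sup>2) *\<^sub>R (G ** outer d d ** G)) *v u)
      = 1 / (real B)\<^sup>2 * ((outer u d \<bullet> G) * (outer d u \<bullet> G))" for G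
    by (simp add: scaleR_matrix_vector_assoc[symmetric] matrix_vector_mul_assoc[symmetric]
        matrix_vector_mult_scaleR outer_mult_vec inner_matrix_mult[symmetric])
  \<comment> \<open>The form in G factors into two linear functionals, with matrices u d^T and d
    u^T. They agree on every summand x x^T, so diagonal pairs give \<open>quartic\<close> and
    distinct pairs the square of u \<bullet> K d.\<close>
  have sym: "outer d u \<bullet> outer x x = outer u d \<bullet> outer x x" for x :: "real^'n"
    by (simp add: inner_outer_outer)
  have g: "has_bochner_integral (gram_batch Dq B) (\<lambda>G. (outer u d \<bullet> G) * (outer d u \<bullet> G))
    (real B * (\<integral>z. (outer u d \<bullet> outer (fst z) (fst z)) * (outer d u \<bullet> outer (fst z) (fst z)) \<partial>Dq)
        + real B * (real B - 1) * (\<integral>z. outer u d \<bullet> outer (fst z) (fst z) \<partial>Dq) * (\<integral>z. outer d u \<bullet> outer (fst z) (fst z) \<partial>Dq))"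
  proof (rule iid_sum_moments(4)[OF Dq_pm, where h="\<lambda>z. outer (fst z) (fst z)"])
    show "(\<lambda>z::(real^'n) \<times> real. outer (fst z) (fst z)) \<in> borel \<rightarrow>\<^sub>M borel" by measurable
  qed (use fourth_rank1(1) in \<open>auto simp: inner_outer_outer mult.commute\<close>)
  have B0: "B \<noteq> 0" using B_pos by simp
  have mean: "(\<integral>z. (u \<bullet> fst z) * (d \<bullet> fst z) \<partial>Dq) = u \<bullet> (K *v d)"
    using second_moment_Dq[of u d] by (simp add: has_bochner_integral_iff)
  have "1 / (real B)\<^sup>2 * (real B * quartic u d + real B * (real B - 1) * (u \<bullet> (K *v d))\<^sup>2)
      \<le> \<alpha> * (d \<bullet> (K *v d)) * (u \<bullet> (K *v u))"
    using has_bochner_integral_inner_matrix[OF f(1), of u u] loewner_leD[OF f(2), of u] g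
    unfolding eq sym
    by (simp add: has_bochner_integral_iff trace_mult_outer scaleR_matrix_vector_assoc[symmetric]
        inner_outer_outer mean power2_eq_square mult.assoc B0)
  moreover have "1 / (real B)\<^sup>2 * (real B * quartic u d + real B * (real B - 1) * (u \<bullet> (K *v d))\<^sup>2)
     = quartic u d / real B + (real B - 1) / real B * (u \<bullet> (K *v d))\<^sup>2"
    using B_pos by (simp add: field_simps power2_eq_square)
  ultimately show ?thesis by simp
qed

abbreviation resid_moment where "resid_moment u \<equiv> \<integral>z. (\<xi> z * (u \<bullet> fst z))\<^sup>2 \<partial>Dq"

lemma noise_rank1:
  shows "integrable Dq (\<lambda>z. (\<xi> z * (u \<bullet> fst z))\<^sup>2)" and "resid_moment u \<le> \<sigma>2 * (u \<bullet> (K *v u))"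
proof -
  have f: "integrable Dq (\<lambda>z. (\<xi> z)\<^sup>2 *\<^sub>R outer (fst z) (fst z))"
    "loewner_le (LINT z|Dq. (\<xi> z)\<^sup>2 *\<^sub>R outer (fst z) (fst z)) (\<sigma>2 *\<^sub>R K)"
    using noise unfolding noise_assm_def by blast+
  have eq: "u \<bullet> (((c)\<^sup>2 *\<^sub>R outer x x) *v u) = (c * (u \<bullet> x))\<^sup>2" for x c
    by (simp add: scaleR_matrix_vector_assoc[symmetric] inner_outer_mult power2_eq_square inner_commute)
  from has_bochner_integral_inner_matrix[OF f(1), of u u]
  show "integrable Dq (\<lambda>z. (\<xi> z * (u \<bullet> fst z))\<^sup>2)" and "resid_moment u \<le> \<sigma>2 * (u \<bullet> (K *v u))"
    using loewner_leD[OF f(2), of u] unfolding eq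
    by (simp_all add: has_bochner_integral_iff scaleR_matrix_vector_assoc[symmetric])
qed

abbreviation cross where "cross u d \<equiv> \<integral>z. (\<xi> z * (u \<bullet> fst z)) * ((u \<bullet> fst z) * (d \<bullet> fst z)) \<partial>Dq"

lemma cross_integrable: "integrable Dq (\<lambda>z. (\<xi> z * (u \<bullet> fst z)) * ((u \<bullet> fst z) * (d \<bullet> fst z)))"
  by (rule integrable_mult_of_squares[OF _ _ noise_rank1(1) fourth_rank1(1)]; rule Dq_meas; measurable)

text \<open>Riesz representation: a linear functional is the inner product with its adjoint applied
  to 1. An expectation over the error d then passes through the inner product.\<close>

lemma cross_inner: "\<exists>c. \<forall>d. cross u d = c \<bullet> d"
proof -
  have "linear (cross u)"
    using cross_integrable[of u]
    by (intro linearI) (simp_all add: inner_add_left distrib_left mult.left_commute)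
  then have "cross u d = adjoint (cross u) 1 \<bullet> d" for d
    using adjoint_works[of "cross u" d 1] by (simp add: inner_commute)
  then show ?thesis by blast
qed

subsection \<open>Moments of the stochastic gradient\<close>

text \<open>The law of one gradient sample given the quantized pair z; only the noise of
  \<open>Qa\<close> and \<open>Qo\<close> is left.\<close>

definition noisy_grad :: "real^'n \<Rightarrow> (real^'n) \<times> real \<Rightarrow> (real^'n) measure" where
  "noisy_grad wp z = Qa (fst z \<bullet> wp) \<bind> (\<lambda>aq. Qo (snd z - aq) \<bind> (\<lambda>oq. return borel (oq *\<^sub>R fst z)))"

abbreviation SG where "SG \<equiv> sample_grad D Qd Ql Qa Qo"

lemma kernel_noisy_grad2: "kernel (\<lambda>p. noisy_grad (fst p) (snd p))"
  unfolding noisy_grad_def by measurable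

lemma kernel_noisy_grad: "kernel (noisy_grad wp)"
  using measurable_compose[OF _ kernel_noisy_grad2, of "\<lambda>z. (wp, z)" borel]
  by (simp add: borel_measurable_continuous_onI continuous_intros)

text \<open>Associativity of \<open>bind\<close> gathers the data quantizers into \<open>Dq\<close>,
  the measure about which the moment assumptions speak.\<close>

lemma sample_grad_eq: "SG wp = Dq \<bind> noisy_grad wp"
proof -
  have k2: "kernel (\<lambda>xq::real^'n. Ql (snd z) \<bind> (\<lambda>yq. return borel (xq, yq)))" for z :: "(real^'n) \<times> real"
  proof (rule kernel_bind_const)
    show "Ql (snd z) \<in> prob_measures" by (rule kernel_prob_measures[OF kernel_sq[OF Ql(1)]])
  qed measurable
  have k3: "kernel (\<lambda>yq. return borel (xq, yq))" for xq :: "real^'n"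
    by (intro measurable_compose[OF _ measurable_return_prob_space]
        borel_measurable_continuous_onI continuous_intros)
  note sub = kernel_in_subprob[OF D_pm kernel_qdata]
    kernel_in_subprob[OF kernel_prob_measures[OF kernel_vq[OF Qd(1)]] k2]
    kernel_in_subprob[OF kernel_prob_measures[OF kernel_sq[OF Ql(1)]] k3]
  note ng = measurable_prob_algebraD[OF kernel_noisy_grad]
  have "Dq \<bind> noisy_grad wp = D \<bind> (\<lambda>z. Qd (fst z) \<bind> (\<lambda>xq. Ql (snd z) \<bind> (\<lambda>yq. return borel (xq, yq) \<bind> noisy_grad wp)))"
    unfolding qdata_def
    by (simp add: bind_assoc[OF sub(1) ng] bind_assoc[OF sub(2) ng] bind_assoc[OF sub(3) ng])
  also have "\<dots> = SG wp"
    unfolding sample_grad_def by (subst bind_return[OF ng]) (simp_all add: noisy_grad_def)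
  finally show ?thesis ..
qed

lemma kernel_SG: "kernel SG"
proof -
  have "kernel (\<lambda>wp. Dq \<bind> noisy_grad wp)"
    by (rule kernel_bind_const[OF Dq_pm kernel_noisy_grad2])
  then show ?thesis by (simp add: sample_grad_eq[abs_def])
qed

text \<open>Given z, the errors of \<open>Qa\<close> and \<open>Qo\<close> are centred and multiply
  the fixed vector \<open>fst z\<close>: they vanish in the mean, and their variances add in the
  square.\<close>

lemma noisy_grad_moments:
  shows "has_bochner_integral (noisy_grad wp z) (\<lambda>g. (u \<bullet> g)\<^sup>2) ((u \<bullet> fst z)\<^sup>2 * ((snd z - fst z \<bullet> wp)\<^sup>2 + (\<epsilon>a + \<epsilon>o)))"
    and "has_bochner_integral (noisy_grad wp z) (\<lambda>g. u \<bullet> g) ((u \<bullet> fst z) * (snd z - fst z \<bullet> wp))"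
proof -
  let ?K2 = "\<lambda>aq. Qo (snd z - aq) \<bind> (\<lambda>oq. return borel (oq *\<^sub>R fst z))"
  note Qo_pm = kernel_prob_measures[OF kernel_sq[OF Qo(1)]]
  note Qa_pm = kernel_prob_measures[OF kernel_sq[OF Qa(1)]]
  have K3: "kernel (\<lambda>oq. return borel (oq *\<^sub>R fst z))"
    by (intro measurable_compose[OF _ measurable_return_prob_space] borel_measurable_continuous_onI continuous_intros)
  have K2: "kernel ?K2"
    by (rule measurable_bind_prob_space[OF _ K3]) measurable
  have sq2: "has_bochner_integral (?K2 aq) (\<lambda>g. (u \<bullet> g)\<^sup>2) ((u \<bullet> fst z)\<^sup>2 * ((snd z - aq)\<^sup>2 + \<epsilon>o))" for aq
  proof (rule has_bochner_integral_bind_kernel_nonneg[OF Qo_pm K3])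
    show "has_bochner_integral (return borel (x *\<^sub>R fst z)) (\<lambda>g. (u \<bullet> g)\<^sup>2) ((u \<bullet> fst z)\<^sup>2 * (x - 0)\<^sup>2)" for x
      using has_bochner_integral_return[of "\<lambda>g. (u \<bullet> g)\<^sup>2" "x *\<^sub>R fst z"]
      by (simp add: power_mult_distrib mult.commute)
    show "has_bochner_integral (Qo (snd z - aq)) (\<lambda>x. (u \<bullet> fst z)\<^sup>2 * (x - 0)\<^sup>2) ((u \<bullet> fst z)\<^sup>2 * ((snd z - aq)\<^sup>2 + \<epsilon>o))"
      using sq_square[OF Qo, of "snd z - aq" 0] by (intro has_bochner_integral_mult_right) simp
  qed auto
  show sq: "has_bochner_integral (noisy_grad wp z) (\<lambda>g. (u \<bullet> g)\<^sup>2) ((u \<bullet> fst z)\<^sup>2 * ((snd z - fst z \<bullet> wp)\<^sup>2 + (\<epsilon>a + \<epsilon>o)))"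
    unfolding noisy_grad_def
  proof (rule has_bochner_integral_bind_kernel_nonneg[OF Qa_pm K2 _ _ sq2])
    have "has_bochner_integral (Qa (fst z \<bullet> wp)) (\<lambda>aq. (u \<bullet> fst z)\<^sup>2 * ((aq - snd z)\<^sup>2 + \<epsilon>o))
        ((u \<bullet> fst z)\<^sup>2 * ((fst z \<bullet> wp - snd z)\<^sup>2 + \<epsilon>a + \<epsilon>o))"
      by (intro has_bochner_integral_mult_right has_bochner_integral_add sq_square[OF Qa] has_bochner_integral_const_prob Qa_pm)
    then show "has_bochner_integral (Qa (fst z \<bullet> wp)) (\<lambda>aq. (u \<bullet> fst z)\<^sup>2 * ((snd z - aq)\<^sup>2 + \<epsilon>o))
        ((u \<bullet> fst z)\<^sup>2 * ((snd z - fst z \<bullet> wp)\<^sup>2 + (\<epsilon>a + \<epsilon>o)))"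
      by (simp add: power2_commute add.assoc)
  qed auto
  have meas: "(\<lambda>g. u \<bullet> g) \<in> borel_measurable borel" by measurable
  have lin2: "has_bochner_integral (?K2 aq) (\<lambda>g. u \<bullet> g) ((u \<bullet> fst z) * (snd z - aq))" for aq
  proof -
    have pm: "?K2 aq \<in> prob_measures" by (rule kernel_prob_measures[OF K2])
    have i: "integrable (?K2 aq) (\<lambda>g. u \<bullet> g)"
      by (rule integrable_of_square[OF pm borel_measurable_prob_measures[OF pm meas] integrable.intros[OF sq2]])
    have "has_bochner_integral (?K2 aq) (\<lambda>g. u \<bullet> g) (\<integral>x. (u \<bullet> fst z) * x \<partial>Qo (snd z - aq))"
    proof (rule has_bochner_integral_bind_kernel(1)[OF Qo_pm K3 meas i])
      show "has_bochner_integral (return borel (x *\<^sub>R fst z)) ((\<bullet>) u) (u \<bullet> fst z * x)" for x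
        using has_bochner_integral_return[OF meas, of "x *\<^sub>R fst z"] by (simp add: mult.commute)
    qed
    moreover have "has_bochner_integral (Qo (snd z - aq)) (\<lambda>x. (u \<bullet> fst z) * x) ((u \<bullet> fst z) * (snd z - aq))"
      by (intro has_bochner_integral_mult_right sq_mean Qo)
    ultimately show ?thesis by (simp add: has_bochner_integral_iff)
  qed
  have pm: "noisy_grad wp z \<in> prob_measures" by (rule kernel_prob_measures[OF kernel_noisy_grad])
  have i: "integrable (noisy_grad wp z) (\<lambda>g. u \<bullet> g)"
    by (rule integrable_of_square[OF pm borel_measurable_prob_measures[OF pm meas] integrable.intros[OF sq]])
  have "has_bochner_integral (noisy_grad wp z) (\<lambda>g. u \<bullet> g) (\<integral>aq. (u \<bullet> fst z) * (snd z - aq) \<partial>Qa (fst z \<bullet> wp))"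
    unfolding noisy_grad_def
    by (rule has_bochner_integral_bind_kernel(1)[OF Qa_pm K2 meas i[unfolded noisy_grad_def] lin2])
  moreover have "has_bochner_integral (Qa (fst z \<bullet> wp)) (\<lambda>aq. (u \<bullet> fst z) * (snd z - aq)) ((u \<bullet> fst z) * (snd z - fst z \<bullet> wp))"
    by (intro has_bochner_integral_mult_right has_bochner_integral_diff has_bochner_integral_const_prob Qa_pm sq_mean Qa)
  ultimately show "has_bochner_integral (noisy_grad wp z) (\<lambda>g. u \<bullet> g) ((u \<bullet> fst z) * (snd z - fst z \<bullet> wp))"
    by (simp add: has_bochner_integral_iff)
qed

text \<open>Here d is the offset of the quantized parameter from the minimizer, so the residual is
  \<xi> - d \<bullet> x. Expanding its square produces the three moments; \<open>xi_orth\<close>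
  removes \<xi> from the mean.\<close>

lemma SG_moments:
  shows "has_bochner_integral (SG (wq + d)) (\<lambda>g. (u \<bullet> g)\<^sup>2)
      (resid_moment u - 2 * cross u d + quartic u d + (\<epsilon>a + \<epsilon>o) * (u \<bullet> (K *v u)))"
    and "has_bochner_integral (SG (wq + d)) (\<lambda>g. u \<bullet> g) (- (u \<bullet> (K *v d)))"
proof -
  have res: "snd z - fst z \<bullet> (wq + d) = \<xi> z - d \<bullet> fst z" for z
    by (simp add: inner_add_right inner_commute)
  show sq: "has_bochner_integral (SG (wq + d)) (\<lambda>g. (u \<bullet> g)\<^sup>2)
      (resid_moment u - 2 * cross u d + quartic u d + (\<epsilon>a + \<epsilon>o) * (u \<bullet> (K *v u)))"
    unfolding sample_grad_eq
  proof (rule has_bochner_integral_bind_kernel_nonneg[OF Dq_pm kernel_noisy_grad _ _ noisy_grad_moments(1)])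
    have "has_bochner_integral Dq (\<lambda>z. (\<xi> z * (u \<bullet> fst z))\<^sup>2 - 2 * ((\<xi> z * (u \<bullet> fst z)) * ((u \<bullet> fst z) * (d \<bullet> fst z)))
        + ((u \<bullet> fst z) * (d \<bullet> fst z))\<^sup>2 + (\<epsilon>a + \<epsilon>o) * ((u \<bullet> fst z) * (u \<bullet> fst z)))
      (resid_moment u - 2 * cross u d + quartic u d + (\<epsilon>a + \<epsilon>o) * (u \<bullet> (K *v u)))"
      by (intro has_bochner_integral_add has_bochner_integral_diff has_bochner_integral_mult_right second_moment_Dq)
         (simp_all add: has_bochner_integral_iff noise_rank1(1) fourth_rank1(1) cross_integrable)
    moreover have "(\<xi> z * (u \<bullet> fst z))\<^sup>2 - 2 * ((\<xi> z * (u \<bullet> fst z)) * ((u \<bullet> fst z) * (d \<bullet> fst z)))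
        + ((u \<bullet> fst z) * (d \<bullet> fst z))\<^sup>2 + (\<epsilon>a + \<epsilon>o) * ((u \<bullet> fst z) * (u \<bullet> fst z))
        = (u \<bullet> fst z)\<^sup>2 * ((snd z - fst z \<bullet> (wq + d))\<^sup>2 + (\<epsilon>a + \<epsilon>o))" for z
      unfolding res by (simp only: power2_eq_square) (simp add: algebra_simps)
    ultimately show "has_bochner_integral Dq (\<lambda>z. (u \<bullet> fst z)\<^sup>2 * ((snd z - fst z \<bullet> (wq + d))\<^sup>2 + (\<epsilon>a + \<epsilon>o)))
      (resid_moment u - 2 * cross u d + quartic u d + (\<epsilon>a + \<epsilon>o) * (u \<bullet> (K *v u)))" by simp
  qed auto
  have meas: "(\<lambda>g. u \<bullet> g) \<in> borel_measurable borel" by measurable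
  have pm: "SG (wq + d) \<in> prob_measures" by (rule kernel_prob_measures[OF kernel_SG])
  have i: "integrable (SG (wq + d)) (\<lambda>g. u \<bullet> g)"
    by (rule integrable_of_square[OF pm borel_measurable_prob_measures[OF pm meas] integrable.intros[OF sq]])
  have "has_bochner_integral (SG (wq + d)) (\<lambda>g. u \<bullet> g) (\<integral>z. (u \<bullet> fst z) * (snd z - fst z \<bullet> (wq + d)) \<partial>Dq)"
    unfolding sample_grad_eq
    by (rule has_bochner_integral_bind_kernel(1)[OF Dq_pm kernel_noisy_grad meas i[unfolded sample_grad_eq] noisy_grad_moments(2)])
  moreover have "has_bochner_integral Dq (\<lambda>z. \<xi> z * (u \<bullet> fst z) - (u \<bullet> fst z) * (d \<bullet> fst z)) (0 - u \<bullet> (K *v d))"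
    by (intro has_bochner_integral_diff xi_orth second_moment_Dq)
  ultimately show "has_bochner_integral (SG (wq + d)) (\<lambda>g. u \<bullet> g) (- (u \<bullet> (K *v d)))"
    unfolding res by (simp add: has_bochner_integral_iff algebra_simps)
qed

end

lemma has_bochner_integral_bind_return:
  fixes f :: "'b::topological_space \<Rightarrow> real"
  assumes M: "M \<in> prob_measures" and h: "h \<in> borel \<rightarrow>\<^sub>M borel" and f: "f \<in> borel_measurable borel"
  shows "has_bochner_integral (M \<bind> (\<lambda>x. return borel (h x))) f c \<longleftrightarrow> has_bochner_integral M (\<lambda>x. f (h x)) c"
proof -
  have hM: "h \<in> M \<rightarrow>\<^sub>M borel" using h M by (simp add: space_prob_algebra cong: measurable_cong_sets)
  have "M \<bind> (\<lambda>x. return borel (h x)) = distr M borel h"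
    by (rule bind_return_distr'[OF _ hM]) (simp add: prob_measuresD(3)[OF M])
  then show ?thesis using hM f by (simp add: has_bochner_integral_iff integrable_distr_eq integral_distr)
qed

section \<open>Batch gradients and the cross term\<close>

context quantized_sgd begin

declare kernel_SG [measurable]

abbreviation BG where "BG wp b \<equiv> batch_grad D Qd Ql Qa Qo wp b"

lemma kernel_BG [measurable]: "kernel (\<lambda>wp. BG wp b)"
proof (induction b)
  case 0
  show ?case by (simp add: space_prob_algebra prob_space_return)
next
  case (Suc b)
  note [measurable] = this
  show ?case unfolding batch_grad.simps by measurable
qed

text \<open>The second moment along u of the averaged batch gradient at parameter
  \<open>wq + d\<close>: weight 1/B for the diagonal pairs of samples, (B - 1)/B for the distinct
  ones.\<close>

definition batch_grad_sq :: "real^'n \<Rightarrow> real^'n \<Rightarrow> real" where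
  "batch_grad_sq u d = (resid_moment u - 2 * cross u d + quartic u d + (\<epsilon>a + \<epsilon>o) * (u \<bullet> (K *v u))) / real B
     + (real B - 1) / real B * (u \<bullet> (K *v d))\<^sup>2"

lemma BG_moments:
  shows "has_bochner_integral (BG (wq + d) B) (\<lambda>g. u \<bullet> g) (- real B * (u \<bullet> (K *v d)))"
    and "has_bochner_integral (BG (wq + d) B) (\<lambda>g. (u \<bullet> g)\<^sup>2) ((real B)\<^sup>2 * batch_grad_sq u d)"
proof -
  note SG_pm = kernel_prob_measures[OF kernel_SG, of "wq + d"]
  have I: "p \<in> {u, u} \<Longrightarrow> integrable (SG (wq + d)) (\<lambda>z. (p \<bullet> z)\<^sup>2)" for p
    using SG_moments(1)[of d u] by (simp add: has_bochner_integral_iff)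
  have E1: "(\<integral>g. u \<bullet> g \<partial>SG (wq + d)) = - (u \<bullet> (K *v d))"
    using SG_moments(2)[of d u] by (simp add: has_bochner_integral_iff)
  have E2: "(\<integral>g. (u \<bullet> g) * (u \<bullet> g) \<partial>SG (wq + d)) = resid_moment u - 2 * cross u d + quartic u d + (\<epsilon>a + \<epsilon>o) * (u \<bullet> (K *v u))"
    using SG_moments(1)[of d u] by (simp add: has_bochner_integral_iff power2_eq_square)
  note iid = iid_sum_moments[OF SG_pm measurable_ident, where P="BG (wq + d)" and b=B and ?p1.0=u and ?p2.0=u,
      unfolded id_def, OF batch_grad.simps I]
  show "has_bochner_integral (BG (wq + d) B) (\<lambda>g. u \<bullet> g) (- real B * (u \<bullet> (K *v d)))"
    using iid(3)[of u] by (simp add: E1)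
  have "(real B)\<^sup>2 * batch_grad_sq u d = real B * (resid_moment u - 2 * cross u d + quartic u d + (\<epsilon>a + \<epsilon>o) * (u \<bullet> (K *v u)))
     + real B * (real B - 1) * (u \<bullet> (K *v d))\<^sup>2"
    using B_pos by (simp add: batch_grad_sq_def power2_eq_square field_simps)
  then show "has_bochner_integral (BG (wq + d) B) (\<lambda>g. (u \<bullet> g)\<^sup>2) ((real B)\<^sup>2 * batch_grad_sq u d)"
    using iid(4) unfolding E1 E2 by (simp add: power2_eq_square mult.assoc)
qed

lemma batch_grad_sq_nonneg: "0 \<le> batch_grad_sq u d"
  using has_bochner_integral_nonneg[OF BG_moments(2), of u d] B_pos by (simp add: zero_le_mult_iff)

definition cross_vec :: "real^'n \<Rightarrow> real^'n" where "cross_vec u = (SOME c. \<forall>d. cross u d = c \<bullet> d)"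

lemma cross_eq_inner: "cross u d = cross_vec u \<bullet> d"
  using someI_ex[OF cross_inner[of u]] unfolding cross_vec_def by blast

text \<open>The value of \<open>batch_grad_sq u\<close> at d = 0, that is, the gradient noise at the
  minimizer.\<close>

definition \<kappa> :: "real^'n \<Rightarrow> real" where "\<kappa> u = (resid_moment u + (\<epsilon>a + \<epsilon>o) * (u \<bullet> (K *v u))) / real B"

lemma batch_grad_sq_eq: "batch_grad_sq u d = \<kappa> u - 2 / real B * (cross_vec u \<bullet> d) + (quartic u d / real B + (real B - 1) / real B * (u \<bullet> (K *v d))\<^sup>2)"
  unfolding batch_grad_sq_def \<kappa>_def cross_eq_inner[symmetric] by (simp add: add_divide_distrib diff_divide_distrib)

lemma batch_grad_sq_le: "batch_grad_sq u d \<le> \<alpha> * (d \<bullet> (K *v d)) * (u \<bullet> (K *v u)) - 2 / real B * (cross_vec u \<bullet> d) + \<kappa> u"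
  unfolding batch_grad_sq_eq using gram_bound[of u d] by linarith

text \<open>The second moment at the reflected point is nonnegative, which absorbs the cross term of
  signal and residual noise without splitting the iterates into a bias and a variance process.\<close>
lemma cross_le: "- 2 / real B * (cross_vec u \<bullet> d) \<le> \<alpha> * (d \<bullet> (K *v d)) * (u \<bullet> (K *v u)) + \<kappa> u"
proof -
  \<comment> \<open>Replacing d by -d preserves the quadratic part and flips the linear one.\<close>
  have "K *v (- d) = - (K *v d)" using matrix_vector_mult_scaleR[of K "-1" d] by simp
  then show ?thesis
    using batch_grad_sq_nonneg[of u "- d"] gram_bound[of u d] unfolding batch_grad_sq_eq by simp
qed

lemma kappa_le: "\<kappa> u \<le> ((\<epsilon>o + \<epsilon>a) / real B + \<sigma>2 / real B) * (u \<bullet> (K *v u))"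
proof -
  have "\<kappa> u \<le> (\<sigma>2 * (u \<bullet> (K *v u)) + (\<epsilon>a + \<epsilon>o) * (u \<bullet> (K *v u))) / real B"
    unfolding \<kappa>_def by (intro divide_right_mono add_right_mono noise_rank1(2)) simp
  then show ?thesis by (simp add: add_divide_distrib algebra_simps)
qed

subsection \<open>One step\<close>

abbreviation STEP where "STEP \<equiv> sgd_step D Qd Ql Qp Qa Qo \<gamma> B"

definition update :: "real^'n \<Rightarrow> real^'n \<Rightarrow> (real^'n) measure" where
  "update w wp = BG wp B \<bind> (\<lambda>g. return borel (w + (\<gamma> / real B) *\<^sub>R g))"

lemma kernel_update: "kernel (update w)"
  unfolding update_def by measurable

lemma kernel_STEP: "kernel STEP"
  unfolding sgd_step_def by measurable

lemma STEP_eq: "STEP w = Qp w \<bind> update w"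
  unfolding sgd_step_def update_def ..

lemma update_moments:
  shows "has_bochner_integral (update w (wq + d)) (\<lambda>w'. (u \<bullet> (w' - wq))\<^sup>2)
      ((u \<bullet> (w - wq))\<^sup>2 - 2 * \<gamma> * (u \<bullet> (w - wq)) * (u \<bullet> (K *v d)) + \<gamma>\<^sup>2 * batch_grad_sq u d)"
    and "has_bochner_integral (update w (wq + d)) (\<lambda>w'. u \<bullet> (w' - wq)) (u \<bullet> (w - wq) - \<gamma> * (u \<bullet> (K *v d)))"
proof -
  note BG_pm = kernel_prob_measures[OF kernel_BG, of "wq + d" B]
  have h: "(\<lambda>g. w + (\<gamma> / real B) *\<^sub>R g) \<in> borel \<rightarrow>\<^sub>M borel" by measurable
  have eq: "u \<bullet> (w + (\<gamma> / real B) *\<^sub>R g - wq) = u \<bullet> (w - wq) + \<gamma> / real B * (u \<bullet> g)" for g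
    by (simp add: inner_add_right inner_diff_right)
  have square_meas: "(\<lambda>w'. (u \<bullet> (w' - wq))\<^sup>2) \<in> borel_measurable borel" by measurable
  have "has_bochner_integral (BG (wq + d) B)
     (\<lambda>g. (u \<bullet> (w - wq))\<^sup>2 + 2 * (u \<bullet> (w - wq)) * (\<gamma> / real B) * (u \<bullet> g) + (\<gamma> / real B)\<^sup>2 * (u \<bullet> g)\<^sup>2)
     ((u \<bullet> (w - wq))\<^sup>2 + 2 * (u \<bullet> (w - wq)) * (\<gamma> / real B) * (- real B * (u \<bullet> (K *v d))) + (\<gamma> / real B)\<^sup>2 * ((real B)\<^sup>2 * batch_grad_sq u d))"
    by (intro has_bochner_integral_add has_bochner_integral_mult_right BG_moments has_bochner_integral_const_prob BG_pm)
  moreover have "(u \<bullet> (w - wq))\<^sup>2 + 2 * (u \<bullet> (w - wq)) * (\<gamma> / real B) * (u \<bullet> g) + (\<gamma> / real B)\<^sup>2 * (u \<bullet> g)\<^sup>2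
      = (u \<bullet> (w + (\<gamma> / real B) *\<^sub>R g - wq))\<^sup>2" for g
    unfolding eq by (simp only: power2_eq_square) (simp add: algebra_simps)
  moreover have "(u \<bullet> (w - wq))\<^sup>2 + 2 * (u \<bullet> (w - wq)) * (\<gamma> / real B) * (- real B * (u \<bullet> (K *v d))) + (\<gamma> / real B)\<^sup>2 * ((real B)\<^sup>2 * batch_grad_sq u d)
      = (u \<bullet> (w - wq))\<^sup>2 - 2 * \<gamma> * (u \<bullet> (w - wq)) * (u \<bullet> (K *v d)) + \<gamma>\<^sup>2 * batch_grad_sq u d"
    using B_pos by (simp add: power_divide)
  ultimately show "has_bochner_integral (update w (wq + d)) (\<lambda>w'. (u \<bullet> (w' - wq))\<^sup>2)
      ((u \<bullet> (w - wq))\<^sup>2 - 2 * \<gamma> * (u \<bullet> (w - wq)) * (u \<bullet> (K *v d)) + \<gamma>\<^sup>2 * batch_grad_sq u d)"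
    unfolding update_def has_bochner_integral_bind_return[OF BG_pm h square_meas] by (simp only:)
  have "has_bochner_integral (BG (wq + d) B) (\<lambda>g. u \<bullet> (w - wq) + \<gamma> / real B * (u \<bullet> g))
     (u \<bullet> (w - wq) + \<gamma> / real B * (- real B * (u \<bullet> (K *v d))))"
    by (intro has_bochner_integral_add has_bochner_integral_mult_right BG_moments has_bochner_integral_const_prob BG_pm)
  then show "has_bochner_integral (update w (wq + d)) (\<lambda>w'. u \<bullet> (w' - wq)) (u \<bullet> (w - wq) - \<gamma> * (u \<bullet> (K *v d)))"
    unfolding update_def using B_pos by (subst has_bochner_integral_bind_return[OF BG_pm h]) (simp_all add: eq)
qed

text \<open>From here on d is the offset of the parameter before \<open>Qp\<close> acts. Quantizing
  it adds the mean energy \<open>\<epsilon>p * trace K\<close>; terms linear in the offset see only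
  its mean and do not change.\<close>

definition step_bound :: "real^'n \<Rightarrow> real^'n \<Rightarrow> real" where
  "step_bound u d = (u \<bullet> d)\<^sup>2 - 2 * \<gamma> * (u \<bullet> d) * (u \<bullet> (K *v d))
     + \<gamma>\<^sup>2 * (\<alpha> * (d \<bullet> (K *v d) + \<epsilon>p * trace K) * (u \<bullet> (K *v u)) - 2 / real B * (cross_vec u \<bullet> d) + \<kappa> u)"

lemma K_inner_swap: "u \<bullet> (K *v d) = (K *v u) \<bullet> d"
  using K_sym[of u d] by (simp add: inner_commute)

lemmas l_eig = sorted_eigendecompD[OF eig]

lemma Qp_moments:
  shows "has_bochner_integral (Qp w) (\<lambda>x. u \<bullet> (x - wq)) (u \<bullet> (w - wq))"
    and "has_bochner_integral (Qp w) (\<lambda>x. (x - wq) \<bullet> (K *v (x - wq))) ((w - wq) \<bullet> (K *v (w - wq)) + \<epsilon>p * trace K)"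
proof -
  note pm = kernel_prob_measures[OF kernel_vq[OF Qp(1)]]
  have "has_bochner_integral (Qp w) (\<lambda>x. u \<bullet> x - u \<bullet> wq) (u \<bullet> w - u \<bullet> wq)"
    by (intro has_bochner_integral_diff vq_mean Qp has_bochner_integral_const_prob pm)
  then show "has_bochner_integral (Qp w) (\<lambda>x. u \<bullet> (x - wq)) (u \<bullet> (w - wq))"
    by (simp add: inner_diff_right)
  \<comment> \<open>In the eigenbasis the K-energy is a weighted sum of squares; each unit
    eigenvector picks up the variance \<open>\<epsilon>p\<close>, in total
    \<open>\<epsilon>p * trace K\<close>.\<close>
  have "has_bochner_integral (Qp w) (\<lambda>x. \<Sum>i=1..CARD('n). l i * (v i \<bullet> x - v i \<bullet> wq)\<^sup>2)
      (\<Sum>i=1..CARD('n). l i * ((v i \<bullet> w - v i \<bullet> wq)\<^sup>2 + \<epsilon>p * (v i \<bullet> v i)))"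
    by (intro has_bochner_integral_sum has_bochner_integral_mult_right vq_square Qp)
  moreover have "(\<Sum>i=1..CARD('n). l i * ((v i \<bullet> w - v i \<bullet> wq)\<^sup>2 + \<epsilon>p * (v i \<bullet> v i)))
      = (w - wq) \<bullet> (K *v (w - wq)) + \<epsilon>p * trace K"
    unfolding l_eig(2,4) sum_distrib_left sum.distrib[symmetric]
    by (intro sum.cong refl) (simp add: l_eig(1) inner_diff_right power2_eq_square algebra_simps)
  moreover have "(\<Sum>i=1..CARD('n). l i * (v i \<bullet> x - v i \<bullet> wq)\<^sup>2) = (x - wq) \<bullet> (K *v (x - wq))" for x
    unfolding l_eig(2) by (intro sum.cong refl) (simp add: inner_diff_right power2_eq_square algebra_simps)
  ultimately show "has_bochner_integral (Qp w) (\<lambda>x. (x - wq) \<bullet> (K *v (x - wq))) ((w - wq) \<bullet> (K *v (w - wq)) + \<epsilon>p * trace K)"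
    by simp
qed

lemma STEP_square:
  shows "integrable (STEP w) (\<lambda>w'. (u \<bullet> (w' - wq))\<^sup>2)"
    and "(\<integral>w'. (u \<bullet> (w' - wq))\<^sup>2 \<partial>STEP w) \<le> step_bound u (w - wq)"
proof -
  note pm = kernel_prob_measures[OF kernel_vq[OF Qp(1)], of w]
  \<comment> \<open>The batch bound is applied for each value x of the quantized parameter before
    averaging over \<open>Qp\<close>; what remains is one K-quadratic form and linear forms in x,
    whose means are known.\<close>
  define g where "g x = (u \<bullet> (w - wq))\<^sup>2 - 2 * \<gamma> * (u \<bullet> (w - wq)) * (u \<bullet> (K *v (x - wq)))
     + \<gamma>\<^sup>2 * (\<alpha> * ((x - wq) \<bullet> (K *v (x - wq))) * (u \<bullet> (K *v u)) - 2 / real B * (cross_vec u \<bullet> (x - wq)) + \<kappa> u)" for x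
  have g: "has_bochner_integral (Qp w) g (step_bound u (w - wq))"
    unfolding g_def step_bound_def K_inner_swap[of u "_ - wq"]
    by (intro has_bochner_integral_add has_bochner_integral_diff has_bochner_integral_mult_right
        has_bochner_integral_mult_left has_bochner_integral_const_prob pm Qp_moments)
  have m: "has_bochner_integral (update w x) (\<lambda>w'. (u \<bullet> (w' - wq))\<^sup>2)
      ((u \<bullet> (w - wq))\<^sup>2 - 2 * \<gamma> * (u \<bullet> (w - wq)) * (u \<bullet> (K *v (x - wq))) + \<gamma>\<^sup>2 * batch_grad_sq u (x - wq))" for x
    using update_moments(1)[of w "x - wq" u] by simp
  have le: "(\<integral>w'. (u \<bullet> (w' - wq))\<^sup>2 \<partial>update w x) \<le> g x" for x
    using m[of x] unfolding g_def has_bochner_integral_iff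
    by (auto intro!: mult_left_mono batch_grad_sq_le simp del: times_divide_eq_left)
  have meas: "(\<lambda>w'. (u \<bullet> (w' - wq))\<^sup>2) \<in> borel_measurable borel" by measurable
  show "integrable (STEP w) (\<lambda>w'. (u \<bullet> (w' - wq))\<^sup>2)"
    "(\<integral>w'. (u \<bullet> (w' - wq))\<^sup>2 \<partial>STEP w) \<le> step_bound u (w - wq)"
    using integrable_bind_kernel[OF pm kernel_update meas _ integrable.intros[OF m] le integrable.intros[OF g]] g
    by (simp_all add: STEP_eq has_bochner_integral_iff)
qed

lemma STEP_mean:
  "has_bochner_integral (STEP w) (\<lambda>w'. u \<bullet> (w' - wq)) (u \<bullet> (w - wq) - \<gamma> * (u \<bullet> (K *v (w - wq))))"
proof -
  note pm = kernel_prob_measures[OF kernel_vq[OF Qp(1)], of w]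
  have meas: "(\<lambda>w'. u \<bullet> (w' - wq)) \<in> borel_measurable borel" by measurable
  note spm = kernel_prob_measures[OF kernel_STEP, of w]
  have i: "integrable (STEP w) (\<lambda>w'. u \<bullet> (w' - wq))"
    by (rule integrable_of_square[OF spm borel_measurable_prob_measures[OF spm meas] STEP_square(1)])
  have m: "has_bochner_integral (update w x) (\<lambda>w'. u \<bullet> (w' - wq)) (u \<bullet> (w - wq) - \<gamma> * (u \<bullet> (K *v (x - wq))))" for x
    using update_moments(2)[of w "x - wq" u] by simp
  have "has_bochner_integral (STEP w) (\<lambda>w'. u \<bullet> (w' - wq))
     (\<integral>x. u \<bullet> (w - wq) - \<gamma> * (u \<bullet> (K *v (x - wq))) \<partial>Qp w)"
    using has_bochner_integral_bind_kernel(1)[OF pm kernel_update meas i[unfolded STEP_eq] m] by (simp add: STEP_eq)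
  moreover have "has_bochner_integral (Qp w) (\<lambda>x. u \<bullet> (w - wq) - \<gamma> * (u \<bullet> (K *v (x - wq))))
     (u \<bullet> (w - wq) - \<gamma> * (u \<bullet> (K *v (w - wq))))"
    unfolding K_inner_swap[of u "_ - wq"]
    by (intro has_bochner_integral_diff has_bochner_integral_mult_right has_bochner_integral_const_prob pm Qp_moments)
  ultimately show ?thesis by (simp add: has_bochner_integral_iff)
qed

subsection \<open>Trajectory\<close>

abbreviation TR where "TR t \<equiv> sgd_traj D Qd Ql Qp Qa Qo \<gamma> B t"

definition traj_kernel :: "(real^'n) \<times> (real^'n) \<Rightarrow> ((real^'n) \<times> (real^'n)) measure" where
  "traj_kernel s = STEP (fst s) \<bind> (\<lambda>w'. return borel (w', snd s + fst s))"

lemma kernel_traj_kernel: "kernel traj_kernel"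
  unfolding traj_kernel_def
proof (rule measurable_bind_prob_space2[where N=borel])
  show "(\<lambda>s::(real^'n) \<times> (real^'n). STEP (fst s)) \<in> borel \<rightarrow>\<^sub>M prob_algebra borel"
    using measurable_compose[OF fst_borel_measurable kernel_STEP] .
qed measurable

lemma TR_Suc: "TR (Suc t) = TR t \<bind> traj_kernel"
  unfolding traj_kernel_def by simp

lemma TR_pm: "TR t \<in> prob_measures"
proof (induction t)
  case 0
  show ?case by (simp add: space_prob_algebra prob_space_return)
next
  case (Suc t)
  then show ?case unfolding TR_Suc by (rule bind_prob_measures[OF _ kernel_traj_kernel])
qed

lemma has_bochner_integral_traj_kernel:
  fixes f :: "(real^'n) \<times> (real^'n) \<Rightarrow> real"
  assumes f: "f \<in> borel_measurable borel"
  shows "has_bochner_integral (traj_kernel s) f c \<longleftrightarrow> has_bochner_integral (STEP (fst s)) (\<lambda>w'. f (w', snd s + fst s)) c"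
  unfolding traj_kernel_def
  by (rule has_bochner_integral_bind_return[OF kernel_prob_measures[OF kernel_STEP] _ f]) measurable

text \<open>Deterministic gradient descent on half the quantized risk, in coordinates centred at
  \<open>wq\<close>; it starts at -wq since w_0 = 0. Unbiasedness makes it the exact mean of the
  error.\<close>

primrec mean_err :: "nat \<Rightarrow> real^'n" where
  "mean_err 0 = - wq"
| "mean_err (Suc t) = mean_err t - \<gamma> *\<^sub>R (K *v mean_err t)"

lemma traj_kernel_err_square:
  shows "integrable (traj_kernel s) (\<lambda>s. (u \<bullet> (fst s - wq))\<^sup>2)"
    and "(\<integral>s'. (u \<bullet> (fst s' - wq))\<^sup>2 \<partial>traj_kernel s) \<le> step_bound u (fst s - wq)"
proof -
  have meas: "(\<lambda>s::(real^'n) \<times> (real^'n). (u \<bullet> (fst s - wq))\<^sup>2) \<in> borel_measurable borel" by measurable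
  show "integrable (traj_kernel s) (\<lambda>s. (u \<bullet> (fst s - wq))\<^sup>2)"
    "(\<integral>s'. (u \<bullet> (fst s' - wq))\<^sup>2 \<partial>traj_kernel s) \<le> step_bound u (fst s - wq)"
    using has_bochner_integral_traj_kernel[OF meas, of s "\<integral>w'. (u \<bullet> (w' - wq))\<^sup>2 \<partial>STEP (fst s)"]
      STEP_square[of "fst s" u]
    by (simp_all add: has_bochner_integral_iff)
qed

lemma traj_kernel_err_mean:
  "has_bochner_integral (traj_kernel s) (\<lambda>s'. u \<bullet> (fst s' - wq)) (u \<bullet> (fst s - wq) - \<gamma> * (u \<bullet> (K *v (fst s - wq))))"
proof -
  have meas: "(\<lambda>s::(real^'n) \<times> (real^'n). u \<bullet> (fst s - wq)) \<in> borel_measurable borel" by measurable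
  show ?thesis using has_bochner_integral_traj_kernel[OF meas] STEP_mean[of "fst s" u] by simp
qed

lemma traj_kernel_sum_square: "has_bochner_integral (traj_kernel s) (\<lambda>s'. (u \<bullet> (snd s' - a))\<^sup>2) ((u \<bullet> (snd s + fst s - a))\<^sup>2)"
proof -
  have meas: "(\<lambda>s::(real^'n) \<times> (real^'n). (u \<bullet> (snd s - a))\<^sup>2) \<in> borel_measurable borel" by measurable
  show ?thesis unfolding has_bochner_integral_traj_kernel[OF meas]
    using has_bochner_integral_const_prob[OF kernel_prob_measures[OF kernel_STEP]] by simp
qed

lemma TR_meas: "f \<in> borel_measurable borel \<Longrightarrow> f \<in> borel_measurable (TR t)"
  by (rule borel_measurable_prob_measures[OF TR_pm])

lemma integrable_square_add:
  fixes f g :: "'a \<Rightarrow> real"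
  assumes "f \<in> borel_measurable M" "g \<in> borel_measurable M"
    and "integrable M (\<lambda>x. (f x)\<^sup>2)" "integrable M (\<lambda>x. (g x)\<^sup>2)"
  shows "integrable M (\<lambda>x. (f x + g x)\<^sup>2)"
proof -
  have "integrable M (\<lambda>x. (f x)\<^sup>2 + 2 * (f x * g x) + (g x)\<^sup>2)"
    using assms integrable_mult_of_squares[OF assms] by simp
  moreover have "(\<lambda>x. (f x)\<^sup>2 + 2 * (f x * g x) + (g x)\<^sup>2) = (\<lambda>x. (f x + g x)\<^sup>2)"
    by (auto simp: power2_sum)
  ultimately show ?thesis by simp
qed

lemma step_bound_integrable:
  assumes sq: "\<And>u. integrable (TR t) (\<lambda>s. (u \<bullet> (fst s - wq))\<^sup>2)"
  shows "integrable (TR t) (\<lambda>s. step_bound u (fst s - wq))"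
proof -
  have meas: "(\<lambda>s::(real^'n) \<times> (real^'n). u \<bullet> (fst s - wq)) \<in> borel_measurable (TR t)" for u
    by (rule TR_meas) measurable
  have lin: "integrable (TR t) (\<lambda>s. u \<bullet> (fst s - wq))" for u
    by (rule integrable_of_square[OF TR_pm meas sq])
  have prod: "integrable (TR t) (\<lambda>s. (u \<bullet> (fst s - wq)) * (w \<bullet> (fst s - wq)))" for u w
    by (rule integrable_mult_of_squares[OF meas meas sq sq])
  have const: "integrable (TR t) (\<lambda>s. c)" for c :: real
    using has_bochner_integral_const_prob[OF TR_pm] by (simp add: has_bochner_integral_iff)
  show ?thesis
    unfolding step_bound_def K_inner_swap[of u "_ - wq"] l_eig(2)[of "_ - wq" "_ - wq"]
    by (intro Bochner_Integration.integrable_add Bochner_Integration.integrable_diff integrable_mult_right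
        integrable_mult_left Bochner_Integration.integrable_sum const sq)
       (auto simp: mult.assoc intro!: prod lin integrable_mult_right)
qed

text \<open>One induction over all directions and centres: the step bound for u involves the energy
  in every eigendirection, and adding an iterate to the accumulated sum moves the centre by
  \<open>wq\<close>.\<close>

lemma TR_integrable:
  shows "integrable (TR t) (\<lambda>s. (u \<bullet> (fst s - wq))\<^sup>2)"
    and "integrable (TR t) (\<lambda>s. (u \<bullet> (snd s - a))\<^sup>2)"
    and "has_bochner_integral (TR t) (\<lambda>s. u \<bullet> (fst s - wq)) (u \<bullet> mean_err t)"
proof -
  have "(\<forall>u. integrable (TR t) (\<lambda>s. (u \<bullet> (fst s - wq))\<^sup>2)) \<and>
    (\<forall>u a. integrable (TR t) (\<lambda>s. (u \<bullet> (snd s - a))\<^sup>2)) \<and>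
    (\<forall>u. has_bochner_integral (TR t) (\<lambda>s. u \<bullet> (fst s - wq)) (u \<bullet> mean_err t))"
  proof (induction t)
    case 0
    have m: "(\<lambda>s::(real^'n) \<times> (real^'n). (u \<bullet> (fst s - wq))\<^sup>2) \<in> borel_measurable borel"
      "(\<lambda>s::(real^'n) \<times> (real^'n). (u \<bullet> (snd s - a))\<^sup>2) \<in> borel_measurable borel"
      "(\<lambda>s::(real^'n) \<times> (real^'n). u \<bullet> (fst s - wq)) \<in> borel_measurable borel" for u a
      by measurable
    show ?case
      using integrable.intros[OF has_bochner_integral_return[OF m(1)]]
        integrable.intros[OF has_bochner_integral_return[OF m(2)]]
        has_bochner_integral_return[OF m(3), of "(0, 0)"] by simp
  next
    case (Suc t)
    have sq: "integrable (TR t) (\<lambda>s. (u \<bullet> (fst s - wq))\<^sup>2)" for u using Suc by blast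
    have sqs: "integrable (TR t) (\<lambda>s. (u \<bullet> (snd s - a))\<^sup>2)" for u a using Suc by blast
    have mean: "has_bochner_integral (TR t) (\<lambda>s. u \<bullet> (fst s - wq)) (u \<bullet> mean_err t)" for u using Suc by blast
    have meas: "(\<lambda>s::(real^'n) \<times> (real^'n). u \<bullet> (fst s - wq)) \<in> borel_measurable borel"
      "(\<lambda>s::(real^'n) \<times> (real^'n). u \<bullet> (snd s - a)) \<in> borel_measurable borel"
      "(\<lambda>s::(real^'n) \<times> (real^'n). (u \<bullet> (fst s - wq))\<^sup>2) \<in> borel_measurable borel"
      "(\<lambda>s::(real^'n) \<times> (real^'n). (u \<bullet> (snd s - a))\<^sup>2) \<in> borel_measurable borel" for u a
      by measurable
    have 1: "integrable (TR (Suc t)) (\<lambda>s. (u \<bullet> (fst s - wq))\<^sup>2)" for u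
      unfolding TR_Suc
      by (rule integrable_bind_kernel(1)[OF TR_pm kernel_traj_kernel meas(3) _ traj_kernel_err_square step_bound_integrable[OF sq]]) simp
    have 2: "integrable (TR (Suc t)) (\<lambda>s. (u \<bullet> (snd s - a))\<^sup>2)" for u a
    proof -
      have "integrable (TR t) (\<lambda>s. (u \<bullet> (snd s - (a - wq)) + u \<bullet> (fst s - wq))\<^sup>2)"
        by (rule integrable_square_add[OF TR_meas[OF meas(2)] TR_meas[OF meas(1)] sqs sq])
      moreover have "u \<bullet> (snd s - (a - wq)) + u \<bullet> (fst s - wq) = u \<bullet> (snd s + fst s - a)" for s :: "(real^'n) \<times> (real^'n)"
        by (simp add: inner_add_right inner_diff_right)
      ultimately have i: "integrable (TR t) (\<lambda>s. (u \<bullet> (snd s + fst s - a))\<^sup>2)" by simp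
      show ?thesis unfolding TR_Suc
        by (rule integrable_bind_kernel(1)[OF TR_pm kernel_traj_kernel meas(4) _ integrable.intros[OF traj_kernel_sum_square] _ i])
           (use traj_kernel_sum_square[of _ u a] in \<open>auto simp: has_bochner_integral_iff\<close>)
    qed
    have 3: "has_bochner_integral (TR (Suc t)) (\<lambda>s. u \<bullet> (fst s - wq)) (u \<bullet> mean_err (Suc t))" for u
    proof -
      have i: "integrable (TR (Suc t)) (\<lambda>s. u \<bullet> (fst s - wq))"
        by (rule integrable_of_square[OF TR_pm TR_meas[OF meas(1)] 1])
      have "has_bochner_integral (TR (Suc t)) (\<lambda>s. u \<bullet> (fst s - wq))
         (\<integral>s. u \<bullet> (fst s - wq) - \<gamma> * (u \<bullet> (K *v (fst s - wq))) \<partial>TR t)"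
        unfolding TR_Suc
        by (rule has_bochner_integral_bind_kernel(1)[OF TR_pm kernel_traj_kernel meas(1) i[unfolded TR_Suc] traj_kernel_err_mean])
      moreover have "has_bochner_integral (TR t) (\<lambda>s. u \<bullet> (fst s - wq) - \<gamma> * (u \<bullet> (K *v (fst s - wq))))
          (u \<bullet> mean_err t - \<gamma> * (u \<bullet> (K *v mean_err t)))"
        unfolding K_inner_swap[of u]
        by (intro has_bochner_integral_diff has_bochner_integral_mult_right mean)
      ultimately show ?thesis by (simp add: has_bochner_integral_iff inner_diff_right)
    qed
    from 1 2 3 show ?case by blast
  qed
  then show "integrable (TR t) (\<lambda>s. (u \<bullet> (fst s - wq))\<^sup>2)"
    and "integrable (TR t) (\<lambda>s. (u \<bullet> (snd s - a))\<^sup>2)"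
    and "has_bochner_integral (TR t) (\<lambda>s. u \<bullet> (fst s - wq)) (u \<bullet> mean_err t)" by blast+
qed

section \<open>Error moments in the eigenbasis\<close>

lemma err_meas:
  "(\<lambda>s::(real^'n) \<times> (real^'n). u \<bullet> (fst s - wq)) \<in> borel_measurable borel"
  "(\<lambda>s::(real^'n) \<times> (real^'n). u \<bullet> (snd s - a)) \<in> borel_measurable borel"
  by measurable

text \<open>Along eigenvector i, \<open>A\<close> is the second moment of the current error,
  \<open>S\<close> that of the accumulated error, and \<open>C\<close> their correlation. At time t
  the accumulator holds w_0 up to w_(t-1), that is t iterates, hence the centre t wq.\<close>

definition A :: "nat \<Rightarrow> nat \<Rightarrow> real" where
  "A t i = (\<integral>s. (v i \<bullet> (fst s - wq))\<^sup>2 \<partial>TR t)"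
definition C :: "nat \<Rightarrow> nat \<Rightarrow> real" where
  "C t i = (\<integral>s. (v i \<bullet> (snd s - real t *\<^sub>R wq)) * (v i \<bullet> (fst s - wq)) \<partial>TR t)"
definition S :: "nat \<Rightarrow> nat \<Rightarrow> real" where
  "S t i = (\<integral>s. (v i \<bullet> (snd s - real t *\<^sub>R wq))\<^sup>2 \<partial>TR t)"

lemma hA: "has_bochner_integral (TR t) (\<lambda>s. (v i \<bullet> (fst s - wq))\<^sup>2) (A t i)"
  using TR_integrable(1) by (simp add: has_bochner_integral_iff A_def)

lemma hC: "has_bochner_integral (TR t) (\<lambda>s. (v i \<bullet> (snd s - real t *\<^sub>R wq)) * (v i \<bullet> (fst s - wq))) (C t i)"
  using integrable_mult_of_squares[OF TR_meas[OF err_meas(2)] TR_meas[OF err_meas(1)] TR_integrable(2,1)]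
  by (simp add: has_bochner_integral_iff C_def)

lemma hS: "has_bochner_integral (TR t) (\<lambda>s. (v i \<bullet> (snd s - real t *\<^sub>R wq))\<^sup>2) (S t i)"
  using TR_integrable(2) by (simp add: has_bochner_integral_iff S_def)

lemma A_nonneg: "0 \<le> A t i"
  by (rule has_bochner_integral_nonneg[OF hA]) simp

lemma K_eigvec: "i \<in> {1..CARD('n)} \<Longrightarrow> v i \<bullet> (K *v d) = l i * (v i \<bullet> d)"
  by (simp add: K_inner_swap l_eig(3))

lemma K_eigval: "i \<in> {1..CARD('n)} \<Longrightarrow> v i \<bullet> (K *v v i) = l i"
  by (simp add: K_eigvec l_eig(1))

lemma mean_err_eig: "i \<in> {1..CARD('n)} \<Longrightarrow> v i \<bullet> mean_err (Suc t) = (1 - \<gamma> * l i) * (v i \<bullet> mean_err t)"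
  by (simp add: inner_diff_right K_eigvec algebra_simps)

text \<open>The factor is 1 - 2 \<gamma> l_i and not a full square: the \<gamma>^2 term of the
  square belongs to the gradient second moment, which the \<alpha> summand already bounds.\<close>

lemma A_Suc:
  assumes i: "i \<in> {1..CARD('n)}"
  shows "A (Suc t) i \<le> (1 - 2 * \<gamma> * l i) * A t i
    + \<gamma>\<^sup>2 * (\<alpha> * ((\<Sum>j=1..CARD('n). l j * A t j) + \<epsilon>p * trace K) * l i - 2 / real B * (cross_vec (v i) \<bullet> mean_err t) + \<kappa> (v i))"
proof -
  have meas: "(\<lambda>s::(real^'n) \<times> (real^'n). (v i \<bullet> (fst s - wq))\<^sup>2) \<in> borel_measurable borel" by measurable
  have "has_bochner_integral (TR t) (\<lambda>s. (1 - 2 * \<gamma> * l i) * (v i \<bullet> (fst s - wq))\<^sup>2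
     + \<gamma>\<^sup>2 * (\<alpha> * ((\<Sum>j=1..CARD('n). l j * (v j \<bullet> (fst s - wq))\<^sup>2) + \<epsilon>p * trace K) * l i - 2 / real B * (cross_vec (v i) \<bullet> (fst s - wq)) + \<kappa> (v i)))
     ((1 - 2 * \<gamma> * l i) * A t i
    + \<gamma>\<^sup>2 * (\<alpha> * ((\<Sum>j=1..CARD('n). l j * A t j) + \<epsilon>p * trace K) * l i - 2 / real B * (cross_vec (v i) \<bullet> mean_err t) + \<kappa> (v i)))"
    by (intro has_bochner_integral_add has_bochner_integral_diff has_bochner_integral_mult_right
        has_bochner_integral_mult_left has_bochner_integral_sum has_bochner_integral_const_prob TR_pm hA TR_integrable(3))
  moreover have "(1 - 2 * \<gamma> * l i) * (v i \<bullet> d)\<^sup>2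
     + \<gamma>\<^sup>2 * (\<alpha> * ((\<Sum>j=1..CARD('n). l j * (v j \<bullet> d)\<^sup>2) + \<epsilon>p * trace K) * l i - 2 / real B * (cross_vec (v i) \<bullet> d) + \<kappa> (v i))
     = step_bound (v i) d" for d
    unfolding step_bound_def K_eigval[OF i] K_eigvec[OF i] l_eig(2)[of d d]
    by (simp add: l_eig(1)[OF i i] power2_eq_square algebra_simps)
  ultimately have hb: "has_bochner_integral (TR t) (\<lambda>s. step_bound (v i) (fst s - wq)) ((1 - 2 * \<gamma> * l i) * A t i
    + \<gamma>\<^sup>2 * (\<alpha> * ((\<Sum>j=1..CARD('n). l j * A t j) + \<epsilon>p * trace K) * l i - 2 / real B * (cross_vec (v i) \<bullet> mean_err t) + \<kappa> (v i)))"
    by (simp only:)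
  have "A (Suc t) i \<le> (\<integral>s. step_bound (v i) (fst s - wq) \<partial>TR t)"
    unfolding A_def TR_Suc
    by (rule integrable_bind_kernel(2)[OF TR_pm kernel_traj_kernel meas _ traj_kernel_err_square integrable.intros[OF hb]]) simp
  with hb show ?thesis by (simp add: has_bochner_integral_iff)
qed

text \<open>Adding the squared mean makes the recursion for the error second moments close up, since the
  cross term is bounded by the energy of the mean; it doubles the initial value only.\<close>
definition U :: "nat \<Rightarrow> nat \<Rightarrow> real" where "U t i = A t i + (v i \<bullet> mean_err t)\<^sup>2"
definition eff_noise :: real where "eff_noise = (\<epsilon>o + \<epsilon>a) / real B + \<alpha> * \<epsilon>p * trace K + \<sigma>2 / real B"

lemma \<epsilon>p_nonneg: "0 \<le> \<epsilon>p" by (rule vq_eps_nonneg[OF Qp])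

lemma l_pos: "i \<in> {1..CARD('n)} \<Longrightarrow> 0 < l i"
  using K_pos[of "v i"] l_eig(1)[of i i] by (cases "v i = 0") (auto simp: K_eigval)

text \<open>Otherwise the upper bound on the step size would be at most 0, also in the degenerate
  case 1 / 0 = 0, against \<gamma> > 0.\<close>

lemma alpha_trace_pos: "0 < \<alpha> * trace K"
  using \<gamma>_pos \<gamma>_small by (smt (verit) divide_nonneg_nonpos)

text \<open>\<open>\<kappa>\<close> occurs twice, once as gradient noise and once through
  \<open>cross_le\<close>, hence 2 \<open>eff_noise\<close>. The energy of the mean that
  \<open>cross_le\<close> contributes completes the sum over \<open>A\<close> to the sum over
  \<open>U\<close>.\<close>

lemma U_Suc:
  assumes i: "i \<in> {1..CARD('n)}"
  shows "U (Suc t) i \<le> (1 - \<gamma> * l i)\<^sup>2 * U t i + \<gamma>\<^sup>2 * l i * (\<alpha> * (\<Sum>j=1..CARD('n). l j * U t j) + 2 * eff_noise)"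
proof -
  let ?m = "mean_err t"
  have KM: "?m \<bullet> (K *v ?m) = (\<Sum>j=1..CARD('n). l j * (v j \<bullet> ?m)\<^sup>2)"
    unfolding l_eig(2) by (simp add: power2_eq_square)
  have c: "- 2 / real B * (cross_vec (v i) \<bullet> ?m) \<le> \<alpha> * (\<Sum>j=1..CARD('n). l j * (v j \<bullet> ?m)\<^sup>2) * l i + \<kappa> (v i)"
    using cross_le[of "v i" ?m] unfolding KM K_eigval[OF i] .
  have k: "\<kappa> (v i) \<le> ((\<epsilon>o + \<epsilon>a) / real B + \<sigma>2 / real B) * l i"
    using kappa_le[of "v i"] unfolding K_eigval[OF i] .
  \<comment> \<open>Parameter quantization enters only once; nonnegativity allows doubling it
    together with the other noise.\<close>
  have e: "0 \<le> \<alpha> * \<epsilon>p * trace K * l i"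
    using alpha_trace_pos \<epsilon>p_nonneg l_pos[OF i]
    by (metis less_imp_le mult.assoc mult.left_commute mult_nonneg_nonneg)
  have s: "eff_noise * l i = ((\<epsilon>o + \<epsilon>a) / real B + \<sigma>2 / real B) * l i + \<alpha> * \<epsilon>p * trace K * l i"
    by (simp add: eff_noise_def algebra_simps)
  have sumU: "(\<Sum>j=1..CARD('n). l j * U t j) = (\<Sum>j=1..CARD('n). l j * A t j) + (\<Sum>j=1..CARD('n). l j * (v j \<bullet> ?m)\<^sup>2)"
    by (simp add: U_def distrib_left sum.distrib)
  have "\<alpha> * ((\<Sum>j=1..CARD('n). l j * A t j) + \<epsilon>p * trace K) * l i - 2 / real B * (cross_vec (v i) \<bullet> ?m) + \<kappa> (v i)
     \<le> l i * (\<alpha> * (\<Sum>j=1..CARD('n). l j * U t j) + 2 * eff_noise)"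
    using c k e s unfolding sumU by (simp add: algebra_simps)
  then have le: "\<gamma>\<^sup>2 * (\<alpha> * ((\<Sum>j=1..CARD('n). l j * A t j) + \<epsilon>p * trace K) * l i - 2 / real B * (cross_vec (v i) \<bullet> ?m) + \<kappa> (v i))
     \<le> \<gamma>\<^sup>2 * (l i * (\<alpha> * (\<Sum>j=1..CARD('n). l j * U t j) + 2 * eff_noise))"
    by (rule mult_left_mono) simp
  \<comment> \<open>Enlarged to the exact factor of the squared mean, so that both parts of
    \<open>U\<close> share one coefficient.\<close>
  have "(1 - 2 * \<gamma> * l i) * A t i \<le> (1 - \<gamma> * l i)\<^sup>2 * A t i"
    using zero_le_power2[of "\<gamma> * l i"]
    by (intro mult_right_mono[OF _ A_nonneg]) (simp add: power2_diff)
  with A_Suc[OF i, of t] le show ?thesis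
    unfolding U_def[of "Suc t"] mean_err_eig[OF i] power_mult_distrib U_def[of t i]
    by (simp add: distrib_left mult.assoc)
qed

lemma U_0: "U 0 i = 2 * (v i \<bullet> wq)\<^sup>2"
proof -
  have m: "(\<lambda>s::(real^'n) \<times> (real^'n). (v i \<bullet> (fst s - wq))\<^sup>2) \<in> borel_measurable borel" by measurable
  show ?thesis
    using has_bochner_integral_return[OF m, of "(0, 0)"] by (simp add: U_def A_def has_bochner_integral_iff)
qed

lemma C_S_0: "C 0 i = 0" "S 0 i = 0"
proof -
  have m: "(\<lambda>s::(real^'n) \<times> (real^'n). (v i \<bullet> snd s)\<^sup>2) \<in> borel_measurable borel"
    "(\<lambda>s::(real^'n) \<times> (real^'n). (v i \<bullet> snd s) * (v i \<bullet> (fst s - wq))) \<in> borel_measurable borel" by measurable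
  show "C 0 i = 0" "S 0 i = 0"
    using has_bochner_integral_return[OF m(1), of "(0, 0)"] has_bochner_integral_return[OF m(2), of "(0, 0)"]
    by (simp_all add: C_def S_def has_bochner_integral_iff)
qed

lemma sum_shift: "v i \<bullet> (snd s + fst s - real (Suc t) *\<^sub>R wq) = v i \<bullet> (snd s - real t *\<^sub>R wq) + v i \<bullet> (fst s - wq)"
  by (simp add: inner_add_right inner_diff_right algebra_simps)

lemma S_Suc: "S (Suc t) i = S t i + 2 * C t i + A t i"
proof -
  have meas: "(\<lambda>s::(real^'n) \<times> (real^'n). (v i \<bullet> (snd s - real (Suc t) *\<^sub>R wq))\<^sup>2) \<in> borel_measurable borel" by measurable
  have "has_bochner_integral (TR (Suc t)) (\<lambda>s. (v i \<bullet> (snd s - real (Suc t) *\<^sub>R wq))\<^sup>2)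
     (\<integral>s. (v i \<bullet> (snd s + fst s - real (Suc t) *\<^sub>R wq))\<^sup>2 \<partial>TR t)"
    unfolding TR_Suc
    by (rule has_bochner_integral_bind_kernel(1)[OF TR_pm kernel_traj_kernel meas integrable.intros[OF hS[of "Suc t" i, unfolded TR_Suc]] traj_kernel_sum_square])
  moreover have "has_bochner_integral (TR t) (\<lambda>s. (v i \<bullet> (snd s - real t *\<^sub>R wq))\<^sup>2
      + 2 * ((v i \<bullet> (snd s - real t *\<^sub>R wq)) * (v i \<bullet> (fst s - wq))) + (v i \<bullet> (fst s - wq))\<^sup>2) (S t i + 2 * C t i + A t i)"
    by (intro has_bochner_integral_add has_bochner_integral_mult_right hS hC hA)
  ultimately show ?thesis
    unfolding sum_shift power2_sum S_def[of "Suc t"]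
    by (simp add: has_bochner_integral_iff mult.assoc algebra_simps)
qed

text \<open>An equality, because the new iterate enters linearly: given the past only its
  conditional mean matters, and along an eigenvector this is a scalar multiple of the old
  error.\<close>

lemma C_Suc:
  assumes i: "i \<in> {1..CARD('n)}"
  shows "C (Suc t) i = (1 - \<gamma> * l i) * (C t i + A t i)"
proof -
  define f where "f s = (v i \<bullet> (snd s - real (Suc t) *\<^sub>R wq)) * (v i \<bullet> (fst s - wq))" for s :: "(real^'n) \<times> (real^'n)"
  have meas: "f \<in> borel_measurable borel" unfolding f_def by measurable
  have "has_bochner_integral (traj_kernel s) f
      ((v i \<bullet> (snd s + fst s - real (Suc t) *\<^sub>R wq)) * ((1 - \<gamma> * l i) * (v i \<bullet> (fst s - wq))))" for s
  proof -
    have "has_bochner_integral (STEP (fst s)) (\<lambda>w'. (v i \<bullet> (snd s + fst s - real (Suc t) *\<^sub>R wq)) * (v i \<bullet> (w' - wq)))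
       ((v i \<bullet> (snd s + fst s - real (Suc t) *\<^sub>R wq)) * (v i \<bullet> (fst s - wq) - \<gamma> * (v i \<bullet> (K *v (fst s - wq)))))"
      by (intro has_bochner_integral_mult_right STEP_mean)
    then show ?thesis unfolding has_bochner_integral_traj_kernel[OF meas]
      by (simp add: f_def K_eigvec[OF i] algebra_simps)
  qed
  note tr = this
  have hf: "integrable (TR (Suc t)) f"
    unfolding f_def by (rule integrable.intros[OF hC])
  have hf2: "has_bochner_integral (TR (Suc t)) f
     (\<integral>s. (v i \<bullet> (snd s + fst s - real (Suc t) *\<^sub>R wq)) * ((1 - \<gamma> * l i) * (v i \<bullet> (fst s - wq))) \<partial>TR t)"
    unfolding TR_Suc
    by (rule has_bochner_integral_bind_kernel(1)[OF TR_pm kernel_traj_kernel meas hf[unfolded TR_Suc] tr])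
  have eq: "(v i \<bullet> (snd s + fst s - real (Suc t) *\<^sub>R wq)) * ((1 - \<gamma> * l i) * (v i \<bullet> (fst s - wq)))
     = (1 - \<gamma> * l i) * ((v i \<bullet> (snd s - real t *\<^sub>R wq)) * (v i \<bullet> (fst s - wq)) + (v i \<bullet> (fst s - wq))\<^sup>2)" for s :: "(real^'n) \<times> (real^'n)"
    unfolding sum_shift by (simp only: power2_eq_square ring_distribs mult_ac)
  have hb: "has_bochner_integral (TR t) (\<lambda>s. (1 - \<gamma> * l i) * ((v i \<bullet> (snd s - real t *\<^sub>R wq)) * (v i \<bullet> (fst s - wq)) + (v i \<bullet> (fst s - wq))\<^sup>2))
      ((1 - \<gamma> * l i) * (C t i + A t i))"
    by (intro has_bochner_integral_add has_bochner_integral_mult_right hC hA)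
  show ?thesis
    using has_bochner_integral_integral_eq[OF hf2[unfolded eq]] has_bochner_integral_integral_eq[OF hb]
    unfolding C_def[of "Suc t"] f_def[symmetric] by (simp only:)
qed

end

section \<open>The scalar recursion\<close>

text \<open>The initial value and every later impulse \<open>c t\<close> decay geometrically, so
  each contributes at most one full geometric sum of length N.\<close>

lemma sum_linear_recursion_le:
  fixes u c :: "nat \<Rightarrow> real"
  assumes "0 \<le> r" "\<And>t. u (Suc t) \<le> r * u t + c t" "\<And>t. 0 \<le> c t"
  shows "(\<Sum>t<N. u t) \<le> (\<Sum>k<N. r ^ k) * (u 0 + (\<Sum>t<N. c t))"
  using assms(2,3)
proof (induction N arbitrary: u c)
  case 0
  then show ?case by simp
next
  case (Suc N)
  define G where "G = (\<Sum>k<N. r ^ k)"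
  have G0: "0 \<le> G" unfolding G_def using assms(1) by (simp add: sum_nonneg)
  have GS: "(\<Sum>k<Suc N. r ^ k) = 1 + r * G"
    unfolding G_def sum.lessThan_Suc_shift by (simp add: sum_distrib_left)
  have "G \<le> (\<Sum>k<Suc N. r ^ k)" unfolding G_def using assms(1) by simp
  then have mono: "G \<le> 1 + r * G" unfolding GS .
  have c': "0 \<le> (\<Sum>t<Suc N. c t)" using Suc.prems(2) by (intro sum_nonneg) auto
  have "(\<Sum>t<Suc N. u t) = u 0 + (\<Sum>t<N. u (Suc t))" by (rule sum.lessThan_Suc_shift)
  also have "\<dots> \<le> u 0 + G * (u (Suc 0) + (\<Sum>t<N. c (Suc t)))"
    unfolding G_def by (intro add_left_mono Suc.IH) (rule Suc.prems)+
  also have "\<dots> \<le> u 0 + G * (r * u 0 + c 0 + (\<Sum>t<N. c (Suc t)))"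
    using G0 Suc.prems(1)[of 0] by (intro add_left_mono mult_left_mono) auto
  also have "\<dots> = (1 + r * G) * u 0 + G * (\<Sum>t<Suc N. c t)"
    unfolding sum.lessThan_Suc_shift[of c] by (simp add: algebra_simps)
  also have "\<dots> \<le> (1 + r * G) * u 0 + (1 + r * G) * (\<Sum>t<Suc N. c t)"
    by (intro add_left_mono mult_right_mono mono c')
  finally show ?case unfolding GS by (simp add: distrib_left)
qed

text \<open>Unrolled, \<open>s N\<close> is the sum of all \<open>a t\<close> plus twice the sum of
  q^(j-t) a_t over t < j < N. Thus a_t has weight at most twice a geometric sum minus 1; the factor
  2 covers both orders of a pair.\<close>

lemma sum_of_correlated_le:
  fixes a c s :: "nat \<Rightarrow> real"
  assumes q: "0 \<le> q" and a0: "\<And>t. 0 \<le> a t"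
    and init: "c 0 = 0" "s 0 = 0"
    and cS: "\<And>t. c (Suc t) = q * (c t + a t)" and sS: "\<And>t. s (Suc t) = s t + 2 * c t + a t"
  shows "s N \<le> 2 * (\<Sum>k<N. q ^ k) * (\<Sum>t<N. a t)"
proof -
  define G where "G K = (\<Sum>k<K. q ^ k)" for K
  have GS: "G (Suc K) = 1 + q * G K" for K
    unfolding G_def sum.lessThan_Suc_shift by (simp add: sum_distrib_left)
  have Gmono: "G K \<le> G (K + n)" for K n
    unfolding G_def using q by (intro sum_mono2) auto
  \<comment> \<open>The left side is what \<open>s\<close> would be after K further steps if all
    later \<open>a\<close> were 0: a correlation c decaying at rate q feeds 2 G(K) c into the
    sum.\<close>
  have "s N + 2 * G K * c N \<le> 2 * G (N + K) * (\<Sum>t<N. a t)" for K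
  proof (induction N arbitrary: K)
    case 0
    then show ?case by (simp add: init)
  next
    case (Suc N)
    have "s (Suc N) + 2 * G K * c (Suc N) = s N + 2 * G (Suc K) * c N + (2 * G (Suc K) - 1) * a N"
      unfolding cS sS GS by (simp add: algebra_simps)
    also have "\<dots> \<le> 2 * G (N + Suc K) * (\<Sum>t<N. a t) + 2 * G (N + Suc K) * a N"
      using Suc.IH[of "Suc K"] Gmono[of "Suc K" N] a0[of N]
      by (intro add_mono mult_right_mono) (auto simp: add.commute)
    finally show ?case by (simp add: distrib_left)
  qed
  from this[of 0] show ?thesis by (simp add: G_def)
qed

lemma geometric_sum_eq:
  fixes x :: real
  assumes "x \<noteq> 0"
  shows "(\<Sum>k<N. (1 - x) ^ k) = (1 - (1 - x) ^ N) / x"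
  using assms by (simp add: sum_gp_strict)

lemma head_tail_sum:
  fixes f :: "nat \<Rightarrow> real"
  assumes "k \<le> n"
  shows "(\<Sum>i=1..n. f i) = (\<Sum>i=1..k. f i) + (\<Sum>i\<in>{k<..n}. f i)"
proof -
  have "{1..n} = {1..k} \<union> {k<..n}" using assms by auto
  then show ?thesis by (simp add: sum.union_disjoint[symmetric] disjoint_iff)
qed

text \<open>Here \<beta> are the coordinates of the minimizer and \<tau> is the effective noise. The
  cut k is arbitrary: the head uses p \<le> 1 and the tail p \<le> N \<gamma> l, two estimates that
  cross at l = 1/(N \<gamma>), the threshold of \<open>kstar\<close>.\<close>

lemma spectral_recursion_bound:
  fixes l \<beta> S :: "nat \<Rightarrow> real" and U A :: "nat \<Rightarrow> nat \<Rightarrow> real" and \<gamma> \<alpha> \<tau> :: real and n k N :: nat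
  defines "tr \<equiv> (\<Sum>i=1..n. l i)"
  assumes l: "\<And>i. i \<in> {1..n} \<Longrightarrow> 0 < l i" "\<And>i. i \<in> {1..n} \<Longrightarrow> \<gamma> * l i \<le> 1"
    and \<gamma>: "0 < \<gamma>" and \<alpha>: "0 \<le> \<alpha>" and small: "\<gamma> * \<alpha> * tr < 1" and \<tau>: "0 \<le> \<tau>" and N: "1 \<le> N" and k: "k \<le> n"
    and U0: "\<And>i. i \<in> {1..n} \<Longrightarrow> U 0 i = 2 * (\<beta> i)\<^sup>2"
    and US: "\<And>t i. i \<in> {1..n} \<Longrightarrow>
      U (Suc t) i \<le> (1 - \<gamma> * l i)\<^sup>2 * U t i + \<gamma>\<^sup>2 * l i * (\<alpha> * (\<Sum>j=1..n. l j * U t j) + 2 * \<tau>)"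
    and A0: "\<And>t i. 0 \<le> A t i" and AU: "\<And>t i. A t i \<le> U t i"
    and S: "\<And>i. i \<in> {1..n} \<Longrightarrow> S i \<le> 2 * (\<Sum>j<N. (1 - \<gamma> * l i) ^ j) * (\<Sum>t<N. A t i)"
  shows "1 / (2 * (real N)\<^sup>2) * (\<Sum>i=1..n. l i * S i) \<le>
    2 * ((\<tau> + (2 * \<alpha> / (real N * \<gamma>)) * ((\<Sum>i=1..k. (\<beta> i)\<^sup>2) + real N * \<gamma> * (\<Sum>i\<in>{k<..n}. l i * (\<beta> i)\<^sup>2)))
        / (1 - \<gamma> * \<alpha> * tr) * (real k / real N + real N * \<gamma>\<^sup>2 * (\<Sum>i\<in>{k<..n}. (l i)\<^sup>2)))
    + 2 * (1 / (\<gamma>\<^sup>2 * (real N)\<^sup>2) * (\<Sum>i=1..k. inverse (l i) * (\<beta> i)\<^sup>2) + (\<Sum>i\<in>{k<..n}. l i * (\<beta> i)\<^sup>2))"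
proof -
  \<comment> \<open>\<open>p i\<close> is \<gamma> l_i times the geometric sum of length N; it
    measures how far coordinate i has converged.\<close>
  define p where "p i = 1 - (1 - \<gamma> * l i) ^ N" for i
  define V where "V i = (\<Sum>t<N. U t i)" for i
  define T where "T t = (\<Sum>j=1..n. l j * U t j)" for t
  \<comment> \<open>Up to the factor \<gamma>^2 l_i the forcing summed over time is the same for all
    coordinates, so one bound on \<Phi> decouples them.\<close>
  define \<Phi> where "\<Phi> = (\<Sum>t<N. \<alpha> * T t + 2 * \<tau>)"
  define P where "P = (\<Sum>i=1..n. (\<beta> i)\<^sup>2 * p i)"
  have p01: "0 \<le> p i" "p i \<le> 1" if "i \<in> {1..n}" for i
    using l(1)[OF that] l(2)[OF that] \<gamma> by (auto simp: p_def power_le_one)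
  have pN: "p i \<le> real N * (\<gamma> * l i)" if "i \<in> {1..n}" for i
    using Bernoulli_inequality[of "- (\<gamma> * l i)" N] l(2)[OF that] by (simp add: p_def)
  have G: "(\<Sum>j<N. (1 - \<gamma> * l i) ^ j) = p i / (\<gamma> * l i)" if "i \<in> {1..n}" for i
    using l(1)[OF that] \<gamma> by (simp add: p_def geometric_sum_eq)
  have Unn: "0 \<le> U t i" for t i using A0[of t i] AU[of t i] by simp
  have Tnn: "0 \<le> T t" for t
    unfolding T_def using l(1) Unn by (intro sum_nonneg mult_nonneg_nonneg) (auto intro: less_imp_le)
  have \<Phi>nn: "0 \<le> \<Phi>" unfolding \<Phi>_def using \<alpha> \<tau> Tnn by (intro sum_nonneg) simp
  have V: "V i \<le> p i / (\<gamma> * l i) * (2 * (\<beta> i)\<^sup>2) + \<gamma> * p i * \<Phi>" if i: "i \<in> {1..n}" for i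
  proof -
    have li: "0 < l i" "\<gamma> * l i \<le> 1" using l i by auto
    have cnn: "0 \<le> \<gamma>\<^sup>2 * l i * (\<alpha> * T t + 2 * \<tau>)" for t using li \<alpha> \<tau> Tnn by simp
    have "V i \<le> (\<Sum>k<N. ((1 - \<gamma> * l i)\<^sup>2) ^ k) * (U 0 i + (\<Sum>t<N. \<gamma>\<^sup>2 * l i * (\<alpha> * T t + 2 * \<tau>)))"
      unfolding V_def by (rule sum_linear_recursion_le) (use US[OF i] cnn in \<open>auto simp: T_def\<close>)
    \<comment> \<open>The squared rate is relaxed to the rate itself, so that the time sum and the
      averaging are governed by the same \<open>p i\<close>.\<close>
    also have "\<dots> \<le> (\<Sum>k<N. (1 - \<gamma> * l i) ^ k) * (U 0 i + (\<Sum>t<N. \<gamma>\<^sup>2 * l i * (\<alpha> * T t + 2 * \<tau>)))"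
    proof (intro mult_right_mono sum_mono)
      have "0 \<le> 1 - \<gamma> * l i" "1 - \<gamma> * l i \<le> 1" using li \<gamma> by auto
      then have "(1 - \<gamma> * l i)\<^sup>2 \<le> 1 - \<gamma> * l i" by (simp add: power2_eq_square mult_left_le_one_le)
      then show "((1 - \<gamma> * l i)\<^sup>2) ^ j \<le> (1 - \<gamma> * l i) ^ j" for j by (intro power_mono) auto
      show "0 \<le> U 0 i + (\<Sum>t<N. \<gamma>\<^sup>2 * l i * (\<alpha> * T t + 2 * \<tau>))"
        by (intro add_nonneg_nonneg Unn sum_nonneg cnn)
    qed
    also have "\<dots> = p i / (\<gamma> * l i) * (2 * (\<beta> i)\<^sup>2 + \<gamma>\<^sup>2 * l i * \<Phi>)"
      unfolding G[OF i] U0[OF i] \<Phi>_def by (simp add: sum_distrib_left)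
    also have "\<dots> = p i / (\<gamma> * l i) * (2 * (\<beta> i)\<^sup>2) + \<gamma> * p i * \<Phi>"
      using li \<gamma> by (simp add: field_simps power2_eq_square)
    finally show ?thesis .
  qed
  have sumT: "(\<Sum>t<N. T t) = (\<Sum>i=1..n. l i * V i)"
    unfolding T_def V_def sum_distrib_left by (rule sum.swap)
  also have "\<dots> \<le> (\<Sum>i=1..n. 2 / \<gamma> * ((\<beta> i)\<^sup>2 * p i) + \<gamma> * \<Phi> * l i)"
  proof (rule sum_mono)
    fix i assume i: "i \<in> {1..n}"
    have li: "0 < l i" using l i by auto
    have "l i * V i \<le> l i * (p i / (\<gamma> * l i) * (2 * (\<beta> i)\<^sup>2) + \<gamma> * p i * \<Phi>)"
      using V[OF i] li by (intro mult_left_mono) auto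
    also have "\<dots> = 2 / \<gamma> * ((\<beta> i)\<^sup>2 * p i) + \<gamma> * \<Phi> * l i * p i"
      using li \<gamma> by (simp add: field_simps)
    \<comment> \<open>In the feedback term \<open>p i\<close> is replaced by 1, so that the
      eigenvalues add up to the trace.\<close>
    also have "\<dots> \<le> 2 / \<gamma> * ((\<beta> i)\<^sup>2 * p i) + \<gamma> * \<Phi> * l i"
      using p01[OF i] li \<gamma> \<Phi>nn by (intro add_left_mono mult_right_le_one_le) auto
    finally show "l i * V i \<le> 2 / \<gamma> * ((\<beta> i)\<^sup>2 * p i) + \<gamma> * \<Phi> * l i" .
  qed
  also have "\<dots> = 2 / \<gamma> * P + \<gamma> * \<Phi> * tr"
    unfolding P_def tr_def by (simp add: sum.distrib sum_distrib_left)
  finally have sT: "(\<Sum>t<N. T t) \<le> 2 / \<gamma> * P + \<gamma> * \<Phi> * tr" .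
  have "\<Phi> = \<alpha> * (\<Sum>t<N. T t) + 2 * \<tau> * real N"
    unfolding \<Phi>_def by (simp add: sum.distrib sum_distrib_left)
  also have "\<dots> \<le> \<alpha> * (2 / \<gamma> * P + \<gamma> * \<Phi> * tr) + 2 * \<tau> * real N"
    using sT \<alpha> by (intro add_right_mono mult_left_mono)
  finally have "\<Phi> * (1 - \<gamma> * \<alpha> * tr) \<le> 2 * \<alpha> / \<gamma> * P + 2 * \<tau> * real N"
    by (simp add: algebra_simps)
  then have \<Phi>: "\<Phi> \<le> (2 * \<alpha> / \<gamma> * P + 2 * \<tau> * real N) / (1 - \<gamma> * \<alpha> * tr)"
    using small by (simp add: pos_le_divide_eq)
  define bh where "bh = (\<Sum>i=1..k. (\<beta> i)\<^sup>2)"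
  define bt where "bt = (\<Sum>i\<in>{k<..n}. l i * (\<beta> i)\<^sup>2)"
  define hi where "hi = (\<Sum>i=1..k. inverse (l i) * (\<beta> i)\<^sup>2)"
  define l2 where "l2 = (\<Sum>i\<in>{k<..n}. (l i)\<^sup>2)"
  have inI: "i \<in> {1..n}" if "i \<in> {1..k} \<or> i \<in> {k<..n}" for i using that k by auto
  have Ple: "P \<le> bh + real N * \<gamma> * bt"
    unfolding P_def head_tail_sum[OF k] bh_def bt_def sum_distrib_left
  proof (intro add_mono sum_mono)
    show "(\<beta> i)\<^sup>2 * p i \<le> (\<beta> i)\<^sup>2" if "i \<in> {1..k}" for i
      using p01[of i] inI that by (intro mult_right_le_one_le) auto
    show "(\<beta> i)\<^sup>2 * p i \<le> real N * \<gamma> * (l i * (\<beta> i)\<^sup>2)" if "i \<in> {k<..n}" for i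
      using mult_left_mono[OF pN[of i], of "(\<beta> i)\<^sup>2"] inI that by (simp add: mult_ac)
  qed
  have btnn: "0 \<le> bt" "0 \<le> bh" "0 \<le> l2"
    unfolding bt_def bh_def l2_def using less_imp_le[OF l(1)] inI
    by (auto intro!: sum_nonneg mult_nonneg_nonneg)
  have p2: "(p i)\<^sup>2 \<le> 1" "(p i)\<^sup>2 \<le> (real N * (\<gamma> * l i))\<^sup>2" if "i \<in> {1..n}" for i
    using p01[OF that] pN[OF that] by (auto simp: power_le_one intro: power_mono)
  have p2sum: "(\<Sum>i=1..n. (p i)\<^sup>2) \<le> real k + (real N)\<^sup>2 * \<gamma>\<^sup>2 * l2"
  proof -
    have "(\<Sum>i=1..k. (p i)\<^sup>2) \<le> (\<Sum>i=1..k. 1)" using p2(1) inI by (intro sum_mono) auto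
    moreover have "(\<Sum>i\<in>{k<..n}. (p i)\<^sup>2) \<le> (real N)\<^sup>2 * \<gamma>\<^sup>2 * l2"
      unfolding l2_def sum_distrib_left using p2(2) inI by (intro sum_mono) (auto simp: power_mult_distrib mult.assoc)
    ultimately show ?thesis unfolding head_tail_sum[OF k] by simp
  qed
  have p2lsum: "(\<Sum>i=1..n. (\<beta> i)\<^sup>2 * (p i)\<^sup>2 / l i) \<le> hi + (real N)\<^sup>2 * \<gamma>\<^sup>2 * bt"
    unfolding head_tail_sum[OF k] hi_def bt_def sum_distrib_left
  proof (intro add_mono sum_mono)
    fix i assume i: "i \<in> {1..k}"
    then have "0 < l i" using l(1) inI by blast
    then show "(\<beta> i)\<^sup>2 * (p i)\<^sup>2 / l i \<le> inverse (l i) * (\<beta> i)\<^sup>2"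
      using mult_right_le_one_le[of "(\<beta> i)\<^sup>2" "(p i)\<^sup>2"] p2(1)[OF inI[OF disjI1[OF i]]]
      by (simp add: divide_inverse mult.commute)
  next
    fix i assume i: "i \<in> {k<..n}"
    then have li: "0 < l i" using l(1) inI by blast
    have "(\<beta> i)\<^sup>2 * (p i)\<^sup>2 / l i \<le> (\<beta> i)\<^sup>2 * (real N * (\<gamma> * l i))\<^sup>2 / l i"
      using p2(2)[of i] inI i li by (intro divide_right_mono mult_left_mono) auto
    also have "\<dots> = (real N)\<^sup>2 * \<gamma>\<^sup>2 * (l i * (\<beta> i)\<^sup>2)"
      using li by (simp add: power2_eq_square field_simps)
    finally show "(\<beta> i)\<^sup>2 * (p i)\<^sup>2 / l i \<le> (real N)\<^sup>2 * \<gamma>\<^sup>2 * (l i * (\<beta> i)\<^sup>2)" .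
  qed
  \<comment> \<open>Two factors \<open>p i\<close> meet, one from averaging correlated errors and
    one from the time sum of \<open>U\<close>. Their product is the source of the squared
    eigenvalues in the variance tail.\<close>
  have term_le: "l i * S i \<le> 2 * (2 / \<gamma>\<^sup>2 * ((\<beta> i)\<^sup>2 * (p i)\<^sup>2 / l i) + \<Phi> * (p i)\<^sup>2)" if i: "i \<in> {1..n}" for i
  proof -
    have li: "0 < l i" using l i by auto
    have AV: "(\<Sum>t<N. A t i) \<le> V i" unfolding V_def by (intro sum_mono AU)
    have "l i * S i \<le> l i * (2 * (p i / (\<gamma> * l i)) * (\<Sum>t<N. A t i))"
      using S[OF i] li unfolding G[OF i] by (intro mult_left_mono) auto
    also have "\<dots> = 2 * p i / \<gamma> * (\<Sum>t<N. A t i)" using li by simp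
    also have "\<dots> \<le> 2 * p i / \<gamma> * (p i / (\<gamma> * l i) * (2 * (\<beta> i)\<^sup>2) + \<gamma> * p i * \<Phi>)"
      using AV V[OF i] p01(1)[OF i] \<gamma> by (intro mult_left_mono) auto
    also have "\<dots> = 2 * (2 / \<gamma>\<^sup>2 * ((\<beta> i)\<^sup>2 * (p i)\<^sup>2 / l i) + \<Phi> * (p i)\<^sup>2)"
      using li \<gamma> by (simp add: field_simps power2_eq_square)
    finally show ?thesis .
  qed
  have "(\<Sum>i=1..n. l i * S i) \<le> (\<Sum>i=1..n. 2 * (2 / \<gamma>\<^sup>2 * ((\<beta> i)\<^sup>2 * (p i)\<^sup>2 / l i) + \<Phi> * (p i)\<^sup>2))"
    by (intro sum_mono term_le)
  also have "\<dots> = 2 * (2 / \<gamma>\<^sup>2 * (\<Sum>i=1..n. (\<beta> i)\<^sup>2 * (p i)\<^sup>2 / l i) + \<Phi> * (\<Sum>i=1..n. (p i)\<^sup>2))"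
    by (simp only: sum_distrib_left[symmetric] sum.distrib)
  also have "\<dots> \<le> 2 * (2 / \<gamma>\<^sup>2 * (hi + (real N)\<^sup>2 * \<gamma>\<^sup>2 * bt) + \<Phi> * (real k + (real N)\<^sup>2 * \<gamma>\<^sup>2 * l2))"
    using p2lsum p2sum \<Phi>nn \<gamma> by (intro mult_left_mono add_mono) auto
  \<comment> \<open>The recursion yields the \<alpha> term once and the noise twice; doubling the
    former gives the claim its common factor 2.\<close>
  also have "\<Phi> * (real k + (real N)\<^sup>2 * \<gamma>\<^sup>2 * l2)
      \<le> (2 * \<alpha> / \<gamma> * (bh + real N * \<gamma> * bt) * 2 + 2 * \<tau> * real N) / (1 - \<gamma> * \<alpha> * tr) * (real k + (real N)\<^sup>2 * \<gamma>\<^sup>2 * l2)"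
  proof (rule mult_right_mono)
    have b0: "0 \<le> bh + real N * \<gamma> * bt" using btnn \<gamma> by simp
    have "2 * \<alpha> / \<gamma> * P \<le> 2 * \<alpha> / \<gamma> * (bh + real N * \<gamma> * bt)"
      using Ple \<alpha> \<gamma> by (intro mult_left_mono) auto
    moreover have "0 \<le> 2 * \<alpha> / \<gamma> * (bh + real N * \<gamma> * bt)" using b0 \<alpha> \<gamma> by simp
    ultimately have "2 * \<alpha> / \<gamma> * P + 2 * \<tau> * real N \<le> 2 * \<alpha> / \<gamma> * (bh + real N * \<gamma> * bt) * 2 + 2 * \<tau> * real N"
      by argo
    then show "\<Phi> \<le> (2 * \<alpha> / \<gamma> * (bh + real N * \<gamma> * bt) * 2 + 2 * \<tau> * real N) / (1 - \<gamma> * \<alpha> * tr)"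
      using \<Phi> small by (meson divide_right_mono order_trans diff_ge_0_iff_ge less_imp_le)
    show "0 \<le> real k + (real N)\<^sup>2 * \<gamma>\<^sup>2 * l2" using btnn by simp
  qed
  finally have "1 / (2 * (real N)\<^sup>2) * (\<Sum>i=1..n. l i * S i)
     \<le> 1 / (2 * (real N)\<^sup>2) * (2 * (2 / \<gamma>\<^sup>2 * (hi + (real N)\<^sup>2 * \<gamma>\<^sup>2 * bt)
       + (2 * \<alpha> / \<gamma> * (bh + real N * \<gamma> * bt) * 2 + 2 * \<tau> * real N) / (1 - \<gamma> * \<alpha> * tr) * (real k + (real N)\<^sup>2 * \<gamma>\<^sup>2 * l2)))"
    by (intro mult_left_mono) auto
  also have "\<dots> = 2 * ((\<tau> + (2 * \<alpha> / (real N * \<gamma>)) * (bh + real N * \<gamma> * bt)) / (1 - \<gamma> * \<alpha> * tr)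
        * (real k / real N + real N * \<gamma>\<^sup>2 * l2)) + 2 * (1 / (\<gamma>\<^sup>2 * (real N)\<^sup>2) * hi + bt)"
  proof -
    define R where "R = 1 / (1 - \<gamma> * \<alpha> * tr)"
    have "x / (1 - \<gamma> * \<alpha> * tr) = x * R" for x by (simp add: R_def)
    then show ?thesis using N \<gamma> by (simp add: field_simps power2_eq_square)
  qed
  finally show ?thesis unfolding bh_def bt_def hi_def l2_def .
qed

section \<open>Spectra of symmetric matrices\<close>

text \<open>Parseval's identity. As many orthonormal vectors as the dimension span the space; the
  remainder y after projection is orthogonal to all of them, hence to itself.\<close>

lemma orthonormal_expansion:
  fixes v :: "nat \<Rightarrow> real^'n"
  assumes o: "\<And>i j. i \<in> {1..CARD('n)} \<Longrightarrow> j \<in> {1..CARD('n)} \<Longrightarrow> v i \<bullet> v j = (if i = j then 1 else 0)"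
  shows "x \<bullet> x = (\<Sum>i=1..CARD('n). (v i \<bullet> x)\<^sup>2)"
proof -
  let ?I = "{1..CARD('n)}"
  have inj: "inj_on v ?I"
    by (rule inj_onI) (metis o zero_neq_one)
  have ind: "independent (v ` ?I)"
  proof (rule pairwise_orthogonal_independent)
    show "pairwise orthogonal (v ` ?I)"
      unfolding pairwise_def orthogonal_def using o by fastforce
    show "0 \<notin> v ` ?I" using o by (metis imageE inner_zero_left zero_neq_one)
  qed
  have "UNIV \<subseteq> span (v ` ?I)"
    by (rule card_ge_dim_independent[OF _ ind]) (use card_image[OF inj] in simp_all)
  then have sp: "x \<in> span (v ` ?I)" for x by blast
  define y where "y = x - (\<Sum>i\<in>?I. (v i \<bullet> x) *\<^sub>R v i)"
  have vy: "v j \<bullet> y = 0" if j: "j \<in> ?I" for j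
  proof -
    have "v j \<bullet> (\<Sum>i\<in>?I. (v i \<bullet> x) *\<^sub>R v i) = (\<Sum>i\<in>?I. if i = j then v j \<bullet> x else 0)"
      unfolding inner_sum_right by (intro sum.cong refl) (use o j in auto)
    also have "\<dots> = v j \<bullet> x" using j by simp
    finally show ?thesis by (simp add: y_def inner_diff_right)
  qed
  have "orthogonal y y"
    by (rule orthogonal_to_span[OF sp]) (use vy in \<open>auto simp: orthogonal_def inner_commute\<close>)
  then have x: "x = (\<Sum>i\<in>?I. (v i \<bullet> x) *\<^sub>R v i)" by (simp add: y_def orthogonal_def)
  have "x \<bullet> x = x \<bullet> (\<Sum>i\<in>?I. (v i \<bullet> x) *\<^sub>R v i)" by (rule arg_cong[OF x])
  then show ?thesis by (simp add: inner_sum_right inner_commute power2_eq_square)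
qed

text \<open>The squared overlaps of two orthonormal eigenbases form a doubly stochastic matrix that
  only couples equal eigenvalues, so every eigenvalue count agrees.\<close>
lemma eigenvalue_count_eq:
  fixes K :: "real^'n^'n"
  defines "I \<equiv> {1..CARD('n)}"
  assumes v: "\<And>i j. i \<in> I \<Longrightarrow> j \<in> I \<Longrightarrow> v i \<bullet> v j = (if i = j then 1 else 0)"
    and w: "\<And>i j. i \<in> I \<Longrightarrow> j \<in> I \<Longrightarrow> w i \<bullet> w j = (if i = j then 1 else 0)"
    and ev: "\<And>i. i \<in> I \<Longrightarrow> K *v v i = a i *\<^sub>R v i" and ew: "\<And>i. i \<in> I \<Longrightarrow> K *v w i = b i *\<^sub>R w i"
    and sym: "\<And>x y. x \<bullet> (K *v y) = y \<bullet> (K *v x)"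
  shows "card {i\<in>I. c \<le> a i} = card {i\<in>I. c \<le> b i}"
proof -
  define f where "f x = (if c \<le> x then 1 else 0 :: real)" for x
  have fI: "finite I" by (simp add: I_def)
  have count: "(\<Sum>i\<in>I. f (a i)) = real (card {i\<in>I. c \<le> a i})" for a
    using fI by (simp add: f_def sum.If_cases Int_def)
  \<comment> \<open>By symmetry of K, eigenvectors with different eigenvalues are orthogonal: either
    the overlap is 0 or the eigenvalues agree.\<close>
  have couple: "f (a i) * (v i \<bullet> w j)\<^sup>2 = f (b j) * (v i \<bullet> w j)\<^sup>2" if "i \<in> I" "j \<in> I" for i j
  proof -
    have "b j * (v i \<bullet> w j) = a i * (v i \<bullet> w j)"
      using sym[of "v i" "w j"] ev[OF that(1)] ew[OF that(2)] by (simp add: inner_commute)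
    then show ?thesis by auto
  qed
  have row: "(\<Sum>j\<in>I. (v i \<bullet> w j)\<^sup>2) = 1" if "i \<in> I" for i
    using orthonormal_expansion[of w "v i"] w v[OF that that] by (simp add: I_def inner_commute)
  have col: "(\<Sum>i\<in>I. (v i \<bullet> w j)\<^sup>2) = 1" if "j \<in> I" for j
    using orthonormal_expansion[of v "w j"] v w[OF that that] by (simp add: I_def)
  have "(\<Sum>i\<in>I. f (a i)) = (\<Sum>i\<in>I. \<Sum>j\<in>I. f (a i) * (v i \<bullet> w j)\<^sup>2)"
    by (simp add: sum_distrib_left[symmetric] row)
  also have "\<dots> = (\<Sum>i\<in>I. \<Sum>j\<in>I. f (b j) * (v i \<bullet> w j)\<^sup>2)"
    by (intro sum.cong refl couple)
  also have "\<dots> = (\<Sum>j\<in>I. \<Sum>i\<in>I. f (b j) * (v i \<bullet> w j)\<^sup>2)"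
    by (rule sum.swap)
  also have "\<dots> = (\<Sum>j\<in>I. f (b j))"
    by (simp add: sum_distrib_left[symmetric] col)
  finally show ?thesis unfolding count by simp
qed

text \<open>Take the threshold c = a_i. At least i entries of a reach it; if b_i were smaller,
  monotonicity would leave at most i - 1 entries of b that do.\<close>

lemma sorted_le_of_counts:
  fixes a b :: "nat \<Rightarrow> real"
  assumes sa: "\<And>i j. 1 \<le> i \<Longrightarrow> i \<le> j \<Longrightarrow> j \<le> n \<Longrightarrow> a j \<le> a i"
    and sb: "\<And>i j. 1 \<le> i \<Longrightarrow> i \<le> j \<Longrightarrow> j \<le> n \<Longrightarrow> b j \<le> b i"
    and count: "\<And>c. card {i\<in>{1..n}. c \<le> a i} \<le> card {i\<in>{1..n}. c \<le> b i}"
    and i: "i \<in> {1..n}"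
  shows "a i \<le> b i"
proof (rule ccontr)
  assume "\<not> a i \<le> b i"
  then have ba: "b i < a i" by simp
  have "{1..i} \<subseteq> {j\<in>{1..n}. a i \<le> a j}" using sa i by auto
  then have "i \<le> card {j\<in>{1..n}. a i \<le> a j}"
    using card_mono[of "{j\<in>{1..n}. a i \<le> a j}" "{1..i}"] by simp
  also have "\<dots> \<le> card {j\<in>{1..n}. a i \<le> b j}" by (rule count)
  also have "{j\<in>{1..n}. a i \<le> b j} \<subseteq> {1..<i}"
  proof
    fix j assume j: "j \<in> {j\<in>{1..n}. a i \<le> b j}"
    then have "\<not> i \<le> j" using sb[of i j] i ba by auto
    then show "j \<in> {1..<i}" using j by auto
  qed
  then have "card {j\<in>{1..n}. a i \<le> b j} \<le> card {1..<i}" by (intro card_mono) auto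
  finally have "i \<le> i - 1" by simp
  moreover have "1 \<le> i" using i by simp
  ultimately show False by arith
qed

text \<open>The two decompositions are given independently and their eigenvectors may differ for
  repeated eigenvalues; the sorted eigenvalue lists still agree because their counts above every
  threshold do.\<close>

lemma sorted_eigendecomp_shift:
  fixes H :: "real^'n^'n"
  assumes H: "sorted_eigendecomp H lam v" and K: "sorted_eigendecomp (H + e *\<^sub>R mat 1) lamq vq"
    and i: "i \<in> {1..CARD('n)}"
  shows "lamq i = lam i + e"
proof -
  note h = sorted_eigendecompD[OF H] and k = sorted_eigendecompD[OF K]
  have sl: "1 \<le> i \<Longrightarrow> i \<le> j \<Longrightarrow> j \<le> CARD('n) \<Longrightarrow> lam j + e \<le> lam i + e"
    and sq: "1 \<le> i \<Longrightarrow> i \<le> j \<Longrightarrow> j \<le> CARD('n) \<Longrightarrow> lamq j \<le> lamq i" for i j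
    using H K unfolding sorted_eigendecomp_def by auto
  have ev: "(H + e *\<^sub>R mat 1) *v v i = (lam i + e) *\<^sub>R v i" if "i \<in> {1..CARD('n)}" for i
    using h(3)[OF that] by (simp add: matrix_vector_mult_add_rdistrib scaleR_matrix_vector_assoc[symmetric] scaleR_add_left)
  have sym: "x \<bullet> ((H + e *\<^sub>R mat 1) *v y) = y \<bullet> ((H + e *\<^sub>R mat 1) *v x)" for x y
    unfolding k(2) by (simp add: mult_ac)
  have count: "card {i\<in>{1..CARD('n)}. c \<le> lam i + e} = card {i\<in>{1..CARD('n)}. c \<le> lamq i}" for c
    by (rule eigenvalue_count_eq[OF h(1) k(1) ev k(3) sym])
  show ?thesis
  proof (rule order_antisym)
    show "lamq i \<le> lam i + e"
      using sorted_le_of_counts[of "CARD('n)" lamq "\<lambda>i. lam i + e", OF sq sl _ i] count by simp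
    show "lam i + e \<le> lamq i"
      using sorted_le_of_counts[of "CARD('n)" "\<lambda>i. lam i + e" lamq, OF sl sq _ i] count by simp
  qed
qed

section \<open>Excess risk\<close>

lemma mnorm2_eigensum: "mnorm2 x (\<Sum>i\<in>I. c i *\<^sub>R outer (v i) (v i)) = (\<Sum>i\<in>I. c i * (v i \<bullet> x)\<^sup>2)"
  unfolding mnorm2_def inner_eigensum by (simp add: power2_eq_square)

lemma invertible_of_pos_def:
  fixes A :: "real^'n^'n"
  assumes "\<And>u. u \<noteq> 0 \<Longrightarrow> 0 < u \<bullet> (A *v u)"
  shows "invertible A"
proof -
  have "\<forall>x. A *v x = 0 \<longrightarrow> x = 0" using assms by (metis inner_zero_right less_irrefl)
  then show ?thesis by (simp add: invertible_left_inverse matrix_left_invertible_ker)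
qed

lemma matrix_inv_mult_vec:
  assumes "invertible (A::real^'n^'n)"
  shows "A *v (matrix_inv A *v x) = x" "matrix_inv A *v (A *v x) = x"
proof -
  have "A ** matrix_inv A = mat 1 \<and> matrix_inv A ** A = mat 1"
    using assms unfolding invertible_def matrix_inv_def by (rule someI_ex)
  then show "A *v (matrix_inv A *v x) = x" "matrix_inv A *v (A *v x) = x"
    by (simp_all add: matrix_vector_mul_assoc)
qed

context quantized_sgd begin

text \<open>For y = (v \<bullet> x)^2 the variance is nonnegative, so E[y^2] is at least (E y)^2,
  while the fourth-moment assumption bounds it by \<alpha> (E y)^2. This makes the step size small
  enough for every coordinate to contract.\<close>

lemma alpha_ge_1: "1 \<le> \<alpha>"
proof -
  obtain i where i: "i \<in> {1..CARD('n)}" using that[of 1] by (simp add: Suc_le_eq)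
  define k where "k = v i \<bullet> (K *v v i)"
  have k: "0 < k" unfolding k_def K_eigval[OF i] by (rule l_pos[OF i])
  have "has_bochner_integral Dq (\<lambda>z. ((v i \<bullet> fst z) * (v i \<bullet> fst z))\<^sup>2 - 2 * k * ((v i \<bullet> fst z) * (v i \<bullet> fst z)) + k\<^sup>2)
      (quartic (v i) (v i) - 2 * k * k + k\<^sup>2)"
    using fourth_rank1(1) unfolding k_def
    by (intro has_bochner_integral_add has_bochner_integral_diff has_bochner_integral_mult_right
        second_moment_Dq has_bochner_integral_const_prob Dq_pm) (simp add: has_bochner_integral_iff)
  moreover have "a\<^sup>2 - 2 * k * a + k\<^sup>2 = (a - k)\<^sup>2" for a
    by (simp add: power2_eq_square algebra_simps)
  ultimately have "has_bochner_integral Dq (\<lambda>z. ((v i \<bullet> fst z) * (v i \<bullet> fst z) - k)\<^sup>2) (quartic (v i) (v i) - 2 * k * k + k\<^sup>2)"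
    by (simp only:)
  from has_bochner_integral_nonneg[OF this] have "0 \<le> quartic (v i) (v i) - 2 * k * k + k\<^sup>2"
    by simp
  then have "k * k \<le> \<alpha> * (k * k)"
    using fourth_rank1(2)[of "v i" "v i"] unfolding k_def[symmetric] by (simp add: power2_eq_square mult.assoc)
  then show ?thesis using k by simp
qed

lemma gamma_alpha_trace: "\<gamma> * \<alpha> * trace K < 1"
  using \<gamma>_small alpha_trace_pos by (simp add: pos_less_divide_eq mult.assoc)

lemma gamma_l_le: "i \<in> {1..CARD('n)} \<Longrightarrow> \<gamma> * l i \<le> 1"
proof -
  assume i: "i \<in> {1..CARD('n)}"
  have "l i \<le> trace K"
    unfolding l_eig(4) by (rule member_le_sum[OF i]) (use l_pos in \<open>auto intro: less_imp_le\<close>)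
  also have "\<dots> \<le> \<alpha> * trace K"
    using alpha_ge_1 l_pos[OF i] \<open>l i \<le> trace K\<close> by (simp add: mult_le_cancel_right1)
  finally have "\<gamma> * l i \<le> \<gamma> * (\<alpha> * trace K)" using \<gamma>_pos by (intro mult_left_mono) auto
  then show ?thesis using gamma_alpha_trace by (simp add: mult.assoc)
qed

text \<open>The sign of \<open>\<sigma>2\<close> follows from the noise assumption, since
  \<open>\<sigma>2 * l i\<close> dominates a second moment and \<open>l i\<close> is
  positive.\<close>

lemma eff_noise_nonneg: "0 \<le> eff_noise"
proof -
  obtain i where i: "i \<in> {1..CARD('n)}" using that[of 1] by (simp add: Suc_le_eq)
  have "0 \<le> resid_moment (v i)" by (rule Bochner_Integration.integral_nonneg) simp
  then have "0 \<le> \<sigma>2 * l i" using noise_rank1(2)[of "v i"] unfolding K_eigval[OF i] by (rule order_trans)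
  then have "0 \<le> \<sigma>2" using l_pos[OF i] by (simp add: zero_le_mult_iff)
  moreover have "0 \<le> \<epsilon>p * (\<alpha> * trace K)" using \<epsilon>p_nonneg alpha_trace_pos by simp
  ultimately show ?thesis
    unfolding eff_noise_def using sq_eps_nonneg[OF Qa(3)] sq_eps_nonneg[OF Qo(3)] by (simp add: mult_ac)
qed

text \<open>In the eigenbasis the left side is half the expected K-energy of the averaged error,
  which is the accumulated error divided by N.\<close>

lemma averaged_K_error:
  assumes N: "1 \<le> N" and k: "k \<le> CARD('n)"
  shows "1 / (2 * (real N)\<^sup>2) * (\<Sum>i=1..CARD('n). l i * S N i) \<le>
    2 * ((eff_noise + (2 * \<alpha> / (real N * \<gamma>)) * (mnorm2 wq (head_id v k) + real N * \<gamma> * mnorm2 wq (tail_mat l v k)))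
        / (1 - \<gamma> * \<alpha> * trace K) * (real k / real N + real N * \<gamma>\<^sup>2 * (\<Sum>i\<in>{k<..CARD('n)}. (l i)\<^sup>2)))
    + 2 * (1 / (\<gamma>\<^sup>2 * (real N)\<^sup>2) * mnorm2 wq (head_inv l v k) + mnorm2 wq (tail_mat l v k))"
proof -
  have id: "mnorm2 wq (head_id v k) = (\<Sum>i=1..k. (v i \<bullet> wq)\<^sup>2)"
    using mnorm2_eigensum[of wq "\<lambda>_. 1" v "{1..k}"] by (simp add: head_id_def)
  show ?thesis
    unfolding id tail_mat_def head_inv_def mnorm2_eigensum l_eig(4)
  proof (rule spectral_recursion_bound[where U=U and A=A])
    show "S N i \<le> 2 * (\<Sum>j<N. (1 - \<gamma> * l i) ^ j) * (\<Sum>t<N. A t i)" if "i \<in> {1..CARD('n)}" for i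
      by (rule sum_of_correlated_le[where c="\<lambda>t. C t i" and s="\<lambda>t. S t i"])
         (use gamma_l_le[OF that] A_nonneg C_S_0 C_Suc[OF that] S_Suc in auto)
  qed (use gamma_l_le l_pos \<gamma>_pos alpha_ge_1 gamma_alpha_trace eff_noise_nonneg N k U_0 U_Suc A_nonneg
      in \<open>auto simp: l_eig(4) U_def\<close>)
qed

text \<open>The risk is half the quantized risk minus a ridge term and a constant. The ridge term
  helps at \<open>w\<close> and costs at \<open>wstar\<close>, where stationarity expresses its cost
  exactly by the two quadratic forms.\<close>

lemma excess_risk_le:
  assumes wstar_min: "\<And>w. risk D wstar \<le> risk D w"
    and Hn: "\<And>u. 0 \<le> u \<bullet> (second_moment D *v u)"
  shows "risk D w - risk D wstar \<le> 1 / 2 * ((w - wq) \<bullet> (K *v (w - wq)))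
    + (\<epsilon>l + (3 * \<epsilon>d / 2) * mnorm2 wstar (second_moment D ** matrix_inv K ** matrix_inv K ** second_moment D)
       + (\<epsilon>d\<^sup>2 / 2) * mnorm2 wstar (matrix_inv K ** second_moment D ** matrix_inv K))"
proof -
  define H where "H = second_moment D"
  have KH: "K *v x = H *v x + \<epsilon>d *\<^sub>R x" for x
    unfolding K_eq H_def by (simp add: matrix_vector_mult_add_rdistrib scaleR_matrix_vector_assoc[symmetric])
  have H_sym: "x \<bullet> (H *v y) = y \<bullet> (H *v x)" for x y
    using K_sym[of x y] unfolding KH by (simp add: inner_add_right inner_commute)
  note inv = matrix_inv_mult_vec[OF invertible_of_pos_def[OF K_pos]]
  have ed: "0 \<le> \<epsilon>d" by (rule vq_eps_nonneg[OF Qd])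
  have el: "0 \<le> \<epsilon>l" by (rule sq_eps_nonneg[OF Ql(3)])
  have risk: "risk D x = (qrisk Dq wq + (x - wq) \<bullet> (K *v (x - wq)) - \<epsilon>l - \<epsilon>d * (x \<bullet> x)) / 2" for x
    using qrisk_eq[of x] qrisk_shift[of "x - wq"] by simp
  \<comment> \<open>The normal equation of \<open>wstar\<close>, read off from the quantized risk
    with the ridge term subtracted.\<close>
  have stat: "K *v (wstar - wq) = \<epsilon>d *\<^sub>R wstar"
  proof -
    have "u \<bullet> (K *v (wstar - wq)) = u \<bullet> (\<epsilon>d *\<^sub>R wstar)" for u
    proof -
      have "0 \<le> t * (u \<bullet> (K *v (wstar - wq)) - \<epsilon>d * (u \<bullet> wstar)) + t * t * ((u \<bullet> (K *v u) - \<epsilon>d * (u \<bullet> u)) / 2)" for t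
      proof -
        define d where "d = wstar - wq"
        have X: "(d + t *\<^sub>R u) \<bullet> (K *v (d + t *\<^sub>R u)) = d \<bullet> (K *v d) + 2 * t * (u \<bullet> (K *v d)) + t * t * (u \<bullet> (K *v u))"
          using K_sym[of d u]
          by (simp add: matrix_vector_right_distrib matrix_vector_mult_scaleR inner_add_left inner_add_right algebra_simps)
        have Y: "(wstar + t *\<^sub>R u) \<bullet> (wstar + t *\<^sub>R u) = wstar \<bullet> wstar + 2 * t * (u \<bullet> wstar) + t * t * (u \<bullet> u)"
          by (simp add: inner_add_left inner_add_right inner_commute)
        have Z: "wstar + t *\<^sub>R u - wq = d + t *\<^sub>R u" by (simp add: d_def)
        show ?thesis
          using wstar_min[of "wstar + t *\<^sub>R u"] unfolding risk Z X Y d_def[symmetric] by (simp add: field_simps)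
      qed
      from linear_coefficient_zero[OF this] show ?thesis by simp
    qed
    then show ?thesis using vector_eq_ldot[of "K *v (wstar - wq)" "\<epsilon>d *\<^sub>R wstar"] by blast
  qed
  \<comment> \<open>In terms of \<open>a\<close> one has wstar = K a, wq = H a and wstar - wq =
    \<epsilon>d a; the second relation holds because H commutes with K = H + \<epsilon>d I.\<close>
  define a where "a = matrix_inv K *v wstar"
  have Ka: "K *v a = wstar" unfolding a_def by (rule inv)
  have w_a: "wstar = H *v a + \<epsilon>d *\<^sub>R a" using Ka KH by simp
  have Kwq: "K *v wq = H *v wstar"
    using stat KH[of wstar] by (simp add: matrix_vector_mult_diff_distrib)
  have "K *v (H *v a) = H *v wstar"
    unfolding KH[of "H *v a"] w_a by (simp add: matrix_vector_right_distrib matrix_vector_mult_scaleR)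
  then have wq_a: "wq = H *v a" using Kwq inv(2) by metis
  have d_a: "wstar - wq = \<epsilon>d *\<^sub>R a" using w_a wq_a by simp
  have "(wstar - wq) \<bullet> (K *v (wstar - wq)) = \<epsilon>d\<^sup>2 * (a \<bullet> wstar)"
    unfolding d_a by (simp add: matrix_vector_mult_scaleR Ka power2_eq_square)
  moreover have "wstar \<bullet> wstar = wstar \<bullet> wq + \<epsilon>d * (a \<bullet> wstar)"
    using d_a by (metis add.commute diff_add_cancel inner_add_right inner_commute inner_scaleR_right)
  moreover have "wstar \<bullet> wq = wq \<bullet> wq + \<epsilon>d * (a \<bullet> (H *v a))"
    using d_a wq_a by (metis add.commute diff_add_cancel inner_add_left inner_scaleR_left)
  ultimately have opt: "\<epsilon>d * (wstar \<bullet> wstar) - (wstar - wq) \<bullet> (K *v (wstar - wq)) = \<epsilon>d * (wq \<bullet> wq) + \<epsilon>d\<^sup>2 * (a \<bullet> (H *v a))"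
    by (simp add: power2_eq_square algebra_simps)
  have m1: "mnorm2 wstar (H ** matrix_inv K ** matrix_inv K ** H) = wq \<bullet> wq"
  proof -
    define c where "c = matrix_inv K *v wq"
    have "mnorm2 wstar (H ** matrix_inv K ** matrix_inv K ** H) = wstar \<bullet> (H *v c)"
      using inv(2)[of wq] unfolding mnorm2_def c_def Kwq by (simp add: matrix_vector_mul_assoc[symmetric])
    also have "\<dots> = c \<bullet> (K *v wq)" unfolding Kwq by (rule H_sym)
    also have "\<dots> = wq \<bullet> (K *v c)" by (rule K_sym)
    finally show ?thesis by (simp add: c_def inv)
  qed
  have m2: "mnorm2 wstar (matrix_inv K ** H ** matrix_inv K) = a \<bullet> (H *v a)"
  proof -
    have "mnorm2 wstar (matrix_inv K ** H ** matrix_inv K) = (K *v a) \<bullet> (matrix_inv K *v (H *v a))"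
      unfolding mnorm2_def Ka by (simp add: matrix_vector_mul_assoc[symmetric] a_def)
    also have "\<dots> = a \<bullet> (K *v (matrix_inv K *v (H *v a)))" using K_sym inner_commute by metis
    finally show ?thesis by (simp add: inv)
  qed
  have Haa: "0 \<le> a \<bullet> (H *v a)" unfolding H_def by (rule Hn)
  \<comment> \<open>An exact identity. Dropping the ridge term at \<open>w\<close>, enlarging the
    coefficient 1/2 to 3/2 and adding \<epsilon>l \<ge> 0 give the stated form.\<close>
  have "risk D w - risk D wstar = 1 / 2 * ((w - wq) \<bullet> (K *v (w - wq))) - \<epsilon>d / 2 * (w \<bullet> w)
     + 1 / 2 * (\<epsilon>d * (wq \<bullet> wq) + \<epsilon>d\<^sup>2 * (a \<bullet> (H *v a)))"
    unfolding risk[of w] risk[of wstar] opt[symmetric] by (simp add: field_simps)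
  moreover have "0 \<le> \<epsilon>d * (w \<bullet> w)" "0 \<le> \<epsilon>d * (wq \<bullet> wq)" using ed by auto
  ultimately show ?thesis
    unfolding H_def[symmetric] m1 m2 using el by (simp add: algebra_simps)
qed

text \<open>The excess risk is nonnegative, so \<open>ennreal\<close> truncates nothing, and the
  integrable majorant \<open>G\<close> shows that its expectation is finite.\<close>

lemma expected_excess_risk:
  assumes N: "1 \<le> N" and k: "k \<le> CARD('n)"
    and wstar_min: "\<And>w. risk D wstar \<le> risk D w"
    and Hn: "\<And>u. 0 \<le> u \<bullet> (second_moment D *v u)"
  shows "(\<integral>\<^sup>+ s. ennreal (risk D ((1 / real N) *\<^sub>R snd s) - risk D wstar) \<partial>TR N)
    \<le> ennreal (\<epsilon>l + (3 * \<epsilon>d / 2) * mnorm2 wstar (second_moment D ** matrix_inv K ** matrix_inv K ** second_moment D)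
       + (\<epsilon>d\<^sup>2 / 2) * mnorm2 wstar (matrix_inv K ** second_moment D ** matrix_inv K)
       + 2 * ((eff_noise + (2 * \<alpha> / (real N * \<gamma>)) * (mnorm2 wq (head_id v k) + real N * \<gamma> * mnorm2 wq (tail_mat l v k)))
        / (1 - \<gamma> * \<alpha> * trace K) * (real k / real N + real N * \<gamma>\<^sup>2 * (\<Sum>i\<in>{k<..CARD('n)}. (l i)\<^sup>2)))
       + 2 * (1 / (\<gamma>\<^sup>2 * (real N)\<^sup>2) * mnorm2 wq (head_inv l v k) + mnorm2 wq (tail_mat l v k)))"
proof -
  define approx where "approx = \<epsilon>l + (3 * \<epsilon>d / 2) * mnorm2 wstar (second_moment D ** matrix_inv K ** matrix_inv K ** second_moment D)
       + (\<epsilon>d\<^sup>2 / 2) * mnorm2 wstar (matrix_inv K ** second_moment D ** matrix_inv K)"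
  define G where "G s = 1 / (2 * (real N)\<^sup>2) * (\<Sum>i=1..CARD('n). l i * (v i \<bullet> (snd s - real N *\<^sub>R wq))\<^sup>2) + approx"
    for s :: "(real^'n) \<times> (real^'n)"
  have le: "risk D ((1 / real N) *\<^sub>R snd s) - risk D wstar \<le> G s" for s :: "(real^'n) \<times> (real^'n)"
  proof -
    have x: "(1 / real N) *\<^sub>R snd s - wq = (1 / real N) *\<^sub>R (snd s - real N *\<^sub>R wq)"
      using N by (simp add: scaleR_diff_right)
    have "1 / 2 * (((1 / real N) *\<^sub>R snd s - wq) \<bullet> (K *v ((1 / real N) *\<^sub>R snd s - wq)))
        = 1 / (2 * (real N)\<^sup>2) * ((snd s - real N *\<^sub>R wq) \<bullet> (K *v (snd s - real N *\<^sub>R wq)))"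
      unfolding x by (simp add: matrix_vector_mult_scaleR power2_eq_square)
    also have "\<dots> = G s - approx"
      unfolding G_def l_eig(2) by (simp add: power2_eq_square)
    finally show ?thesis
      using excess_risk_le[OF wstar_min Hn, of "(1 / real N) *\<^sub>R snd s"] unfolding approx_def[symmetric] by linarith
  qed
  have G0: "0 \<le> G s" for s :: "(real^'n) \<times> (real^'n)"
    by (rule order_trans[OF _ le]) (simp add: wstar_min)
  have hG: "has_bochner_integral (TR N) G (1 / (2 * (real N)\<^sup>2) * (\<Sum>i=1..CARD('n). l i * S N i) + approx)"
    unfolding G_def
    by (intro has_bochner_integral_add has_bochner_integral_mult_right has_bochner_integral_sum hS
        has_bochner_integral_const_prob TR_pm)
  have "(\<integral>\<^sup>+ s. ennreal (risk D ((1 / real N) *\<^sub>R snd s) - risk D wstar) \<partial>TR N) \<le> (\<integral>\<^sup>+ s. ennreal (G s) \<partial>TR N)"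
    by (intro nn_integral_mono ennreal_leI le)
  also have "\<dots> = ennreal (\<integral>s. G s \<partial>TR N)"
    by (rule nn_integral_eq_integral[OF integrable.intros[OF hG]]) (simp add: G0)
  also have "\<dots> = ennreal (1 / (2 * (real N)\<^sup>2) * (\<Sum>i=1..CARD('n). l i * S N i) + approx)"
    using hG by (simp add: has_bochner_integral_iff)
  also have "\<dots> \<le> ennreal (approx
       + 2 * ((eff_noise + (2 * \<alpha> / (real N * \<gamma>)) * (mnorm2 wq (head_id v k) + real N * \<gamma> * mnorm2 wq (tail_mat l v k)))
        / (1 - \<gamma> * \<alpha> * trace K) * (real k / real N + real N * \<gamma>\<^sup>2 * (\<Sum>i\<in>{k<..CARD('n)}. (l i)\<^sup>2)))
       + 2 * (1 / (\<gamma>\<^sup>2 * (real N)\<^sup>2) * mnorm2 wq (head_inv l v k) + mnorm2 wq (tail_mat l v k)))"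
    using averaged_K_error[OF N k] by (intro ennreal_leI) linarith
  finally show ?thesis unfolding approx_def .
qed

end

theorem theoremF2:
  fixes D :: "((real^'n) \<times> real) measure"
    and Qd Qp :: "real^'n \<Rightarrow> (real^'n) measure"
    and Ql Qa Qo :: "real \<Rightarrow> real measure"
    and \<epsilon>d \<epsilon>l \<epsilon>p \<epsilon>a \<epsilon>o \<alpha> \<sigma>2 \<gamma> :: real
    and B N :: nat
    and H :: "real^'n^'n"
    and wstar wqstar :: "real^'n"
    and lam lamq :: "nat \<Rightarrow> real"
    and v vq :: "nat \<Rightarrow> real^'n"
  assumes D_prob: "prob_space D" and D_sets: "sets D = sets borel"
    and D_x2: "integrable D (\<lambda>z. (norm (fst z))^2)"
    and D_y2: "integrable D (\<lambda>z. (snd z)^2)"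
    and H_def: "H = second_moment D"
    and H_pd: "\<forall>u. u \<noteq> 0 \<longrightarrow> u \<bullet> (H *v u) > 0"
    and H_eig: "sorted_eigendecomp H lam v"
    and wstar_min: "\<forall>w. risk D wstar \<le> risk D w"
    and Qd_q: "vec_quantizer Qd" "coordinatewise_vq Qd" "unbiased_vq Qd" "additive_vq \<epsilon>d Qd"
    and Qp_q: "vec_quantizer Qp" "coordinatewise_vq Qp" "unbiased_vq Qp" "additive_vq \<epsilon>p Qp"
    and Ql_q: "scal_quantizer Ql" "unbiased_sq Ql" "additive_sq \<epsilon>l Ql"
    and Qa_q: "scal_quantizer Qa" "unbiased_sq Qa" "additive_sq \<epsilon>a Qa"
    and Qo_q: "scal_quantizer Qo" "unbiased_sq Qo" "additive_sq \<epsilon>o Qo"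
    and Hq_eig: "sorted_eigendecomp (second_moment (qdata D Qd Ql)) lamq vq"
    and wqstar_min: "\<forall>w. qrisk (qdata D Qd Ql) wqstar \<le> qrisk (qdata D Qd Ql) w"
    and fourth: "fourth_moment_assm \<alpha> B (qdata D Qd Ql)"
    and noise: "noise_assm \<sigma>2 wqstar (qdata D Qd Ql)"
    and B_pos: "B \<ge> 1" and N_pos: "N \<ge> 1"
    and \<gamma>_pos: "\<gamma> > 0"
    and \<gamma>_small: "\<gamma> < 1 / (\<alpha> * trace (H + \<epsilon>d *\<^sub>R mat 1))"
  shows
    "(let Hd = H + \<epsilon>d *\<^sub>R mat 1;
          k = kstar CARD('n) lamq N \<gamma>;
          ApproxErr = \<epsilon>l
            + (3 * \<epsilon>d / 2) * mnorm2 wstar (H ** matrix_inv Hd ** matrix_inv Hd ** H)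
            + (\<epsilon>d^2 / 2) * mnorm2 wstar (matrix_inv Hd ** H ** matrix_inv Hd);
          BiasErr = 1 / (\<gamma>^2 * (real N)^2) * mnorm2 wqstar (head_inv lamq vq k)
            + mnorm2 wqstar (tail_mat lamq vq k);
          \<sigma>A2 = (\<epsilon>o + \<epsilon>a) / real B + \<alpha> * \<epsilon>p * trace Hd + \<sigma>2 / real B;
          VarErr = (\<sigma>A2 + (2 * \<alpha> / (real N * \<gamma>)) *
                      (mnorm2 wqstar (head_id vq k) + real N * \<gamma> * mnorm2 wqstar (tail_mat lamq vq k)))
                   / (1 - \<gamma> * \<alpha> * trace Hd)
                   * (real k / real N + real N * \<gamma>^2 * (\<Sum>i\<in>{k<..CARD('n)}. (lam i + \<epsilon>d)^2))
      in (\<integral>\<^sup>+ s. ennreal (risk D ((1 / real N) *\<^sub>R snd s) - risk D wstar)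
             \<partial>(sgd_traj D Qd Ql Qp Qa Qo \<gamma> B N))
         \<le> ennreal (ApproxErr + 2 * VarErr + 2 * BiasErr))"
proof -
  \<comment> \<open>The data locale comes first: its \<open>K_eq\<close> translates the hypotheses
    on H into those of the second locale.\<close>
  interpret quantized_data D Qd Ql \<epsilon>d \<epsilon>l
    by (rule quantized_data.intro) (fact D_prob D_sets D_x2 D_y2 Qd_q(1,3,4) Ql_q)+
  have Hd: "second_moment (qdata D Qd Ql) = H + \<epsilon>d *\<^sub>R mat 1"
    unfolding H_def by (rule K_eq)
  have ed: "0 \<le> \<epsilon>d" by (rule vq_eps_nonneg[OF Qd])
  have Hn: "0 \<le> u \<bullet> (second_moment D *v u)" for u
    using H_pd[rule_format, of u] unfolding H_def by (cases "u = 0") auto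
  interpret quantized_sgd D Qd Ql \<epsilon>d \<epsilon>l Qp Qa Qo \<epsilon>p \<epsilon>a \<epsilon>o \<alpha> \<sigma>2 \<gamma> B wqstar lamq vq
  proof unfold_locales
    show "0 < u \<bullet> (second_moment (qdata D Qd Ql) *v u)" if "u \<noteq> 0" for u
      using H_pd[rule_format, OF that] ed
      by (simp add: Hd matrix_vector_mult_add_rdistrib inner_add_right scaleR_matrix_vector_assoc[symmetric] add_pos_nonneg)
    show "\<gamma> < 1 / (\<alpha> * trace (second_moment (qdata D Qd Ql)))"
      unfolding Hd by (rule \<gamma>_small)
    show "qrisk (qdata D Qd Ql) wqstar \<le> qrisk (qdata D Qd Ql) w" for w
      using wqstar_min by blast
  qed (fact Qp_q(1,3,4) Qa_q Qo_q Hq_eig fourth noise B_pos \<gamma>_pos)+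
  let ?k = "kstar CARD('n) lamq N \<gamma>"
  \<comment> \<open>The explicit 0 keeps the set nonempty, so k = 0 if no eigenvalue reaches the
    threshold.\<close>
  have k: "?k \<le> CARD('n)"
    unfolding kstar_def by (subst Max_le_iff) auto
  have ws: "risk D wstar \<le> risk D w" for w using wstar_min by blast
  \<comment> \<open>The variance tail is written with shifted eigenvalues of H, while the recursion
    speaks of those of the quantized second moment.\<close>
  have lam: "(\<Sum>i\<in>{?k<..CARD('n)}. (lam i + \<epsilon>d)\<^sup>2) = (\<Sum>i\<in>{?k<..CARD('n)}. (lamq i)\<^sup>2)"
    by (intro sum.cong refl)
       (simp add: sorted_eigendecomp_shift[OF H_eig Hq_eig[unfolded Hd]])
  show ?thesis
    using expected_excess_risk[OF N_pos k ws Hn]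
    unfolding Let_def lam Hd eff_noise_def H_def[symmetric] .
qed

end
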